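(* Let $f\in\mathfrak L^{H}$, $f=z^{\alpha}+\mathrm{h.o.t.}$, $\alpha\in\mathbb R_{>0}$, $\alpha\neq 1$, be a strongly hyperbolic logarithmic transseries. Then: 1. There exists a unique solution $\varphi\in\mathfrak L^{0}$ of the normalization equation $$\varphi\circ f\circ\varphi^{-1}=z^{\alpha}.$$ Moreover, $\mathrm{ord}_z(\varphi-\mathrm{id})\ge \mathrm{ord}_z(f-z^{\alpha})-\alpha+1$. Additionally, if $f\in\mathcal L_k^{H}$, then $\varphi\in\mathcal L_k^{0}$. 2. Let $\alpha>1$. For every initial condition $h\in\mathfrak L^{0}$, the Böttcher sequence $$\left(z^{\frac1{\alpha^{n}}}\circ h\circ f^{\circ n}\right)_{n}$$ converges to the normalization $\varphi$ in the weak topology on $\mathfrak L^{0}$, as $n$ tends to $+\infty$. Moreover, this sequence converges in the power-metric topology on $\mathfrak L^{0}$ if and only if the initial condition $h$ is such that $\mathrm{Lb}_z(h)=\mathrm{Lb}_z(\varphi)$. 3. Let $f\in\mathcal L_k$, $k\in\mathbb N$. The support $\mathrm{Supp}(\varphi)$ is contained in the (additive) semigroup generated by $(\alpha^{p},\mathbf 0_k)$, $p\in\mathbb N$; the elements $(0,1,0,\dots,0),\dots,(0,0,\dots,0,1)\in\mathbb R\times\mathbb Z^{k}$; and $(\alpha^{m}(\gamma-\alpha),\mathbf n)$, for $(\gamma,\mathbf n)\in\mathrm{Supp}(f-z^{\alpha})$, $m\in\mathbb N$.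
   Context: $\mathbb N=\{0,1,2,\dots\}$. Let $\boldsymbol\ell_1:=-\frac1{\log z}$, $\boldsymbol\ell_{n+1}:=\boldsymbol\ell_1\circ\boldsymbol\ell_n$ (formal symbols), and let $\mathbf 0_k$ be the zero multi-index of length $k$. For $k\in\mathbb N$, $\mathcal L_k^{\infty}$ is the set of formal sums $$f=\sum_{(\beta,\mathbf n)\in\mathbb R\times\mathbb Z^k}a_{\beta,\mathbf n}\,z^{\beta}\boldsymbol\ell_1^{n_1}\cdots\boldsymbol\ell_k^{n_k},\qquad a_{\beta,\mathbf n}\in\mathbb R,$$ whose support $\mathrm{Supp}(f)=\{(\beta,\mathbf n):a_{\beta,\mathbf n}\ne0\}$ is well-ordered for the lexicographic order. $\mathcal L_k\subseteq\mathcal L_k^\infty$ consists of $0$ and those $f\neq 0$ with $\min\mathrm{Supp}(f)>\mathbf 0_{k+1}$. Identifying $\mathbb R\times\mathbb Z^k$ with a subset of $\mathbb R\times\mathbb Z^{k+1}$ (append $0$), $\mathcal L_k\subseteq\mathcal L_{k+1}$ and $\mathcal L^\infty_k\subseteq\mathcal L_{k+1}^\infty$; put $\mathfrak L=\bigcup_k\mathcal L_k$, $\mathfrak L^{\infty}=\bigcup_k\mathcal L_k^\infty$. Elements of $\mathfrak L$ are called logarithmic transseries. $\mathfrak L^{\infty}$ is a differential algebra for $\frac{d}{dz}$. $\mathrm{ord}(f):=\min\mathrm{Supp}(f)$, $\mathrm{ord}(0):=+\infty$. Grouping terms by the power of $z$, $f=\sum_{\beta}z^{\beta}R_\beta$ with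 $R_\beta$ involving only $\boldsymbol\ell_1,\dots,\boldsymbol\ell_k$; $\mathrm{ord}_z(f):=\min\{\beta:R_\beta\ne0\}$, $\mathrm{ord}_z(0):=+\infty$, and the leading block is $\mathrm{Lb}_z(f):=z^{\gamma}R_{\gamma}$, $\gamma=\mathrm{ord}_z(f)$. "$f=g+\mathrm{h.o.t.}$" means that the order of every term of $g$ is strictly smaller than $\mathrm{ord}(f-g)$. $\mathcal L_k^{H}$ is the set of $f\in\mathcal L_k$ of the form $f=\lambda z^{\alpha}+\mathrm{h.o.t.}$ with $\alpha,\lambda>0$; $\mathcal L_k^{0}$ is the subset with $\alpha=\lambda=1$ (parabolic); $\mathfrak L^H=\bigcup_k\mathcal L_k^H$, $\mathfrak L^0=\bigcup_k\mathcal L_k^0$. $f\in\mathfrak L^H$ is strongly hyperbolic if $\alpha\ne1$. Composition: for $f=\lambda z^{\alpha}+f_1\in\mathcal L_k^H$ with $\mathrm{ord}(f_1)>(\alpha,\mathbf 0_k)$, put $\log z\circ f:=\log\lambda+\alpha\log z+\sum_{i\ge1}\frac{(-1)^{i+1}}{i}\left(\frac{f_1}{\lambda z^\alpha}\right)^i$ and $z^{\beta}\circ f:=\lambda^{\beta}z^{\alpha\beta}\sum_{i\ge0}\binom{\beta}{i}\left(\frac{f_1}{\lambda z^{\alpha}}\right)^i$; using these formulas term by term defines $g(\lambda z^{\alpha})$ for $g\in\mathcal L_k$, and $g\circ f:=g(\lambda z^{\alpha})+\sum_{i\ge1}\frac{g^{(i)}(\lambda z^{\alpha})}{i!}f_1^{i}$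 (the series converge in the weak topology). $\mathcal L_k^{H}$ is a group under composition with identity $\mathrm{id}=z$, and $\mathcal L_k^0$ is a subgroup; $f^{\circ n}$ is the $n$-fold composition. Power-metric topology: induced by $d_z(f,g)=2^{-\mathrm{ord}_z(f-g)}$ for $f\ne g$, $d_z(f,f)=0$. Weak topology: the topology of $\mathfrak L^\infty$ as a subspace of $\mathbb R^{\mathbb R\times\mathbb Z^{\mathbb N}}$ with the product topology (Euclidean topology on each coordinate), i.e. coefficientwise convergence. Subsets carry the relative topologies.
   Formalization: Item 3 is proved as stated for α>1; for α<1 the exponents p and m range over all integers instead of ℕ, since the stated inclusion fails there (e.g. f=z^α+z^(α+δ), α=9/10, δ irrational, where φ has the term z^(1+δ/α)). *)

theory Defs
  imports "HOL-Analysis.Analysis" "HOL-Library.Extended" "HOL-Algebra.Group"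
begin

section \<open>Logarithmic monomials and their lexicographic order\<close>

text \<open>
  The monomial \<open>z\<^sup>\<beta> \<ell>\<^sub>1\<^bsup>n\<^sub>1\<^esup> \<dots> \<ell>\<^sub>k\<^bsup>n\<^sub>k\<^esup>\<close> is encoded as
  \<open>LMon \<beta> n\<close> with \<open>n :: nat \<Rightarrow> int\<close>, where \<open>n i\<close> is the exponent of \<open>\<ell>\<^bsub>i+1\<^esub>\<close> (indices are
  shifted by one) and \<open>n i = 0\<close> for \<open>i \<ge> k\<close>. The inclusions \<open>\<real> \<times> \<int>\<^sup>k \<subseteq> \<real> \<times> \<int>\<^bsup>k+1\<^esup>\<close> thus become
  equalities of elements. Addition of multi-indices is multiplication of monomials.
\<close>

datatype lmon = LMon (zexp: real) (lexp: "nat \<Rightarrow> int")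

instantiation lmon :: linordered_ab_group_add
begin

definition "0 = LMon 0 (\<lambda>_. 0)"
definition "a + b = LMon (zexp a + zexp b) (\<lambda>i. lexp a i + lexp b i)"
definition "- a = LMon (- zexp a) (\<lambda>i. - lexp a i)"
definition "a - b = LMon (zexp a - zexp b) (\<lambda>i. lexp a i - lexp b i)"

definition less_lmon :: "lmon \<Rightarrow> lmon \<Rightarrow> bool" where
  "a < b \<longleftrightarrow> zexp a < zexp b \<or>
     (zexp a = zexp b \<and> (\<exists>i. lexp a i < lexp b i \<and> (\<forall>j<i. lexp a j = lexp b j)))"

definition less_eq_lmon :: "lmon \<Rightarrow> lmon \<Rightarrow> bool" where
  "less_eq_lmon a b \<longleftrightarrow> a < b \<or> a = b"

instance
proof
  fix a b c :: lmon
  show "a + b + c = a + (b + c)" "a + b = b + a" "0 + a = a" "- a + a = 0" "a - b = a + - b"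
    by (auto simp: plus_lmon_def zero_lmon_def uminus_lmon_def minus_lmon_def algebra_simps)
  have irr: "\<not> a < a" for a :: lmon
    by (auto simp: less_lmon_def)
  have tr: "a < c" if "a < b" "b < c" for a b c :: lmon
  proof (cases "zexp a < zexp b \<or> zexp b < zexp c")
    case True
    then show ?thesis using that by (auto simp: less_lmon_def)
  next
    case False
    with that obtain i j where
      i: "lexp a i < lexp b i" "\<And>l. l < i \<Longrightarrow> lexp a l = lexp b l" and
      j: "lexp b j < lexp c j" "\<And>l. l < j \<Longrightarrow> lexp b l = lexp c l" and
      z: "zexp a = zexp b" "zexp b = zexp c"
      by (auto simp: less_lmon_def)
    have "lexp a (min i j) < lexp c (min i j)"
      using i j by (cases i j rule: linorder_cases) (auto simp: min_def)
    moreover have "\<forall>l < min i j. lexp a l = lexp c l"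
      using i j by auto
    ultimately show ?thesis using z by (auto simp: less_lmon_def)
  qed
  show "a < b \<longleftrightarrow> a \<le> b \<and> \<not> b \<le> a"
    using irr tr by (auto simp: less_eq_lmon_def)
  show "a \<le> a" by (simp add: less_eq_lmon_def)
  show "a \<le> c" if "a \<le> b" "b \<le> c" using that tr by (auto simp: less_eq_lmon_def)
  show "a = b" if "a \<le> b" "b \<le> a" using that irr tr by (auto simp: less_eq_lmon_def)
  show "a \<le> b \<or> b \<le> a"
  proof (cases "zexp a = zexp b \<and> a \<noteq> b")
    case True
    then have "\<exists>i. lexp a i \<noteq> lexp b i"
      by (metis ext lmon.expand)
    define i where "i = (LEAST i. lexp a i \<noteq> lexp b i)"
    have "lexp a i \<noteq> lexp b i"
      unfolding i_def using \<open>\<exists>i. lexp a i \<noteq> lexp b i\<close> by (rule LeastI_ex)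
    moreover have "\<forall>j<i. lexp a j = lexp b j"
      unfolding i_def using not_less_Least by blast
    ultimately have "a < b \<or> b < a"
      using True unfolding less_lmon_def by (metis linorder_less_linear)
    then show ?thesis by (auto simp: less_eq_lmon_def)
  next
    case False
    then show ?thesis by (auto simp: less_eq_lmon_def less_lmon_def)
  qed
  show "c + a \<le> c + b" if "a \<le> b"
    using that by (auto simp: less_eq_lmon_def less_lmon_def plus_lmon_def)
qed

end

definition lunit :: "nat \<Rightarrow> lmon" where
  "lunit j = LMon 0 (\<lambda>i. if i = j then 1 else 0)"


section \<open>Logarithmic transseries\<close>

text \<open>
  A transseries is its coefficient function; the carriers \<open>Linf k\<close>, \<open>Lts k\<close>, ... single out the
  admissible ones. The operations below are total on coefficient functions and are meaningful on
  the carriers, where all the coefficientwise sums reduce to finite ones.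
\<close>

type_synonym lts = "lmon \<Rightarrow> real"

definition supp :: "lts \<Rightarrow> lmon set" where
  "supp f = {a. f a \<noteq> 0}"

definition well_ordered :: "lmon set \<Rightarrow> bool" where
  "well_ordered S \<longleftrightarrow> (\<forall>A\<subseteq>S. A \<noteq> {} \<longrightarrow> (\<exists>m\<in>A. \<forall>a\<in>A. m \<le> a))"

definition lead :: "lts \<Rightarrow> lmon" where
  "lead f = (LEAST a. a \<in> supp f)"

definition lts_ord :: "lts \<Rightarrow> lmon extended" where
  "lts_ord f = (if supp f = {} then Pinf else Fin (lead f))"

definition hot :: "lts \<Rightarrow> lts \<Rightarrow> bool"  \<comment> \<open>\<open>f = g + h.o.t.\<close>\<close> where
  "hot f g \<longleftrightarrow> (\<forall>a\<in>supp g. Fin a < lts_ord (f - g))"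

definition ord_z :: "lts \<Rightarrow> ereal" where
  "ord_z f = (if supp f = {} then infinity else ereal (LEAST \<beta>. \<exists>n. LMon \<beta> n \<in> supp f))"

definition Lb_z :: "lts \<Rightarrow> lts" where
  "Lb_z f = (\<lambda>a. if ereal (zexp a) = ord_z f then f a else 0)"

definition Linf :: "nat \<Rightarrow> lts set" where
  "Linf k = {f. well_ordered (supp f) \<and> (\<forall>a\<in>supp f. \<forall>i\<ge>k. lexp a i = 0)}"

definition Lts :: "nat \<Rightarrow> lts set" where
  "Lts k = {f \<in> Linf k. 0 < lts_ord f}"

definition frakLinf :: "lts set" where
  "frakLinf = (\<Union>k. Linf k)"

definition lmonom :: "lmon \<Rightarrow> lts" where
  "lmonom a = (\<lambda>c. if c = a then 1 else 0)"

definition zpow :: "real \<Rightarrow> lts" where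
  "zpow \<beta> = lmonom (LMon \<beta> (\<lambda>_. 0))"

definition scale_lts :: "real \<Rightarrow> lts \<Rightarrow> lts" where
  "scale_lts r f = (\<lambda>c. r * f c)"

definition LH :: "nat \<Rightarrow> lts set" where
  "LH k = {f \<in> Lts k. \<exists>\<alpha> \<mu>. 0 < \<alpha> \<and> 0 < \<mu> \<and> hot f (scale_lts \<mu> (zpow \<alpha>))}"

definition L0 :: "nat \<Rightarrow> lts set" where
  "L0 k = {f \<in> Lts k. hot f (zpow 1)}"

definition frakLH :: "lts set" where
  "frakLH = (\<Union>k. LH k)"

definition frakL0 :: "lts set" where
  "frakL0 = (\<Union>k. L0 k)"


section \<open>Algebra, derivation and logarithm\<close>

definition mult_lts :: "lts \<Rightarrow> lts \<Rightarrow> lts" where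
  "mult_lts f g = (\<lambda>c. \<Sum>a | a \<in> supp f \<and> c - a \<in> supp g. f a * g (c - a))"

primrec power_lts :: "lts \<Rightarrow> nat \<Rightarrow> lts" where
  "power_lts f 0 = lmonom 0"
| "power_lts f (Suc n) = mult_lts f (power_lts f n)"

text \<open>The infinitesimal part \<open>\<epsilon>\<close> in \<open>f = \<mu> m (1 + \<epsilon>)\<close>, where \<open>\<mu> m\<close> is the leading term of \<open>f\<close>.\<close>

definition eps_lts :: "lts \<Rightarrow> lts" where
  "eps_lts f = (\<lambda>c. f (c + lead f) / f (lead f)) - lmonom 0"

text \<open>\<open>1 / f = \<mu>\<^bsup>-1\<^esup> m\<^bsup>-1\<^esup> \<Sum>\<^sub>i (-\<epsilon>)\<^sup>i\<close>\<close>

definition recip_lts :: "lts \<Rightarrow> lts" where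
  "recip_lts f = (\<lambda>c. (\<Sum>i. (-1) ^ i * power_lts (eps_lts f) i (c + lead f)) / f (lead f))"

definition powi_lts :: "lts \<Rightarrow> int \<Rightarrow> lts" where
  "powi_lts f n = (if 0 \<le> n then power_lts f (nat n) else power_lts (recip_lts f) (nat (- n)))"

text \<open>
  For \<open>f = \<mu> z\<^sup>\<beta> \<ell>\<^sub>1\<^bsup>n\<^sub>1\<^esup> \<dots> \<ell>\<^sub>k\<^bsup>n\<^sub>k\<^esup> (1 + \<epsilon>)\<close>,
  \<open>log f = log \<mu> + \<beta> log z + \<Sum>\<^sub>j n\<^sub>j log \<ell>\<^sub>j + \<Sum>\<^bsub>i\<ge>1\<^esub> (-1)\<^bsup>i+1\<^esup> \<epsilon>\<^sup>i / i\<close>,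
  where \<open>log z = - \<ell>\<^sub>1\<^bsup>-1\<^esup>\<close> and \<open>log \<ell>\<^sub>j = - \<ell>\<^bsub>j+1\<^esub>\<^bsup>-1\<^esup>\<close>
  since \<open>\<ell>\<^sub>1 = - 1 / log z\<close> and \<open>\<ell>\<^bsub>j+1\<^esub> = \<ell>\<^sub>1 \<circ> \<ell>\<^sub>j\<close>.
\<close>

definition log_lts :: "lts \<Rightarrow> lts" where
  "log_lts f = (let a = lead f in (\<lambda>c.
       ln (f a) * lmonom 0 c
     - zexp a * lmonom (- lunit 0) c
     - (\<Sum>j | lexp a j \<noteq> 0. real_of_int (lexp a j) * lmonom (- lunit (Suc j)) c)
     + (\<Sum>i. (-1) ^ i / real (Suc i) * power_lts (eps_lts f) (Suc i) c)))"

text \<open>Term by term extension of an operation on monomials.\<close>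

definition lin_ext :: "(lmon \<Rightarrow> lts) \<Rightarrow> lts \<Rightarrow> lts" where
  "lin_ext T f = (\<lambda>c. \<Sum>\<^sub>\<infinity>a\<in>supp f. f a * T a c)"

text \<open>\<open>d/dz\<close> on monomials, using \<open>d\<ell>\<^sub>j/dz = z\<^bsup>-1\<^esup> \<ell>\<^sub>1 \<dots> \<ell>\<^bsub>j-1\<^esub> \<ell>\<^sub>j\<^sup>2\<close>.\<close>

definition deriv_lmonom :: "lmon \<Rightarrow> lts" where
  "deriv_lmonom a = (\<lambda>c.
       zexp a * lmonom (a - LMon 1 (\<lambda>_. 0)) c
     + (\<Sum>j | lexp a j \<noteq> 0. real_of_int (lexp a j)
          * lmonom (a + LMon (-1) (\<lambda>i. if i \<le> j then 1 else 0)) c))"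

definition deriv_lts :: "lts \<Rightarrow> lts" where
  "deriv_lts = lin_ext deriv_lmonom"


section \<open>Composition\<close>

text \<open>\<open>ell_sub F j\<close> is \<open>\<ell>\<^bsub>j+1\<^esub> \<circ> F\<close>, by \<open>\<ell>\<^sub>1 \<circ> F = - 1 / log F\<close> and \<open>\<ell>\<^bsub>j+2\<^esub> \<circ> F = \<ell>\<^sub>1 \<circ> (\<ell>\<^bsub>j+1\<^esub> \<circ> F)\<close>.\<close>

primrec ell_sub :: "lts \<Rightarrow> nat \<Rightarrow> lts" where
  "ell_sub F 0 = - recip_lts (log_lts F)"
| "ell_sub F (Suc j) = - recip_lts (log_lts (ell_sub F j))"

definition depth :: "lmon \<Rightarrow> nat" where
  "depth a = (LEAST k. \<forall>i\<ge>k. lexp a i = 0)"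

text \<open>\<open>g (\<mu> z\<^sup>\<alpha>)\<close>, first for a monomial \<open>g\<close> and then term by term.\<close>

definition subst_lmonom :: "real \<Rightarrow> real \<Rightarrow> lmon \<Rightarrow> lts" where
  "subst_lmonom \<mu> \<alpha> a =
     foldr (\<lambda>j. mult_lts (powi_lts (ell_sub (scale_lts \<mu> (zpow \<alpha>)) j) (lexp a j))) [0..<depth a]
       (scale_lts (\<mu> powr zexp a) (zpow (\<alpha> * zexp a)))"

definition subst_lts :: "real \<Rightarrow> real \<Rightarrow> lts \<Rightarrow> lts" where
  "subst_lts \<mu> \<alpha> = lin_ext (subst_lmonom \<mu> \<alpha>)"

text \<open>
  Composition with \<open>f = \<mu> z\<^sup>\<alpha> + f\<^sub>1\<close>. The coefficientwise sum of real series is summation in the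
  weak topology.
\<close>

definition comp_lts :: "lts \<Rightarrow> lts \<Rightarrow> lts"  (infixr "\<circ>\<^sub>t" 75) where
  "g \<circ>\<^sub>t f = (let \<alpha> = zexp (lead f); \<mu> = f (lead f); f1 = f - scale_lts \<mu> (zpow \<alpha>) in
     (\<lambda>c. subst_lts \<mu> \<alpha> g c
        + (\<Sum>i. mult_lts (subst_lts \<mu> \<alpha> ((deriv_lts ^^ Suc i) g)) (power_lts f1 (Suc i)) c / fact (Suc i))))"

definition LH_group :: "lts monoid" where
  "LH_group = \<lparr>carrier = frakLH, mult = comp_lts, one = zpow 1\<rparr>"


section \<open>Topologies\<close>

definition weak_topology_on :: "lts set \<Rightarrow> lts topology" where
  "weak_topology_on S = subtopology (product_topology (\<lambda>_. euclideanreal) UNIV) S"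

definition d_z :: "lts \<Rightarrow> lts \<Rightarrow> real" where
  "d_z f g = (if f = g then 0 else 2 powr (- real_of_ereal (ord_z (f - g))))"

definition power_metric_topology_on :: "lts set \<Rightarrow> lts topology" where
  "power_metric_topology_on S = subtopology (Metric_space.mtopology frakLinf d_z) S"


section \<open>Normalization and supports\<close>

definition is_normalization :: "real \<Rightarrow> lts \<Rightarrow> lts \<Rightarrow> bool" where
  "is_normalization \<alpha> f \<phi> \<longleftrightarrow>
     \<phi> \<in> frakL0 \<and> \<phi> \<circ>\<^sub>t f \<circ>\<^sub>t inv\<^bsub>LH_group\<^esub> \<phi> = zpow \<alpha>"

definition boettcher :: "real \<Rightarrow> lts \<Rightarrow> lts \<Rightarrow> nat \<Rightarrow> lts" where
  "boettcher \<alpha> f h n = zpow (1 / \<alpha> ^ n) \<circ>\<^sub>t h \<circ>\<^sub>t (f [^]\<^bsub>LH_group\<^esub> n)"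

inductive_set semigroup_generated :: "lmon set \<Rightarrow> lmon set" for G where
  gen: "a \<in> G \<Longrightarrow> a \<in> semigroup_generated G"
| add: "a \<in> semigroup_generated G \<Longrightarrow> b \<in> semigroup_generated G \<Longrightarrow> a + b \<in> semigroup_generated G"

text \<open>
  \<open>J\<close> is the range of the exponents of \<open>\<alpha>\<close>. For \<open>\<alpha> > 1\<close> these are the natural numbers, i.e.
  \<open>J = {0..}\<close>. For \<open>\<alpha> < 1\<close> negative exponents occur: the normalization of \<open>z\<^sup>\<alpha> + z\<^bsup>\<alpha>+\<delta>\<^esup>\<close> is
  \<open>z - z\<^bsup>1+\<delta>/\<alpha>\<^esup> + h.o.t.\<close>, and \<open>1 + \<delta>/\<alpha>\<close> is not in the semigroup generated by \<open>\<alpha>\<^sup>p\<close> and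
  \<open>\<alpha>\<^sup>m \<delta>\<close> with \<open>p, m \<ge> 0\<close>, for instance, when \<open>\<alpha> = 9/10\<close> and \<open>\<delta>\<close> is irrational.
\<close>

definition support_generators :: "int set \<Rightarrow> nat \<Rightarrow> real \<Rightarrow> lts \<Rightarrow> lmon set" where
  "support_generators J k \<alpha> f =
     {LMon (\<alpha> powi p) (\<lambda>_. 0) | p. p \<in> J}
     \<union> {lunit i | i. i < k}
     \<union> {LMon (\<alpha> powi m * (zexp a - \<alpha>)) (lexp a) | m a. m \<in> J \<and> a \<in> supp (f - zpow \<alpha>)}"

end

theory Submission
  imports Defs "HOL-Library.Set_Algebras" "HOL-Computational_Algebra.Formal_Power_Series"
begin

text \<open>Write the normalization as \<open>\<phi> = z exp \<psi>\<close> and \<open>f = z\<^sup>\<alpha> exp \<eta>\<close> with infinitesimal \<open>\<psi>\<close> and \<open>\<eta>\<close>.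
  The equation \<open>\<phi> \<circ> f = \<phi>\<^sup>\<alpha>\<close> then becomes the linear equation \<open>\<alpha> \<psi> - \<psi> \<circ> f = \<eta>\<close>. The operator
  \<open>\<psi> \<mapsto> \<psi> \<circ> f\<close> is strongly linear and sends a monomial with \<open>z\<close>-exponent \<open>\<beta>\<close> to a series led by the one with
  exponent \<open>\<alpha> \<beta>\<close>, so the equation is triangular along a well-ordered semigroup, has exactly one
  solution, and the recursion bounds its support. Composing with \<open>f\<close> is a strongly linear ring
  homomorphism that satisfies the chain rule, and these properties together with the images of the
  powers of \<open>z\<close>, of \<open>log z\<close> and the constant terms of the iterated logarithms determine it; hence
  composition is associative. If \<open>h = z exp \<theta>\<close>, the \<open>n\<close>-th Boettcher iterate is
  \<open>z exp (\<psi> + \<alpha>\<^sup>-\<^sup>n (\<theta> - \<psi>) \<circ> f\<^sup>n)\<close>. The coefficients of the correction tend to \<open>0\<close>, and its order in \<open>z\<close> is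
  \<open>\<alpha>\<^sup>n\<close> times that of \<open>\<theta> - \<psi>\<close>, which tends to infinity exactly when \<open>h\<close> and \<open>\<phi>\<close> have the same
  leading block.\<close>

text \<open>The unknown is \<psi> because \<phi>^\<alpha> is nonlinear in \<phi> but linear in
  \<psi>. A monomial of \<psi> with z-exponent b contributes to the equation at b and from \<alpha>
  b on. The smaller is b for \<alpha> > 1 and \<alpha> b for \<alpha> < 1, which changes the
  diagonal of the recursion; the support is closed under scaling by q = \<alpha> or q = 1 /
  \<alpha>, always above 1, since scaling down would destroy well-ordering. At b = 0 the two
  contributions coincide. As z^\<alpha> turns l_1 into l_1 / \<alpha>, the diagonal entry is then
  \<alpha> - \<alpha>^(-n), n the exponent of l_1. It vanishes only for n = -1, while
  infinitesimality gives n \<ge> 0. The given operations are total on coefficient functions and obey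
  algebraic laws only on the carriers. So the admissible coefficient functions form a type
  \<open>ts\<close>, shown to be a field, and each given operation is identified with one of that
  field where it is meaningful. A sum in \<open>ts\<close> has finitely many contributions to each
  coefficient, so topology enters only with the Boettcher sequence.\<close>

section \<open>Well-ordered sets of monomials\<close>

lemma lmon_eqI: "zexp a = zexp b \<Longrightarrow> (\<And>i. lexp a i = lexp b i) \<Longrightarrow> a = b"
  by (metis ext lmon.expand)

lemma lmon_simps [simp]:
  "zexp 0 = 0" "lexp 0 i = 0"
  "zexp (a + b) = zexp a + zexp b" "lexp (a + b) i = lexp a i + lexp b i"
  "zexp (- a) = - zexp a" "lexp (- a) i = - lexp a i"
  "zexp (a - b) = zexp a - zexp b" "lexp (a - b) i = lexp a i - lexp b i"
  "zexp (lunit j) = 0" "lexp (lunit j) i = (if i = j then 1 else 0)"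
  by (simp_all add: zero_lmon_def plus_lmon_def uminus_lmon_def minus_lmon_def lunit_def)

text \<open>In a linear order, failure of well-ordering means a strictly decreasing sequence, hence
  one without a non-decreasing pair. This sequence form is what carries over to sums and
  images.\<close>

lemma wo_iff_good:
  "well_ordered S \<longleftrightarrow> (\<forall>s::nat \<Rightarrow> lmon. (\<forall>i. s i \<in> S) \<longrightarrow> (\<exists>i j. i < j \<and> s i \<le> s j))"
proof
  assume S: "well_ordered S"
  show "\<forall>s::nat \<Rightarrow> lmon. (\<forall>i. s i \<in> S) \<longrightarrow> (\<exists>i j. i < j \<and> s i \<le> s j)"
  proof (intro allI impI)
    fix s :: "nat \<Rightarrow> lmon" assume "\<forall>i. s i \<in> S"
    then have "range s \<subseteq> S" "range s \<noteq> {}" by auto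
    then obtain i where "\<forall>a\<in>range s. s i \<le> a"
      using S unfolding well_ordered_def by blast
    then show "\<exists>i j. i < j \<and> s i \<le> s j" by (intro exI[of _ i] exI[of _ "Suc i"]) auto
  qed
next
  assume g: "\<forall>s::nat \<Rightarrow> lmon. (\<forall>i. s i \<in> S) \<longrightarrow> (\<exists>i j. i < j \<and> s i \<le> s j)"
  show "well_ordered S"
    unfolding well_ordered_def
  proof (intro allI impI, rule ccontr)
    fix A assume A: "A \<subseteq> S" "A \<noteq> {}" and n: "\<not> (\<exists>m\<in>A. \<forall>a\<in>A. m \<le> a)"
    obtain a0 where "a0 \<in> A" using A(2) by blast
    have "\<forall>m. \<exists>a. m \<in> A \<longrightarrow> a \<in> A \<and> a < m" using n by (auto simp: not_le)
    then obtain h where h: "\<And>m. m \<in> A \<Longrightarrow> h m \<in> A \<and> h m < m" by metis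
    define s where "s n = (h ^^ n) a0" for n
    have sA: "s n \<in> A" for n using h \<open>a0 \<in> A\<close> by (induction n) (auto simp: s_def)
    have dec: "s (Suc n) < s n" for n using h sA[of n] by (simp add: s_def)
    have lt: "s (i + Suc m) < s i" for i m
    proof (induction m)
      case (Suc m)
      have "s (i + Suc (Suc m)) < s (i + Suc m)" using dec[of "i + Suc m"] by simp
      then show ?case using Suc by (rule less_trans)
    qed (use dec in simp)
    obtain i j where "i < j" "s i \<le> s j" using g sA A(1) by (meson subsetD)
    then show False using lt[of i "j - Suc i"] by simp
  qed
qed

lemma wo_good:
  fixes s :: "nat \<Rightarrow> lmon"
  assumes "well_ordered S" "\<And>i. s i \<in> S"
  obtains i j where "i < j" "s i \<le> s j"
  using assms wo_iff_good by meson

lemma wo_subset: "well_ordered B \<Longrightarrow> A \<subseteq> B \<Longrightarrow> well_ordered A"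
  by (auto simp: well_ordered_def)

text \<open>A monotone subsequence exists in any linear order; a decreasing one is constant from its
  minimum on, hence becomes increasing after a shift past that index.\<close>

lemma wo_incseq:
  fixes s :: "nat \<Rightarrow> lmon"
  assumes "well_ordered S" "\<And>i. s i \<in> S"
  obtains r :: "nat \<Rightarrow> nat" where "strict_mono r" "\<And>i j. i \<le> j \<Longrightarrow> s (r i) \<le> s (r j)"
proof -
  obtain r :: "nat \<Rightarrow> nat" where r: "strict_mono r" "monoseq (\<lambda>n. s (r n))"
    using seq_monosub[of s] by blast
  show thesis
  proof (cases "incseq (\<lambda>n. s (r n))")
    case True
    then show ?thesis using that r by (auto simp: incseq_def)
  next
    case False
    then have dec: "decseq (\<lambda>n. s (r n))" using r(2) by (auto simp: monoseq_def incseq_def decseq_def)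
    have "range (\<lambda>n. s (r n)) \<subseteq> S" using assms by auto
    then obtain i where i: "\<forall>a\<in>range (\<lambda>n. s (r n)). s (r i) \<le> a"
      using assms(1)[unfolded well_ordered_def, rule_format, of "range (\<lambda>n. s (r n))"] by auto
    have eq: "s (r (i + n)) = s (r i)" for n
      using i dec by (intro antisym) (auto simp: decseq_def)
    have "strict_mono (\<lambda>n. r (i + n))" using r(1) by (auto simp: strict_mono_def)
    then show ?thesis using that[of "\<lambda>n. r (i + n)"] eq by auto
  qed
qed

text \<open>Pass to a subsequence along which the first summands increase, then pick a good pair for
  the second summands.\<close>

lemma wo_plus:
  assumes "well_ordered A" "well_ordered B" shows "well_ordered (A + B)"
  unfolding wo_iff_good
proof (intro allI impI)
  fix s :: "nat \<Rightarrow> lmon" assume "\<forall>i. s i \<in> A + B"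
  then have "\<forall>i. \<exists>p. fst p \<in> A \<and> snd p \<in> B \<and> s i = fst p + snd p"
    by (fastforce simp: set_plus_def)
  then obtain p where p: "\<forall>i. fst (p i) \<in> A \<and> snd (p i) \<in> B \<and> s i = fst (p i) + snd (p i)"
    by (rule choice[THEN exE])
  define a b where "a i = fst (p i)" and "b i = snd (p i)" for i
  have ab: "\<And>i. a i \<in> A" "\<And>i. b i \<in> B" "\<And>i. s i = a i + b i"
    using p by (auto simp: a_def b_def)
  obtain r :: "nat \<Rightarrow> nat" where r: "strict_mono r" "\<And>i j. i \<le> j \<Longrightarrow> a (r i) \<le> a (r j)"
    using wo_incseq[OF assms(1), of a] ab by blast
  obtain i j where "i < j" "b (r i) \<le> b (r j)"
    using wo_good[OF assms(2), of "\<lambda>i. b (r i)"] ab(2) by blast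
  then show "\<exists>i j. i < j \<and> s i \<le> s j"
    using r ab(3) by (intro exI[of _ "r i"] exI[of _ "r j"]) (auto simp: strict_mono_def add_mono)
qed

text \<open>Infinitely many decompositions would give strictly increasing \<open>a\<close> together
  with strictly decreasing \<open>c - a\<close>, against well-ordering. This finiteness makes the
  coefficients of products finite sums.\<close>

lemma wo_decomp_finite:
  assumes "well_ordered A" "well_ordered B" shows "finite {a \<in> A. c - a \<in> B}"
proof (rule ccontr)
  assume "infinite {a \<in> A. c - a \<in> B}"
  then obtain a :: "nat \<Rightarrow> lmon" where a: "inj a" "range a \<subseteq> {a \<in> A. c - a \<in> B}"
    using infinite_countable_subset by blast
  obtain r :: "nat \<Rightarrow> nat" where r: "strict_mono r" "\<And>i j. i \<le> j \<Longrightarrow> a (r i) \<le> a (r j)"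
    using wo_incseq[OF assms(1), of a] a by blast
  obtain i j where ij: "i < j" "c - a (r i) \<le> c - a (r j)"
    using wo_good[OF assms(2), of "\<lambda>i. c - a (r i)"] a(2) by (auto simp: image_subset_iff)
  then have "a (r i) = a (r j)" using r(2)[of i j] by (intro antisym) auto
  then have "r i = r j" using a(1) by (auto dest: injD)
  then show False using ij strict_monoD[OF r(1) ij(1)] by simp
qed

lemma wo_un: "well_ordered A \<Longrightarrow> well_ordered B \<Longrightarrow> well_ordered (A \<union> B)"
  unfolding well_ordered_def
proof (intro allI impI)
  fix C assume A: "\<forall>C\<subseteq>A. C \<noteq> {} \<longrightarrow> (\<exists>m\<in>C. \<forall>a\<in>C. m \<le> a)" and B: "\<forall>C\<subseteq>B. C \<noteq> {} \<longrightarrow> (\<exists>m\<in>C. \<forall>a\<in>C. m \<le> a)"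
    and C: "C \<subseteq> A \<union> B" "C \<noteq> {}"
  show "\<exists>m\<in>C. \<forall>a\<in>C. m \<le> a"
  proof (cases "C \<inter> A = {} \<or> C \<inter> B = {}")
    case True
    then have "C \<subseteq> A \<or> C \<subseteq> B" using C by blast
    then show ?thesis using A[rule_format, of C] B[rule_format, of C] C(2) by auto
  next
    case False
    then obtain m n where "m \<in> C \<inter> A" "\<forall>a\<in>C \<inter> A. m \<le> a" "n \<in> C \<inter> B" "\<forall>a\<in>C \<inter> B. n \<le> a"
      using A[rule_format, of "C \<inter> A"] B[rule_format, of "C \<inter> B"] by auto
    moreover from this have "min m n \<le> a" if "a \<in> C" for a
      using C(1) that by (auto simp: min_le_iff_disj)
    ultimately show ?thesis by (intro bexI[of _ "min m n"]) (auto simp: min_def)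
  qed
qed

lemma wo_finite: "finite A \<Longrightarrow> well_ordered A"
  unfolding well_ordered_def by (metis Min_in Min_le finite_subset)

lemma wo_image:
  assumes "well_ordered A" "\<And>a b. a \<in> A \<Longrightarrow> b \<in> A \<Longrightarrow> a \<le> b \<Longrightarrow> \<sigma> a \<le> \<sigma> b"
  shows "well_ordered (\<sigma> ` A)"
  unfolding wo_iff_good
proof (intro allI impI)
  fix s :: "nat \<Rightarrow> lmon" assume "\<forall>i. s i \<in> \<sigma> ` A"
  then have "\<forall>i. \<exists>a. a \<in> A \<and> s i = \<sigma> a" by auto
  then obtain a where a: "\<And>i. a i \<in> A" "\<And>i. s i = \<sigma> (a i)" by metis
  obtain i j where "i < j" "a i \<le> a j" using wo_good[OF assms(1), of a] a(1) by blast
  then show "\<exists>i j. i < j \<and> s i \<le> s j" using assms(2)[of "a i" "a j"] a by auto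
qed

section \<open>Neumann's lemma\<close>

primrec msum :: "nat \<Rightarrow> lmon set \<Rightarrow> lmon set" where
  "msum 0 Z = {0}"
| "msum (Suc n) Z = Z + msum n Z"

definition mgen :: "lmon set \<Rightarrow> lmon set" where
  "mgen Z = (\<Union>n. msum n Z)"

lemma msum_wo: "well_ordered Z \<Longrightarrow> well_ordered (msum n Z)"
  by (induction n) (auto intro: wo_plus wo_finite)

text \<open>A bad sequence refutes that \<open>mgen Z\<close> is well-ordered with only finitely many factorization
  lengths per element; a minimal one (Nash-Williams) leads to a contradiction.\<close>

definition bad :: "lmon set \<Rightarrow> (nat \<Rightarrow> lmon \<times> nat) \<Rightarrow> bool" where
  "bad Z s \<longleftrightarrow> (\<forall>i. fst (s i) \<in> msum (snd (s i)) Z) \<and>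
     (\<forall>i j. i < j \<longrightarrow> fst (s j) \<le> fst (s i) \<and> (fst (s i) = fst (s j) \<longrightarrow> snd (s i) \<noteq> snd (s j)))"

text \<open>The sequences \<open>S k\<close> come from dependent choice: each keeps the entries of
  its predecessor up to index \<open>k\<close> and minimizes the next length. Badness concerns only
  two entries at a time, so the diagonal sequence inherits it.\<close>

lemma minimal_bad:
  assumes "bad Z s0"
  obtains s where "bad Z s" "\<And>k t. bad Z t \<Longrightarrow> (\<And>i. i < k \<Longrightarrow> t i = s i) \<Longrightarrow> snd (s k) \<le> snd (t k)"
proof -
  define P where "P k s \<longleftrightarrow> bad Z s \<and> (\<forall>t. bad Z t \<longrightarrow> (\<forall>i<k. t i = s i) \<longrightarrow> snd (s k) \<le> snd (t k))" for k s
  have ex: "\<exists>t. P k t \<and> (\<forall>i<k. t i = s i)" if "bad Z s" for k s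
  proof -
    have "\<exists>t. (bad Z t \<and> (\<forall>i<k. t i = s i)) \<and>
        (\<forall>u. bad Z u \<and> (\<forall>i<k. u i = s i) \<longrightarrow> snd (t k) \<le> snd (u k))"
      by (rule ex_has_least_nat[of _ s]) (use that in simp)
    then obtain t where t: "bad Z t \<and> (\<forall>i<k. t i = s i)"
      "\<forall>u. bad Z u \<and> (\<forall>i<k. u i = s i) \<longrightarrow> snd (t k) \<le> snd (u k)" by (elim exE conjE) blast
    then show ?thesis unfolding P_def by (intro exI[of _ t]) auto
  qed
  have "\<exists>S. \<forall>k. P k (S k) \<and> (\<forall>i<Suc k. S (Suc k) i = S k i)"
  proof (rule dependent_nat_choice)
    show "\<exists>x. P 0 x" using ex[OF assms, of 0] by blast
  next
    fix x k assume "P k x"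
    then show "\<exists>y. P (Suc k) y \<and> (\<forall>i<Suc k. y i = x i)" using ex[of x "Suc k"] by (auto simp: P_def)
  qed
  then obtain S where S: "\<And>k. P k (S k)" "\<And>k i. i \<le> k \<Longrightarrow> S (Suc k) i = S k i" by (auto simp: less_Suc_eq_le)
  have agree: "S (k + n) i = S k i" if "i \<le> k" for k n i
    using that by (induction n) (auto simp: S(2))
  define s where "s k = S k k" for k
  have sS: "S k i = s i" if "i \<le> k" for i k
    using agree[of i i "k - i"] that by (simp add: s_def)
  have "bad Z s"
    unfolding bad_def
  proof (intro conjI allI impI)
    fix i show "fst (s i) \<in> msum (snd (s i)) Z" using S(1)[of i] by (auto simp: P_def bad_def s_def)
  next
    fix i j :: nat assume ij: "i < j"
    have "bad Z (S j)" using S(1)[of j] by (simp add: P_def)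
    then have *: "fst (S j j) \<le> fst (S j i) \<and> (fst (S j i) = fst (S j j) \<longrightarrow> snd (S j i) \<noteq> snd (S j j))"
      using ij unfolding bad_def by blast
    then show "fst (s j) \<le> fst (s i)" "fst (s i) = fst (s j) \<Longrightarrow> snd (s i) \<noteq> snd (s j)"
      using sS[of i j] sS[of j j] ij by auto
  qed
  moreover have "snd (s k) \<le> snd (t k)" if "bad Z t" "\<And>i. i < k \<Longrightarrow> t i = s i" for k t
  proof -
    have "\<forall>i<k. t i = S k i" using that(2) sS[of _ k] by simp
    then have "snd (S k k) \<le> snd (t k)" using S(1)[of k] that(1) unfolding P_def by blast
    then show ?thesis by (simp add: s_def)
  qed
  ultimately show thesis using that by blast
qed

lemma msum_nonneg:
  assumes "\<And>a. a \<in> Z \<Longrightarrow> 0 < a" "c \<in> msum n Z" shows "0 \<le> c" "n \<noteq> 0 \<Longrightarrow> 0 < c"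
proof -
  have "0 \<le> c \<and> (n \<noteq> 0 \<longrightarrow> 0 < c)" using assms(2)
  proof (induction n arbitrary: c)
    case (Suc n)
    then obtain a b where "a \<in> Z" "b \<in> msum n Z" "c = a + b" by (auto simp: set_plus_def)
    then show ?case using Suc.IH[of b] assms(1)[of a] by (auto intro: add_pos_nonneg less_imp_le)
  qed auto
  then show "0 \<le> c" "n \<noteq> 0 \<Longrightarrow> 0 < c" by auto
qed

lemma no_bad:
  assumes Z: "well_ordered Z" "\<And>a. a \<in> Z \<Longrightarrow> 0 < a" shows "\<not> bad Z s0"
proof
  assume "bad Z s0"
  then obtain s where s: "bad Z s"
    and min: "\<And>k t. bad Z t \<Longrightarrow> (\<And>i. i < k \<Longrightarrow> t i = s i) \<Longrightarrow> snd (s k) \<le> snd (t k)"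
    using minimal_bad by metis
  have mem: "fst (s i) \<in> msum (snd (s i)) Z" for i using s by (auto simp: bad_def)
  have dec: "i < j \<Longrightarrow> fst (s j) \<le> fst (s i)" and ne: "i < j \<Longrightarrow> fst (s i) = fst (s j) \<Longrightarrow> snd (s i) \<noteq> snd (s j)" for i j
    using s by (auto simp: bad_def)
  \<comment> \<open>Length 0 means the monomial 0; the next entry is then squeezed to 0 with length
    0 as well, which repeats the pair.\<close>
  have pos: "snd (s i) \<noteq> 0" for i
  proof
    assume 0: "snd (s i) = 0"
    then have "fst (s i) = 0" using mem[of i] by auto
    then have "fst (s (Suc i)) = 0" using dec[of i "Suc i"] msum_nonneg(1)[OF Z(2) mem[of "Suc i"]] by auto
    moreover from this have "snd (s (Suc i)) = 0" using msum_nonneg(2)[OF Z(2) mem[of "Suc i"]] by auto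
    ultimately show False using ne[of i "Suc i"] 0 \<open>fst (s i) = 0\<close> by auto
  qed
  have "\<exists>z d. z \<in> Z \<and> d \<in> msum (snd (s i) - 1) Z \<and> fst (s i) = z + d" for i
    using mem[of i] pos[of i] by (cases "snd (s i)") (auto simp: set_plus_def)
  then obtain z d where zd: "\<And>i. z i \<in> Z" "\<And>i. d i \<in> msum (snd (s i) - 1) Z" "\<And>i. fst (s i) = z i + d i"
    by metis
  obtain r :: "nat \<Rightarrow> nat" where r: "strict_mono r" "\<And>i j. i \<le> j \<Longrightarrow> z (r i) \<le> z (r j)"
    using wo_incseq[OF Z(1), of z] zd by blast
  \<comment> \<open>Strip one generator from every entry of the subsequence \<open>r\<close> and
    append the results to the untouched entries before \<open>r 0\<close>. The new sequence is again
    bad but has a shorter length at index \<open>r 0\<close>, against minimality.\<close>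
  define t where "t i = (if i < r 0 then s i else (d (r (i - r 0)), snd (s (r (i - r 0))) - 1))" for i
  have "bad Z t"
    unfolding bad_def
  proof (intro conjI allI impI)
    fix i show "fst (t i) \<in> msum (snd (t i)) Z" using mem zd by (auto simp: t_def)
  next
    fix i j :: nat assume ij: "i < j"
    consider "j < r 0" | "i < r 0" "r 0 \<le> j" | "r 0 \<le> i" by linarith
    then have "fst (t j) \<le> fst (t i) \<and> (fst (t i) = fst (t j) \<longrightarrow> snd (t i) \<noteq> snd (t j))"
    proof cases
      case 1 then show ?thesis using ij dec[of i j] ne[of i j] by (auto simp: t_def)
    next
      case 2
      define k where "k = r (j - r 0)"
      have "i < k" using 2 strict_mono_less_eq[OF r(1), of 0 "j - r 0"] by (auto simp: k_def)
      then have "fst (s k) \<le> fst (s i)" by (rule dec)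
      moreover have "d k < fst (s k)" using zd(3)[of k] Z(2)[OF zd(1)[of k]] by auto
      ultimately show ?thesis using 2 by (auto simp: t_def k_def[symmetric])
    next
      case 3
      define k l where "k = r (i - r 0)" and "l = r (j - r 0)"
      have kl: "k < l" using 3 ij r(1) by (auto simp: k_def l_def strict_mono_def)
      have z: "z k \<le> z l" using r(2) 3 ij by (auto simp: k_def l_def)
      have f: "z l + d l \<le> z k + d k" using dec[OF kl] zd(3) by auto
      have le: "d l \<le> d k" using z f by (metis add_le_cancel_left add_right_mono order_trans)
      have "snd (s k) \<noteq> snd (s l)" if "d k = d l"
      proof (rule ne[OF kl])
        show "fst (s k) = fst (s l)" using that z f zd(3) by auto
      qed
      then have "d k = d l \<Longrightarrow> snd (s k) - 1 \<noteq> snd (s l) - 1" using pos[of k] pos[of l] by auto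
      then show ?thesis using le 3 ij by (auto simp: t_def k_def l_def)
    qed
    then show "fst (t j) \<le> fst (t i)" "fst (t i) = fst (t j) \<Longrightarrow> snd (t i) \<noteq> snd (t j)" by auto
  qed
  then have "snd (s (r 0)) \<le> snd (t (r 0))" by (rule min) (auto simp: t_def)
  then show False using pos[of "r 0"] by (auto simp: t_def)
qed

lemma mgen_wo:
  assumes Z: "well_ordered Z" "\<And>a. a \<in> Z \<Longrightarrow> 0 < a" shows "well_ordered (mgen Z)"
  unfolding wo_iff_good
proof (intro allI impI, rule ccontr)
  fix s :: "nat \<Rightarrow> lmon" assume s: "\<forall>i::nat. s i \<in> mgen Z" and n: "\<not> (\<exists>i j. i < j \<and> s i \<le> s j)"
  obtain m where "\<And>i. s i \<in> msum (m i) Z" using s unfolding mgen_def by (auto simp: ) metis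
  then have "bad Z (\<lambda>i. (s i, m i))" using n by (force simp: bad_def not_le)
  then show False using no_bad[OF Z] by blast
qed

text \<open>Infinitely many factorization lengths of one monomial would form a bad sequence with
  constant first component. This half of Neumann's lemma makes each coefficient of a power series in
  an infinitesimal a finite sum.\<close>

lemma mgen_finite_degree:
  assumes Z: "well_ordered Z" "\<And>a. a \<in> Z \<Longrightarrow> 0 < a" shows "finite {n. c \<in> msum n Z}"
proof (rule ccontr)
  assume "infinite {n. c \<in> msum n Z}"
  then obtain m :: "nat \<Rightarrow> nat" where m: "inj m" "range m \<subseteq> {n. c \<in> msum n Z}"
    using infinite_countable_subset by blast
  then have "bad Z (\<lambda>i. (c, m i))" by (auto simp: bad_def inj_def) blast
  then show False using no_bad[OF Z] by blast
qed

lemma msum_add: "a \<in> msum m Z \<Longrightarrow> b \<in> msum n Z \<Longrightarrow> a + b \<in> msum (m + n) Z"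
proof (induction m arbitrary: a)
  case (Suc m)
  then obtain x y where "x \<in> Z" "y \<in> msum m Z" "a = x + y" by (auto simp: set_plus_def)
  then show ?case using Suc.IH[of y] Suc.prems by (auto simp: set_plus_def add.assoc)
qed auto

lemma mgen_0 [simp]: "0 \<in> mgen Z"
  unfolding mgen_def by (rule UN_I[of 0]) auto

lemma mgen_add: "a \<in> mgen Z \<Longrightarrow> b \<in> mgen Z \<Longrightarrow> a + b \<in> mgen Z"
  unfolding mgen_def using msum_add by blast

lemma mgen_base: "a \<in> Z \<Longrightarrow> a \<in> mgen Z"
  unfolding mgen_def by (rule UN_I[of 1]) (auto simp: set_plus_def)

lemma msum_subset_mgen: "msum n Z \<subseteq> mgen Z"
  unfolding mgen_def by auto

lemma mgen_induct [consumes 1, case_names zero add]: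
  assumes "c \<in> mgen Z" "P 0" "\<And>a b. a \<in> Z \<Longrightarrow> b \<in> mgen Z \<Longrightarrow> P b \<Longrightarrow> P (a + b)"
  shows "P c"
proof -
  obtain n where "c \<in> msum n Z" using assms(1) by (auto simp: mgen_def)
  then show ?thesis
  proof (induction n arbitrary: c)
    case (Suc n)
    then obtain x y where "x \<in> Z" "y \<in> msum n Z" "c = x + y" by (auto simp: set_plus_def)
    then show ?case using Suc.IH[of y] assms(3) msum_subset_mgen by blast
  qed (use assms in auto)
qed

lemma mgen_nonneg: "c \<in> mgen Z \<Longrightarrow> (\<And>a. a \<in> Z \<Longrightarrow> 0 < a) \<Longrightarrow> 0 \<le> c"
  using msum_nonneg(1) by (auto simp: mgen_def)

lemma mgen_mono: "Z \<subseteq> Y \<Longrightarrow> mgen Z \<subseteq> mgen Y"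
proof
  fix c assume "Z \<subseteq> Y" "c \<in> mgen Z"
  then show "c \<in> mgen Y" by (induction rule: mgen_induct[OF \<open>c \<in> mgen Z\<close>]) (auto intro: mgen_add mgen_base)
qed

section \<open>Admissible supports\<close>

definition dep :: "nat \<Rightarrow> lmon \<Rightarrow> bool" where
  "dep k a \<longleftrightarrow> (\<forall>i\<ge>k. lexp a i = 0)"

text \<open>A uniform depth bound is imposed along with well-ordering, because a sum of monomials of
  unbounded depth leaves every \<open>Linf k\<close>.\<close>

definition adm :: "lmon set \<Rightarrow> bool" where
  "adm W \<longleftrightarrow> well_ordered W \<and> (\<exists>k. \<forall>a\<in>W. dep k a)"

lemma dep_simps [simp]: "dep k 0" "dep k a \<Longrightarrow> dep k b \<Longrightarrow> dep k (a + b)"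
   "dep k a \<Longrightarrow> dep k b \<Longrightarrow> dep k (a - b)" "dep k a \<Longrightarrow> dep k (- a)"
  by (auto simp: dep_def)

lemma dep_mono: "dep k a \<Longrightarrow> k \<le> l \<Longrightarrow> dep l a"
  by (auto simp: dep_def)

lemma dep_mgen: "c \<in> mgen Z \<Longrightarrow> (\<And>a. a \<in> Z \<Longrightarrow> dep k a) \<Longrightarrow> dep k c"
  by (induction rule: mgen_induct) auto

lemma adm_subset: "adm B \<Longrightarrow> A \<subseteq> B \<Longrightarrow> adm A"
  unfolding adm_def using wo_subset by blast

lemma adm_un: assumes "adm A" "adm B" shows "adm (A \<union> B)"
proof -
  obtain k l where "\<forall>a\<in>A. dep k a" "\<forall>a\<in>B. dep l a" using assms by (auto simp: adm_def)
  then have "\<forall>a\<in>A \<union> B. dep (max k l) a" using dep_mono by (metis Un_iff max.cobounded1 max.cobounded2)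
  then show ?thesis using assms wo_un by (auto simp: adm_def)
qed

lemma adm_plus: assumes "adm A" "adm B" shows "adm (A + B)"
proof -
  obtain k l where "\<forall>a\<in>A. dep k a" "\<forall>a\<in>B. dep l a" using assms by (auto simp: adm_def)
  then have "\<forall>a\<in>A + B. dep (max k l) a" using dep_mono by (fastforce simp: set_plus_def)
  then show ?thesis using assms wo_plus by (auto simp: adm_def)
qed

lemma adm_mgen: assumes "adm Z" "\<And>a. a \<in> Z \<Longrightarrow> 0 < a" shows "adm (mgen Z)"
proof -
  obtain k where "\<forall>a\<in>Z. dep k a" using assms by (auto simp: adm_def)
  then have "\<forall>a\<in>mgen Z. dep k a" using dep_mgen by blast
  then show ?thesis using assms mgen_wo[of Z] by (auto simp: adm_def)
qed

lemma adm_empty [simp]: "adm {}"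
  by (simp add: adm_def wo_finite)

lemma adm_sing [simp]: "adm {a} \<longleftrightarrow> (\<exists>k. dep k a)"
  by (auto simp: adm_def wo_finite)

lemma frakLinf_iff: "f \<in> frakLinf \<longleftrightarrow> adm (supp f)"
  by (auto simp: frakLinf_def Linf_def adm_def dep_def)

section \<open>The algebra of transseries\<close>

lemma summable_finite_support:
  fixes f :: "'a \<Rightarrow> real" assumes "finite {i \<in> I. f i \<noteq> 0}" shows "f summable_on I"
proof -
  have "f summable_on I \<longleftrightarrow> f summable_on {i \<in> I. f i \<noteq> 0}"
    by (rule summable_on_cong_neutral) blast+
  then show ?thesis using summable_on_finite[OF assms] by blast
qed

lemma infsum_finite_support:
  fixes f :: "'a \<Rightarrow> real" assumes "finite S" "S \<subseteq> I" "\<And>i. i \<in> I \<Longrightarrow> i \<notin> S \<Longrightarrow> f i = 0"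
  shows "infsum f I = sum f S"
proof -
  have "infsum f I = infsum f S"
    by (rule infsum_cong_neutral) (use assms in blast)+
  then show ?thesis using assms(1) by simp
qed

lemma infsum_nonzero: "infsum f I \<noteq> (0::real) \<Longrightarrow> \<exists>i\<in>I. f i \<noteq> 0"
  using infsum_0[of I f] by blast

text \<open>As a type, the admissible coefficient functions can carry the vector space, ring and
  field classes, so that the general algebra of these classes applies.\<close>

typedef ts = frakLinf morphisms cf Abs_ts
  by (rule exI[of _ "\<lambda>_. 0"]) (auto simp: frakLinf_iff supp_def)

definition sp :: "ts \<Rightarrow> lmon set" where
  "sp x = {a. cf x a \<noteq> 0}"

lemma supp_cf [simp]: "supp (cf x) = sp x"
  by (simp add: supp_def sp_def)

lemma adm_sp [simp]: "adm (sp x)"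
  using cf[of x] by (simp add: frakLinf_iff)

lemma wo_sp [simp]: "well_ordered (sp x)"
  using adm_sp by (auto simp: adm_def)

lemma notin_sp: "a \<notin> sp x \<longleftrightarrow> cf x a = 0"
  by (simp add: sp_def)

lemma ts_eqI: "(\<And>c. cf x c = cf y c) \<Longrightarrow> x = y"
  by (rule cf_inject[THEN iffD1], rule ext)

lemma cf_Abs: "adm {a. f a \<noteq> 0} \<Longrightarrow> cf (Abs_ts f) = f"
  by (rule Abs_ts_inverse) (simp add: frakLinf_iff supp_def)

lemma cf_Abs': "adm W \<Longrightarrow> {a. f a \<noteq> 0} \<subseteq> W \<Longrightarrow> cf (Abs_ts f) = f"
  by (rule cf_Abs) (rule adm_subset)

definition fd :: "lmon \<Rightarrow> bool" where
  "fd a \<longleftrightarrow> (\<exists>k. dep k a)"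

lemma fd_0 [simp]: "fd 0"
  by (auto simp: fd_def)

lemma fd_add [simp]: assumes "fd a" "fd b" shows "fd (a + b)"
  using adm_plus[of "{a}" "{b}"] assms by (simp add: fd_def set_plus_def)

lemma fd_minus [simp]: "fd (- a) \<longleftrightarrow> fd a"
  by (auto simp: fd_def dep_def)

lemma fd_sp: "a \<in> sp x \<Longrightarrow> fd a"
  using adm_sp[of x] by (auto simp: adm_def fd_def)

lemma cf_nonfd: "\<not> fd a \<Longrightarrow> cf x a = 0"
  using fd_sp notin_sp by blast

text \<open>Monomials of infinite depth are not transseries; \<open>mon\<close> maps them to the junk value \<open>0\<close>.\<close>

definition mon :: "lmon \<Rightarrow> ts" where
  "mon a = Abs_ts (\<lambda>c. if c = a \<and> fd a then 1 else 0)"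

lemma cf_mon: "cf (mon a) c = (if c = a \<and> fd a then 1 else 0)"
  unfolding mon_def by (subst cf_Abs'[of "if fd a then {a} else {}"]) (auto simp: fd_def)

lemma cf_mon_fd: "fd a \<Longrightarrow> cf (mon a) = lmonom a"
  by (auto simp: cf_mon lmonom_def)

lemma sp_mon: "fd a \<Longrightarrow> sp (mon a) = {a}"
  by (auto simp: sp_def cf_mon)

instantiation ts :: real_vector
begin
definition "0 = Abs_ts (\<lambda>_. 0)"
definition "x + y = Abs_ts (\<lambda>c. cf x c + cf y c)"
definition "- x = Abs_ts (\<lambda>c. - cf x c)"
definition "x - (y::ts) = Abs_ts (\<lambda>c. cf x c - cf y c)"
definition "r *\<^sub>R x = Abs_ts (\<lambda>c. r * cf x c)"

lemma cf_simps [simp]: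
  "cf 0 c = 0" "cf (x + y) c = cf x c + cf y c" "cf (- x) c = - cf x c"
  "cf (x - y) c = cf x c - cf y c" "cf (r *\<^sub>R x) c = r * cf x c"
proof -
  have a: "adm (sp x \<union> sp y)" by (simp add: adm_un)
  show "cf 0 c = 0" unfolding zero_ts_def by (subst cf_Abs) auto
  show "cf (x + y) c = cf x c + cf y c" unfolding plus_ts_def
    by (subst cf_Abs'[OF a]) (auto simp: sp_def)
  show "cf (x - y) c = cf x c - cf y c" unfolding minus_ts_def
    by (subst cf_Abs'[OF a]) (auto simp: sp_def)
  show "cf (- x) c = - cf x c" unfolding uminus_ts_def
    by (subst cf_Abs'[OF a]) (auto simp: sp_def)
  show "cf (r *\<^sub>R x) c = r * cf x c" unfolding scaleR_ts_def
    by (subst cf_Abs'[OF a]) (auto simp: sp_def)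
qed

instance
  by standard (auto intro!: ts_eqI simp: algebra_simps)
end

lemma sp_0 [simp]: "sp 0 = {}" and sp_minus [simp]: "sp (- x) = sp x"
  and sp_add: "sp (x + y) \<subseteq> sp x \<union> sp y" and sp_diff: "sp (x - y) \<subseteq> sp x \<union> sp y"
  and sp_scaleR: "sp (r *\<^sub>R x) \<subseteq> sp x"
  by (auto simp: sp_def)

lemma sp_eq_empty [simp]: "sp x = {} \<longleftrightarrow> x = 0"
  by (auto simp: sp_def) (rule ts_eqI, simp)

lemma cf_sum: "cf (sum f A) c = (\<Sum>i\<in>A. cf (f i) c)"
  by (induction A rule: infinite_finite_induct) auto

lemma conv_finite1: "finite {a. cf x a \<noteq> 0 \<and> cf y (c - a) \<noteq> 0}"
  by (rule finite_subset[OF _ wo_decomp_finite[OF wo_sp[of x] wo_sp[of y], of c]]) (auto simp: sp_def)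

instantiation ts :: comm_ring_1
begin
definition "1 = mon 0"
text \<open>An infinite sum over all monomials with finitely many nonzero terms; this form allows
  Fubini and reindexing without tracking index sets.\<close>

definition "x * y = Abs_ts (\<lambda>c. infsum (\<lambda>a. cf x a * cf y (c - a)) UNIV)"

lemma cf_times_infsum: "cf (x * y) c = infsum (\<lambda>a. cf x a * cf y (c - a)) UNIV"
proof -
  have "infsum (\<lambda>a. cf x a * cf y (c - a)) UNIV = 0" if "c \<notin> sp x + sp y" for c
  proof -
    have "cf x a * cf y (c - a) = 0" for a
      using that set_plus_intro[of a "sp x" "c - a" "sp y"] by (auto simp: sp_def)
    then show ?thesis by (rule infsum_0)
  qed
  then show ?thesis unfolding times_ts_def
    by (subst cf_Abs'[OF adm_plus[OF adm_sp[of x] adm_sp[of y]]]) blast+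
qed

lemma cf_times_eq:
  assumes "finite S" "\<And>a. cf x a \<noteq> 0 \<Longrightarrow> cf y (c - a) \<noteq> 0 \<Longrightarrow> a \<in> S"
  shows "cf (x * y) c = (\<Sum>a\<in>S. cf x a * cf y (c - a))"
  unfolding cf_times_infsum using assms by (intro infsum_finite_support) auto

lemma cf_times_mult_lts: "cf (x * y) c = mult_lts (cf x) (cf y) c"
  unfolding mult_lts_def using conv_finite1[of x y c]
  by (subst cf_times_eq[of "{a. cf x a \<noteq> 0 \<and> cf y (c - a) \<noteq> 0}"]) (auto simp: sp_def)

lemma cf_mon_times: "fd a \<Longrightarrow> cf (mon a * x) c = cf x (c - a)"
  by (subst cf_times_eq[of "{a}"]) (auto simp: cf_mon split: if_splits)

lemma ts_assoc: "x * y * z = x * (y * (z :: ts))"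
  proof (rule ts_eqI)
    fix c :: lmon
    let ?P = "{(b,a). cf x a * cf y (b - a) * cf z (c - b) \<noteq> 0}"
    \<comment> \<open>The triple product meets \<open>c\<close> in finitely many ways:
      \<open>b\<close> ranges over decompositions of \<open>c\<close>, and for each \<open>b\<close>
      the index \<open>a\<close> over those of \<open>b\<close>.\<close>
    have "finite {b \<in> sp x + sp y. c - b \<in> sp z}"
      by (intro wo_decomp_finite wo_plus) auto
    then have fin: "finite (SIGMA b:{b \<in> sp x + sp y. c - b \<in> sp z}. {a. cf x a \<noteq> 0 \<and> cf y (b - a) \<noteq> 0})"
      using conv_finite1 by (intro finite_SigmaI)
    have sub: "?P \<subseteq> (SIGMA b:{b \<in> sp x + sp y. c - b \<in> sp z}. {a. cf x a \<noteq> 0 \<and> cf y (b - a) \<noteq> 0})"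
    proof
      fix p assume "p \<in> ?P"
      then obtain b a where p: "p = (b,a)" and h: "cf x a * cf y (b - a) * cf z (c - b) \<noteq> 0" by auto
      then have "a + (b - a) \<in> sp x + sp y" by (intro set_plus_intro) (auto simp: sp_def)
      then show "p \<in> (SIGMA b:{b \<in> sp x + sp y. c - b \<in> sp z}. {a. cf x a \<noteq> 0 \<and> cf y (b - a) \<noteq> 0})"
        using h by (auto simp: sp_def p)
    qed
    have fP: "finite ?P" using finite_subset[OF sub fin] .
    have s1: "(\<lambda>(b,a). cf x a * cf y (b - a) * cf z (c - b)) summable_on (UNIV \<times> UNIV)"
      by (rule summable_finite_support) (rule finite_subset[OF _ fP], auto)
    have "cf (x * y * z) c = (\<Sum>\<^sub>\<infinity>b. (\<Sum>\<^sub>\<infinity>a. cf x a * cf y (b - a)) * cf z (c - b))"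
      by (simp add: cf_times_infsum)
    also have "\<dots> = (\<Sum>\<^sub>\<infinity>b. \<Sum>\<^sub>\<infinity>a. cf x a * cf y (b - a) * cf z (c - b))"
      by (simp add: infsum_cmult_left')
    also have "\<dots> = (\<Sum>\<^sub>\<infinity>a. \<Sum>\<^sub>\<infinity>b. cf x a * cf y (b - a) * cf z (c - b))"
      by (rule infsum_swap_banach[OF s1])
    also have "\<dots> = (\<Sum>\<^sub>\<infinity>a. \<Sum>\<^sub>\<infinity>d. cf x a * cf y d * cf z (c - a - d))"
    proof (rule infsum_cong)
      fix a :: lmon
      have "bij (\<lambda>d. a + d)" by (rule o_bij[of "\<lambda>d. d - a"]) (auto simp: fun_eq_iff)
      from infsum_reindex_bij_betw[OF this, of "\<lambda>b. cf x a * cf y (b - a) * cf z (c - b)"]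
      show "(\<Sum>\<^sub>\<infinity>b. cf x a * cf y (b - a) * cf z (c - b)) = (\<Sum>\<^sub>\<infinity>d. cf x a * cf y d * cf z (c - a - d))"
        by (simp add: diff_diff_add)
    qed
    also have "\<dots> = (\<Sum>\<^sub>\<infinity>a. cf x a * (\<Sum>\<^sub>\<infinity>d. cf y d * cf z (c - a - d)))"
      by (simp add: infsum_cmult_right' mult.assoc)
    also have "\<dots> = cf (x * (y * z)) c" by (simp add: cf_times_infsum)
    finally show "cf (x * y * z) c = cf (x * (y * z)) c" .
  qed

lemma ts_comm: "x * y = y * (x :: ts)"
  proof (rule ts_eqI)
    fix c :: lmon
    have "bij (\<lambda>d. c - d)" by (rule o_bij[of "\<lambda>d. c - d"]) (auto simp: fun_eq_iff)
    from infsum_reindex_bij_betw[OF this, of "\<lambda>b. cf x b * cf y (c - b)"]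
    show "cf (x * y) c = cf (y * x) c" by (simp add: cf_times_infsum mult.commute)
  qed

lemma ts_distrib: "(x + y) * z = x * z + y * (z :: ts)"
  proof (rule ts_eqI)
    fix c :: lmon
    let ?S = "{a. cf x a \<noteq> 0 \<and> cf z (c - a) \<noteq> 0} \<union> {a. cf y a \<noteq> 0 \<and> cf z (c - a) \<noteq> 0}"
    have f: "finite ?S" using conv_finite1 by blast
    show "cf ((x + y) * z) c = cf (x * z + y * z) c"
      by (simp, (subst cf_times_eq[OF f]; (force)?)+) (simp add: algebra_simps sum.distrib)
  qed

instance
proof
  fix x y z :: ts
  show "x * y * z = x * (y * z)" by (rule ts_assoc)
  show "x * y = y * x" by (rule ts_comm)
  show "(x + y) * z = x * z + y * z" by (rule ts_distrib)
  show "1 * x = x" by (rule ts_eqI) (simp add: one_ts_def cf_mon_times)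
  have "cf 0 0 \<noteq> cf 1 0" by (simp add: one_ts_def cf_mon)
  then show "(0::ts) \<noteq> 1" by metis
qed
end

instance ts :: real_algebra_1
proof
  fix r and x y :: ts
  show "r *\<^sub>R x * y = r *\<^sub>R (x * y)"
    by (rule ts_eqI) (simp add: cf_times_infsum mult.assoc infsum_cmult_right')
next
  fix r and x y :: ts
  have "cf x a * cf (r *\<^sub>R y) b = r * (cf x a * cf y b)" for a b by simp
  then show "x * r *\<^sub>R y = r *\<^sub>R (x * y)"
    by (intro ts_eqI) (simp only: cf_times_infsum infsum_cmult_right' cf_simps(5))
qed

lemma cf_one: "cf 1 c = (if c = 0 then 1 else 0)"
  by (simp add: one_ts_def cf_mon)

lemma sp_one [simp]: "sp 1 = {0}"
  by (simp add: one_ts_def sp_mon)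

lemma mon_0 [simp]: "mon 0 = 1"
  by (simp add: one_ts_def)

lemma cf_one_eq: "cf 1 = lmonom 0"
  by (rule ext) (simp add: cf_one lmonom_def)

lemma cf_of_real: "cf (of_real r) c = (if c = 0 then r else 0)"
  by (simp add: of_real_def cf_one)

lemma mon_add: "fd a \<Longrightarrow> fd b \<Longrightarrow> mon (a + b) = mon a * mon b"
proof (rule ts_eqI)
  fix c assume "fd a" "fd b"
  moreover have "c - a = b \<longleftrightarrow> c = a + b" by (simp add: diff_eq_eq add.commute)
  ultimately show "cf (mon (a + b)) c = cf (mon a * mon b) c" by (simp add: cf_mon_times cf_mon)
qed

lemma sp_times: "sp (x * y) \<subseteq> sp x + sp y"
proof
  fix c :: lmon assume "c \<in> sp (x * y)"
  then have "infsum (\<lambda>a. cf x a * cf y (c - a)) UNIV \<noteq> 0"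
    by (simp add: sp_def cf_times_infsum)
  from infsum_nonzero[OF this] obtain a where "a \<in> sp x" "c - a \<in> sp y" by (auto simp: sp_def)
  then have "a + (c - a) \<in> sp x + sp y" by (rule set_plus_intro)
  then show "c \<in> sp x + sp y" by simp
qed

lemma sp_power: "sp (x ^ n) \<subseteq> msum n (sp x)"
proof (induction n)
  case (Suc n)
  have "sp (x ^ Suc n) \<subseteq> sp x + sp (x ^ n)" using sp_times by simp
  also have "\<dots> \<subseteq> sp x + msum n (sp x)" using Suc by (intro set_plus_mono2) auto
  finally show ?case by simp
qed simp

lemma cf_power: "cf (x ^ n) = power_lts (cf x) n"
proof (induction n)
  case 0 show ?case by (simp add: cf_one_eq)
next
  case (Suc n)
  show ?case by (rule ext) (simp add: cf_times_mult_lts Suc)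
qed

section \<open>Strong summation\<close>

text \<open>Summability in the algebraic sense: one admissible set contains all supports and each
  coefficient receives finitely many contributions, so that Fubini holds without estimates.\<close>

definition hsummable :: "('i \<Rightarrow> ts) \<Rightarrow> 'i set \<Rightarrow> bool" where
  "hsummable F I \<longleftrightarrow> adm (\<Union>i\<in>I. sp (F i)) \<and> (\<forall>c. finite {i \<in> I. cf (F i) c \<noteq> 0})"

definition hsum :: "('i \<Rightarrow> ts) \<Rightarrow> 'i set \<Rightarrow> ts" where
  "hsum F I = Abs_ts (\<lambda>c. infsum (\<lambda>i. cf (F i) c) I)"

lemma hsummableI:
  assumes "adm W" "\<And>i. i \<in> I \<Longrightarrow> sp (F i) \<subseteq> W" "\<And>c. finite {i \<in> I. cf (F i) c \<noteq> 0}"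
  shows "hsummable F I"
proof -
  have "(\<Union>i\<in>I. sp (F i)) \<subseteq> W" using assms(2) by (rule UN_least)
  then show ?thesis using assms(1,3) adm_subset unfolding hsummable_def by blast
qed

lemma hsummableD:
  "hsummable F I \<Longrightarrow> adm (\<Union>i\<in>I. sp (F i))" "hsummable F I \<Longrightarrow> finite {i \<in> I. cf (F i) c \<noteq> 0}"
  by (auto simp: hsummable_def)

lemma cf_hsum: "hsummable F I \<Longrightarrow> cf (hsum F I) c = infsum (\<lambda>i. cf (F i) c) I"
  unfolding hsum_def
proof (subst cf_Abs'[of "\<Union>i\<in>I. sp (F i)"])
  show "{c. infsum (\<lambda>i. cf (F i) c) I \<noteq> 0} \<subseteq> (\<Union>i\<in>I. sp (F i))"
    by (auto simp: sp_def dest!: infsum_nonzero)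
qed (auto simp: hsummable_def)

lemma cf_hsum_sum:
  assumes "hsummable F I" "finite S" "S \<subseteq> I" "\<And>i. i \<in> I \<Longrightarrow> i \<notin> S \<Longrightarrow> cf (F i) c = 0"
  shows "cf (hsum F I) c = (\<Sum>i\<in>S. cf (F i) c)"
  using assms by (simp add: cf_hsum infsum_finite_support)

lemma sp_hsum: "sp (hsum F I) \<subseteq> W" if "hsummable F I" "\<And>i. i \<in> I \<Longrightarrow> sp (F i) \<subseteq> W"
proof
  fix c :: lmon assume "c \<in> sp (hsum F I)"
  then have "\<exists>i\<in>I. cf (F i) c \<noteq> 0"
    using that(1) by (intro infsum_nonzero) (simp add: sp_def cf_hsum)
  then show "c \<in> W" using that(2) by (auto simp: sp_def)
qed

lemma hsum_cong: "(\<And>i. i \<in> I \<Longrightarrow> F i = G i) \<Longrightarrow> hsum F I = hsum G I"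
  unfolding hsum_def by (metis (mono_tags, lifting) infsum_cong)

lemma hsummable_cong: "(\<And>i. i \<in> I \<Longrightarrow> F i = G i) \<Longrightarrow> hsummable F I = hsummable G I"
  unfolding hsummable_def by (simp cong: conj_cong)

lemma hsummable_summable: "hsummable F I \<Longrightarrow> (\<lambda>i. cf (F i) c) summable_on I"
  by (rule summable_finite_support) (rule hsummableD)

lemma adm_UN_finite: "finite I \<Longrightarrow> (\<And>i. i \<in> I \<Longrightarrow> adm (A i)) \<Longrightarrow> adm (\<Union>i\<in>I. A i)"
  by (induction I rule: finite_induct) (auto intro: adm_un)

lemma hsummable_finite: "finite I \<Longrightarrow> hsummable F I"
  unfolding hsummable_def by (auto intro!: adm_UN_finite)

lemma hsum_finite: "finite I \<Longrightarrow> hsum F I = sum F I"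
  by (rule ts_eqI) (simp add: cf_hsum hsummable_finite cf_sum)

lemma hsummable_subset: "hsummable F I \<Longrightarrow> J \<subseteq> I \<Longrightarrow> hsummable F J"
  by (rule hsummableI[of "\<Union>i\<in>I. sp (F i)"])
    (auto simp: hsummable_def intro: rev_finite_subset)

lemma hsummable_neutral:
  assumes "hsummable F I" "\<And>i. i \<in> J \<Longrightarrow> i \<notin> I \<Longrightarrow> F i = 0" shows "hsummable F J"
proof (rule hsummableI)
  show "adm (\<Union>i\<in>I. sp (F i))" using assms by (simp add: hsummable_def)
  show "sp (F i) \<subseteq> (\<Union>i\<in>I. sp (F i))" if "i \<in> J" for i using assms(2)[OF that] by (cases "i \<in> I") auto
  fix c :: lmon show "finite {i \<in> J. cf (F i) c \<noteq> 0}"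
    by (rule finite_subset[OF _ hsummableD(2)[OF assms(1), of c]]) (use assms(2) in force)
qed

lemma hsum_neutral:
  assumes "hsummable F I" "I \<subseteq> J" "\<And>i. i \<in> J \<Longrightarrow> i \<notin> I \<Longrightarrow> F i = 0"
  shows "hsum F J = hsum F I"
  unfolding hsum_def using assms by (intro arg_cong[of _ _ Abs_ts] ext infsum_cong_neutral) auto

lemma hsummable_add: "hsummable F I \<Longrightarrow> hsummable G I \<Longrightarrow> hsummable (\<lambda>i. F i + G i) I"
proof (rule hsummableI)
  assume F: "hsummable F I" and G: "hsummable G I"
  then show "adm ((\<Union>i\<in>I. sp (F i)) \<union> (\<Union>i\<in>I. sp (G i)))" by (intro adm_un) (auto simp: hsummable_def)
  fix i assume "i \<in> I" then show "sp (F i + G i) \<subseteq> (\<Union>i\<in>I. sp (F i)) \<union> (\<Union>i\<in>I. sp (G i))"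
    using sp_add[of "F i" "G i"] by blast
next
  fix c :: lmon assume F: "hsummable F I" and G: "hsummable G I"
  have "finite ({i \<in> I. cf (F i) c \<noteq> 0} \<union> {i \<in> I. cf (G i) c \<noteq> 0})"
    using F G by (simp add: hsummable_def)
  then show "finite {i \<in> I. cf (F i + G i) c \<noteq> 0}" by (rule rev_finite_subset) auto
qed

lemma hsum_add: "hsummable F I \<Longrightarrow> hsummable G I \<Longrightarrow> hsum (\<lambda>i. F i + G i) I = hsum F I + hsum G I"
  by (rule ts_eqI) (simp add: cf_hsum hsummable_add infsum_add hsummable_summable)

lemma hsummable_scaleR: "hsummable F I \<Longrightarrow> hsummable (\<lambda>i. r i *\<^sub>R F i) I"
proof (rule hsummableI)
  assume F: "hsummable F I"
  then show "adm (\<Union>i\<in>I. sp (F i))" by (simp add: hsummable_def)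
  show "sp (r i *\<^sub>R F i) \<subseteq> (\<Union>i\<in>I. sp (F i))" if "i \<in> I" for i using that by (auto simp: sp_def)
  show "finite {i \<in> I. cf (r i *\<^sub>R F i) c \<noteq> 0}" for c
    by (rule finite_subset[OF _ hsummableD(2)[OF F, of c]]) auto
qed

lemma hsum_scaleR: "hsummable F I \<Longrightarrow> hsum (\<lambda>i. r *\<^sub>R F i) I = r *\<^sub>R hsum F I"
  using hsummable_scaleR[of F I "\<lambda>_. r"] by (intro ts_eqI) (simp add: cf_hsum infsum_cmult_right')

lemma hsummable_uminus: "hsummable F I \<Longrightarrow> hsummable (\<lambda>i. - F i) I"
  using hsummable_scaleR[of F I "\<lambda>_. -1"] by simp

lemma hsum_uminus: "hsummable F I \<Longrightarrow> hsum (\<lambda>i. - F i) I = - hsum F I"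
  using hsum_scaleR[of F I "-1"] by simp

lemma hsummable_diff: "hsummable F I \<Longrightarrow> hsummable G I \<Longrightarrow> hsummable (\<lambda>i. F i - G i) I"
  using hsummable_add[OF _ hsummable_uminus, of F I G] by simp

lemma hsum_diff: "hsummable F I \<Longrightarrow> hsummable G I \<Longrightarrow> hsum (\<lambda>i. F i - G i) I = hsum F I - hsum G I"
  using hsum_add[OF _ hsummable_uminus, of F I G] by (simp add: hsum_uminus)

lemma hsummable_Sigma:
  assumes "hsummable (\<lambda>(i,j). F i j) (Sigma I J)"
  shows "i \<in> I \<Longrightarrow> hsummable (F i) (J i)" "hsummable (\<lambda>i. hsum (F i) (J i)) I"
proof -
  let ?W = "\<Union>p\<in>Sigma I J. sp (case p of (i,j) \<Rightarrow> F i j)"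
  have W: "adm ?W" using assms by (rule hsummableD)
  have sub: "sp (F i j) \<subseteq> ?W" if "i \<in> I" "j \<in> J i" for i j
    using that by (intro SUP_upper2[of "(i,j)"]) auto
  have fin: "finite {p \<in> Sigma I J. cf (case p of (i,j) \<Rightarrow> F i j) c \<noteq> 0}" for c
    using assms by (rule hsummableD)
  show 1: "hsummable (F i) (J i)" if i: "i \<in> I" for i
  proof (rule hsummableI[OF W])
    show "sp (F i j) \<subseteq> ?W" if "j \<in> J i" for j using sub i that by blast
    show "finite {j \<in> J i. cf (F i j) c \<noteq> 0}" for c
      by (rule finite_subset[OF _ finite_imageI[OF fin[of c], of snd]]) (use i in force)
  qed
  show "hsummable (\<lambda>i. hsum (F i) (J i)) I"
  proof (rule hsummableI[OF W])
    show "sp (hsum (F i) (J i)) \<subseteq> ?W" if i: "i \<in> I" for i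
      using sub i by (intro sp_hsum 1)
    fix c :: lmon
    have "\<exists>j\<in>J i. cf (F i j) c \<noteq> 0" if "i \<in> I" "cf (hsum (F i) (J i)) c \<noteq> 0" for i
      using that(2) by (intro infsum_nonzero) (simp add: cf_hsum[OF 1[OF that(1)]])
    then show "finite {i \<in> I. cf (hsum (F i) (J i)) c \<noteq> 0}"
      by (intro finite_subset[OF _ finite_imageI[OF fin[of c], of fst]]) force
  qed
qed

lemma hsum_Sigma:
  assumes "hsummable (\<lambda>(i,j). F i j) (Sigma I J)"
  shows "hsum (\<lambda>i. hsum (F i) (J i)) I = hsum (\<lambda>(i,j). F i j) (Sigma I J)"
proof (rule ts_eqI)
  fix c :: lmon
  have "(\<lambda>p. cf (case p of (i,j) \<Rightarrow> F i j) c) summable_on Sigma I J"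
    by (rule hsummable_summable[OF assms])
  then have s: "(\<lambda>(i,j). cf (F i j) c) summable_on Sigma I J"
    by (simp add: case_prod_beta')
  have "cf (hsum (\<lambda>i. hsum (F i) (J i)) I) c = (\<Sum>\<^sub>\<infinity>i\<in>I. \<Sum>\<^sub>\<infinity>j\<in>J i. cf (F i j) c)"
    using hsummable_Sigma[OF assms] by (simp add: cf_hsum cong: infsum_cong)
  also have "\<dots> = infsum (\<lambda>(i,j). cf (F i j) c) (Sigma I J)"
    by (rule infsum_Sigma'_banach[OF s])
  also have "\<dots> = cf (hsum (\<lambda>(i,j). F i j) (Sigma I J)) c"
    unfolding cf_hsum[OF assms] by (simp add: case_prod_beta')
  finally show "cf (hsum (\<lambda>i. hsum (F i) (J i)) I) c = cf (hsum (\<lambda>(i,j). F i j) (Sigma I J)) c" .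
qed

lemma hsummable_reindex:
  assumes "bij_betw g A B" shows "hsummable (\<lambda>i. F (g i)) A \<longleftrightarrow> hsummable F B"
proof -
  have "(\<Union>i\<in>A. sp (F (g i))) = (\<Union>i\<in>B. sp (F i))"
    using assms by (metis bij_betw_imp_surj_on image_image)
  moreover have "finite {i \<in> A. cf (F (g i)) c \<noteq> 0} \<longleftrightarrow> finite {i \<in> B. cf (F i) c \<noteq> 0}" for c
  proof (rule bij_betw_finite)
    show "bij_betw g {i \<in> A. cf (F (g i)) c \<noteq> 0} {i \<in> B. cf (F i) c \<noteq> 0}"
      using assms by (auto simp: bij_betw_def inj_on_def)
  qed
  ultimately show ?thesis by (simp add: hsummable_def)
qed

lemma hsum_reindex: "bij_betw g A B \<Longrightarrow> hsum (\<lambda>i. F (g i)) A = hsum F B"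
  unfolding hsum_def
  by (intro arg_cong[of _ _ Abs_ts] ext infsum_reindex_bij_betw[of g A B "\<lambda>i. cf (F i) c" for c])

lemma hsummable_swap: "hsummable (\<lambda>(i,j). F i j) (I \<times> J) \<longleftrightarrow> hsummable (\<lambda>(j,i). F i j) (J \<times> I)"
  using hsummable_reindex[of prod.swap "I \<times> J" "J \<times> I" "\<lambda>(j,i). F i j"]
  by (simp add: bij_betw_def product_swap case_prod_beta')

lemma hsum_swap:
  assumes "hsummable (\<lambda>(i,j). F i j) (I \<times> J)"
  shows "hsum (\<lambda>i. hsum (F i) J) I = hsum (\<lambda>j. hsum (\<lambda>i. F i j) I) J"
proof -
  have "hsum (\<lambda>(i,j). F i j) (I \<times> J) = hsum (\<lambda>(j,i). F i j) (J \<times> I)"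
    using hsum_reindex[of prod.swap "I \<times> J" "J \<times> I" "\<lambda>(j,i). F i j"]
    by (simp add: bij_betw_def product_swap case_prod_beta')
  then show ?thesis
    using hsum_Sigma[OF assms] hsum_Sigma[OF assms[unfolded hsummable_swap[of F]]] by simp
qed

text \<open>A monomial \<open>c\<close> splits between the two united supports in finitely many
  ways, and each part is met by finitely many members of its family.\<close>

lemma hsummable_times:
  assumes F: "hsummable F I" and G: "hsummable G J"
  shows "hsummable (\<lambda>(i,j). F i * G j) (I \<times> J)"
proof (rule hsummableI)
  let ?A = "\<Union>i\<in>I. sp (F i)" and ?B = "\<Union>j\<in>J. sp (G j)"
  have A: "adm ?A" and B: "adm ?B" using F G by (auto simp: hsummable_def)
  then show "adm (?A + ?B)" by (rule adm_plus)
  show "sp (case p of (i,j) \<Rightarrow> F i * G j) \<subseteq> ?A + ?B" if pIJ: "p \<in> I \<times> J" for p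
  proof -
    obtain i j where p: "p = (i,j)" "i \<in> I" "j \<in> J" using pIJ by auto
    have "sp (F i * G j) \<subseteq> sp (F i) + sp (G j)" by (rule sp_times)
    also have "\<dots> \<subseteq> ?A + ?B" using p by (intro set_plus_mono2) auto
    finally show ?thesis using p by simp
  qed
  fix c :: lmon
  let ?D = "{a \<in> ?A. c - a \<in> ?B}"
  have D: "finite ?D" using A B by (intro wo_decomp_finite) (auto simp: adm_def)
  have "finite (\<Union>a\<in>?D. {i \<in> I. cf (F i) a \<noteq> 0} \<times> {j \<in> J. cf (G j) (c - a) \<noteq> 0})"
    using D F G by (intro finite_UN_I finite_cartesian_product) (auto simp: hsummable_def)
  then show "finite {p \<in> I \<times> J. cf (case p of (i,j) \<Rightarrow> F i * G j) c \<noteq> 0}"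
  proof (rule rev_finite_subset, clarify)
    fix i j assume ij: "i \<in> I" "j \<in> J" and n: "cf (F i * G j) c \<noteq> 0"
    have "\<exists>a. cf (F i) a * cf (G j) (c - a) \<noteq> 0"
      using infsum_nonzero[OF n[unfolded cf_times_infsum]] by blast
    then obtain a where "cf (F i) a \<noteq> 0" "cf (G j) (c - a) \<noteq> 0" by auto
    then show "(i,j) \<in> (\<Union>a\<in>?D. {i \<in> I. cf (F i) a \<noteq> 0} \<times> {j \<in> J. cf (G j) (c - a) \<noteq> 0})"
      using ij by (intro UN_I[of a]) (auto simp: sp_def)
  qed
qed

lemma hsum_times_left:
  assumes F: "hsummable F I" shows "hsummable (\<lambda>i. y * F i) I" "hsum (\<lambda>i. y * F i) I = y * hsum F I"
proof -
  have "hsummable (\<lambda>(i,j). y * F j) ({()} \<times> I)"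
    using hsummable_times[OF hsummable_finite[of "{()}" "\<lambda>_. y"] F] by simp
  from hsummable_Sigma(1)[OF this] show s: "hsummable (\<lambda>i. y * F i) I" by simp
  show "hsum (\<lambda>i. y * F i) I = y * hsum F I"
  proof (rule ts_eqI)
    fix c :: lmon
    let ?A = "\<Union>i\<in>I. sp (F i)"
    have A: "well_ordered ?A" using F by (auto simp: hsummable_def adm_def)
    let ?D = "{a \<in> sp y. c - a \<in> ?A}"
    have D: "finite ?D" by (intro wo_decomp_finite A) auto
    let ?K = "\<Union>a\<in>?D. {i \<in> I. cf (F i) (c - a) \<noteq> 0}"
    have K: "finite ?K" using D F by (auto simp: hsummable_def)
    have y: "cf (y * F i) c = (\<Sum>a\<in>?D. cf y a * cf (F i) (c - a))" if "i \<in> I" for i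
      using that by (intro cf_times_eq D) (auto simp: sp_def)
    have "cf (hsum (\<lambda>i. y * F i) I) c = (\<Sum>i\<in>?K. cf (y * F i) c)"
      by (rule cf_hsum_sum[OF s K]) (auto simp: y intro!: sum.neutral)
    also have "\<dots> = (\<Sum>i\<in>?K. \<Sum>a\<in>?D. cf y a * cf (F i) (c - a))"
      by (rule sum.cong) (auto simp: y)
    also have "\<dots> = (\<Sum>a\<in>?D. cf y a * (\<Sum>i\<in>?K. cf (F i) (c - a)))"
      by (subst sum.swap) (simp add: sum_distrib_left)
    also have "\<dots> = (\<Sum>a\<in>?D. cf y a * cf (hsum F I) (c - a))"
      by (intro sum.cong refl arg_cong2[of _ _ _ _ "(*)"] cf_hsum_sum[OF F K, symmetric]) auto
    also have "\<dots> = cf (y * hsum F I) c"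
    proof (rule cf_times_eq[OF D, symmetric])
      have "sp (hsum F I) \<subseteq> ?A" by (rule sp_hsum[OF F]) auto
      then show "a \<in> ?D" if "cf y a \<noteq> 0" "cf (hsum F I) (c - a) \<noteq> 0" for a
        using that unfolding sp_def by blast
    qed
    finally show "cf (hsum (\<lambda>i. y * F i) I) c = cf (y * hsum F I) c" .
  qed
qed

lemma hsum_times:
  assumes F: "hsummable F I" and G: "hsummable G J"
  shows "hsum (\<lambda>(i,j). F i * G j) (I \<times> J) = hsum F I * hsum G J"
proof -
  have "hsum (\<lambda>(i,j). F i * G j) (I \<times> J) = hsum (\<lambda>i. hsum (\<lambda>j. F i * G j) J) I"
    by (rule hsum_Sigma[symmetric]) (rule hsummable_times[OF assms])
  also have "\<dots> = hsum (\<lambda>i. hsum G J * F i) I"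
    by (intro hsum_cong) (simp add: hsum_times_left[OF G] mult.commute)
  also have "\<dots> = hsum G J * hsum F I"
    by (rule hsum_times_left(2)[OF F])
  also have "\<dots> = hsum F I * hsum G J" by (rule mult.commute)
  finally show ?thesis .
qed

section \<open>Strongly linear maps\<close>

text \<open>Phrased on monomials, where it can be checked from supports; \<open>slin_hsum\<close>
  shows that it gives commutation with arbitrary strong sums.\<close>

definition slin :: "(ts \<Rightarrow> ts) \<Rightarrow> bool" where
  "slin T \<longleftrightarrow> (\<forall>W. adm W \<longrightarrow> hsummable (\<lambda>m. T (mon m)) W)
     \<and> (\<forall>x. T x = hsum (\<lambda>m. cf x m *\<^sub>R T (mon m)) UNIV)"

lemma slinD:
  assumes "slin T"
  shows "adm W \<Longrightarrow> hsummable (\<lambda>m. T (mon m)) W" "hsummable (\<lambda>m. cf x m *\<^sub>R T (mon m)) UNIV"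
    "T x = hsum (\<lambda>m. cf x m *\<^sub>R T (mon m)) UNIV"
proof -
  show "adm W \<Longrightarrow> hsummable (\<lambda>m. T (mon m)) W" "T x = hsum (\<lambda>m. cf x m *\<^sub>R T (mon m)) UNIV"
    using assms unfolding slin_def by blast+
  have "hsummable (\<lambda>m. cf x m *\<^sub>R T (mon m)) (sp x)"
    using assms adm_sp unfolding slin_def by (intro hsummable_scaleR) blast
  then show "hsummable (\<lambda>m. cf x m *\<^sub>R T (mon m)) UNIV"
    by (rule hsummable_neutral) (simp add: sp_def)
qed

lemma mon_expansion: "hsummable (\<lambda>m. cf x m *\<^sub>R mon m) UNIV" "hsum (\<lambda>m. cf x m *\<^sub>R mon m) UNIV = x"
proof -
  show s: "hsummable (\<lambda>m. cf x m *\<^sub>R mon m) UNIV"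
  proof (rule hsummableI[OF adm_sp[of x]])
    show "sp (cf x m *\<^sub>R mon m) \<subseteq> sp x" for m by (auto simp: sp_def cf_mon split: if_splits)
    show "finite {m \<in> UNIV. cf (cf x m *\<^sub>R mon m) c \<noteq> 0}" for c
      by (rule finite_subset[of _ "{c}"]) (auto simp: cf_mon split: if_splits)
  qed
  show "hsum (\<lambda>m. cf x m *\<^sub>R mon m) UNIV = x"
    by (rule ts_eqI, subst cf_hsum_sum[OF s, of "{c}" for c]) (auto simp: cf_mon cf_nonfd)
qed

text \<open>After expansion over the common support the double family stays summable: a coefficient
  sees finitely many monomials \<open>m\<close> through \<open>T\<close>, and each \<open>m\<close>
  occurs in finitely many \<open>F i\<close>.\<close>

lemma slin_hsum:
  assumes T: "slin T" and F: "hsummable F I"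
  shows "hsummable (\<lambda>i. T (F i)) I" "T (hsum F I) = hsum (\<lambda>i. T (F i)) I"
proof -
  let ?W = "\<Union>i\<in>I. sp (F i)"
  have W: "adm ?W" using F by (rule hsummableD)
  have TW: "hsummable (\<lambda>m. T (mon m)) ?W" by (rule slinD(1)[OF T W])
  have "hsummable (\<lambda>(i,m). cf (F i) m *\<^sub>R T (mon m)) (I \<times> ?W)"
  proof (rule hsummableI[OF hsummableD(1)[OF TW]])
    show "sp (case p of (i,m) \<Rightarrow> cf (F i) m *\<^sub>R T (mon m)) \<subseteq> (\<Union>m\<in>?W. sp (T (mon m)))" if "p \<in> I \<times> ?W" for p
      using that sp_scaleR by fastforce
    fix c :: lmon
    have "finite (\<Union>m\<in>{m \<in> ?W. cf (T (mon m)) c \<noteq> 0}. {i \<in> I. cf (F i) m \<noteq> 0} \<times> {m})"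
      using F TW by (auto simp: hsummable_def)
    then show "finite {p \<in> I \<times> ?W. cf (case p of (i,m) \<Rightarrow> cf (F i) m *\<^sub>R T (mon m)) c \<noteq> 0}"
      by (rule rev_finite_subset) auto
  qed
  note s = this
  have TF: "T (F i) = hsum (\<lambda>m. cf (F i) m *\<^sub>R T (mon m)) ?W" if "i \<in> I" for i
  proof -
    have "T (F i) = hsum (\<lambda>m. cf (F i) m *\<^sub>R T (mon m)) UNIV" by (rule slinD(3)[OF T])
    also have "\<dots> = hsum (\<lambda>m. cf (F i) m *\<^sub>R T (mon m)) ?W"
      using that by (intro hsum_neutral hsummable_subset[OF slinD(2)[OF T]]) (auto simp: sp_def)
    finally show ?thesis .
  qed
  have "hsummable (\<lambda>i. hsum (\<lambda>m. cf (F i) m *\<^sub>R T (mon m)) ?W) I"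
    by (rule hsummable_Sigma(2)[OF s])
  then show "hsummable (\<lambda>i. T (F i)) I" using TF hsummable_cong by (metis (no_types, lifting))
  have cW: "cf (hsum F I) m = 0" if "m \<notin> ?W" for m
    using sp_hsum[OF F, of ?W] that by (auto simp: notin_sp[symmetric])
  have "hsum (\<lambda>i. T (F i)) I = hsum (\<lambda>i. hsum (\<lambda>m. cf (F i) m *\<^sub>R T (mon m)) ?W) I"
    by (rule hsum_cong) (rule TF)
  also have "\<dots> = hsum (\<lambda>m. hsum (\<lambda>i. cf (F i) m *\<^sub>R T (mon m)) I) ?W"
    by (rule hsum_swap[OF s])
  also have "\<dots> = hsum (\<lambda>m. cf (hsum F I) m *\<^sub>R T (mon m)) ?W"
  proof (rule hsum_cong)
    fix m assume "m \<in> ?W"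
    then have s2: "hsummable (\<lambda>i. cf (F i) m *\<^sub>R T (mon m)) I"
      using hsummable_Sigma(1)[OF s[unfolded hsummable_swap[of "\<lambda>i m. cf (F i) m *\<^sub>R T (mon m)"]]] by blast
    show "hsum (\<lambda>i. cf (F i) m *\<^sub>R T (mon m)) I = cf (hsum F I) m *\<^sub>R T (mon m)"
      by (rule ts_eqI) (simp add: cf_hsum[OF s2] cf_hsum[OF F] infsum_cmult_left')
  qed
  also have "\<dots> = hsum (\<lambda>m. cf (hsum F I) m *\<^sub>R T (mon m)) UNIV"
    by (intro hsum_neutral[symmetric] hsummable_subset[OF slinD(2)[OF T]]) (auto simp: cW)
  also have "\<dots> = T (hsum F I)" by (rule slinD(3)[OF T, symmetric])
  finally show "T (hsum F I) = hsum (\<lambda>i. T (F i)) I" by simp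
qed

lemma slin_scaleR: "slin T \<Longrightarrow> T (r *\<^sub>R x) = r *\<^sub>R T x"
  using slinD(3)[of T "r *\<^sub>R x"] slinD(3)[of T x] hsum_scaleR[OF slinD(2)[of T x], of r] by simp

lemma slin_add: "slin T \<Longrightarrow> T (x + y) = T x + T y"
  using slinD(3)[of T "x + y"] slinD(3)[of T x] slinD(3)[of T y] hsum_add[OF slinD(2)[of T x] slinD(2)[of T y]]
  by (simp add: scaleR_add_left)

lemma slin_0: "slin T \<Longrightarrow> T 0 = 0"
  using slin_scaleR[of T 0 0] by simp

lemma slin_uminus: "slin T \<Longrightarrow> T (- x) = - T x"
  using slin_scaleR[of T "-1" x] by simp

lemma slin_diff: "slin T \<Longrightarrow> T (x - y) = T x - T y"
  using slin_add[of T x "- y"] slin_uminus[of T y] by simp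

lemma slin_sum: "slin T \<Longrightarrow> T (sum f A) = (\<Sum>i\<in>A. T (f i))"
  by (induction A rule: infinite_finite_induct) (auto simp: slin_0 slin_add)

text \<open>Families indexed by monomials suffice as tests, since the expansion of an element is
  such a family.\<close>

lemma slinI:
  assumes "\<And>x F (I::lmon set). hsummable F I \<Longrightarrow> hsummable (\<lambda>i. T (F i)) I \<and> T (hsum F I) = hsum (\<lambda>i. T (F i)) I"
    and "\<And>r x. T (r *\<^sub>R x) = r *\<^sub>R T x"
  shows "slin T"
  unfolding slin_def
proof (intro conjI allI impI)
  fix W assume W: "adm W"
  have "hsummable mon W"
    by (rule hsummableI[OF W]) (auto simp: sp_def cf_mon split: if_splits intro: finite_subset[of _ "{c}" for c])
  then show "hsummable (\<lambda>m. T (mon m)) W" using assms(1) by blast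
next
  fix x
  have "T x = T (hsum (\<lambda>m. cf x m *\<^sub>R mon m) UNIV)" by (simp add: mon_expansion)
  also have "\<dots> = hsum (\<lambda>m. cf x m *\<^sub>R T (mon m)) UNIV"
    using assms(1)[OF mon_expansion(1)[of x]] by (simp add: assms(2))
  finally show "T x = hsum (\<lambda>m. cf x m *\<^sub>R T (mon m)) UNIV" .
qed

lemma slin_id: "slin (\<lambda>x. x)"
  by (rule slinI) auto

lemma slin_comp: "slin T \<Longrightarrow> slin U \<Longrightarrow> slin (\<lambda>x. T (U x))"
  by (rule slinI) (simp_all add: slin_hsum(2) slin_hsum(1)[of U] slin_hsum(1)[of T, OF _ slin_hsum(1)[of U]] slin_scaleR)

lemma slin_times: "slin T \<Longrightarrow> slin (\<lambda>x. y * T x)"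
  by (rule slinI) (simp_all add: slin_hsum slin_scaleR hsum_times_left)

lemma slin_plus: "slin T \<Longrightarrow> slin U \<Longrightarrow> slin (\<lambda>x. T x + U x)"
  by (rule slinI) (simp_all add: slin_hsum slin_scaleR hsum_add hsummable_add scaleR_add_right)

lemma slin_minus: "slin T \<Longrightarrow> slin U \<Longrightarrow> slin (\<lambda>x. T x - U x)"
  by (rule slinI) (simp_all add: slin_hsum slin_scaleR hsum_diff hsummable_diff scaleR_diff_right)

lemma slin_cmult: "slin T \<Longrightarrow> slin (\<lambda>x. r *\<^sub>R T x)"
  by (rule slinI) (simp_all add: slin_hsum slin_scaleR hsum_scaleR hsummable_scaleR)

lemma slin_eqI:
  assumes "slin T" "slin U" "\<And>m. fd m \<Longrightarrow> T (mon m) = U (mon m)" shows "T x = U x"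
proof -
  have "cf x m *\<^sub>R T (mon m) = cf x m *\<^sub>R U (mon m)" for m
    using assms(3)[of m] cf_nonfd[of m x] by (cases "fd m") auto
  then show ?thesis by (simp only: slinD(3)[OF assms(1), of x] slinD(3)[OF assms(2), of x])
qed

definition extend :: "(lmon \<Rightarrow> ts) \<Rightarrow> ts \<Rightarrow> ts" where
  "extend K x = hsum (\<lambda>m. cf x m *\<^sub>R K m) UNIV"

lemma extend_mon:
  assumes "\<And>W. adm W \<Longrightarrow> hsummable K W" "fd m" shows "extend K (mon m) = K m"
proof -
  have s: "hsummable (\<lambda>a. cf (mon m) a *\<^sub>R K a) {m}" by (rule hsummable_finite) simp
  have "extend K (mon m) = hsum (\<lambda>a. cf (mon m) a *\<^sub>R K a) {m}"
    unfolding extend_def by (rule hsum_neutral[OF s]) (auto simp: cf_mon)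
  then show ?thesis using assms(2) by (simp add: hsum_finite cf_mon)
qed

lemma slin_extend:
  assumes "\<And>W. adm W \<Longrightarrow> hsummable K W" shows "slin (extend K)"
  unfolding slin_def
proof (intro conjI allI impI)
  fix W assume W: "adm W"
  have "extend K (mon m) = K m" if "m \<in> W" for m
    using extend_mon[OF assms] that W by (auto simp: adm_def fd_def)
  then show "hsummable (\<lambda>m. extend K (mon m)) W" using assms[OF W] hsummable_cong by (metis (no_types, lifting))
next
  fix x show "extend K x = hsum (\<lambda>m. cf x m *\<^sub>R extend K (mon m)) UNIV"
    unfolding extend_def[of K x]
  proof (rule hsum_cong)
    show "cf x m *\<^sub>R K m = cf x m *\<^sub>R extend K (mon m)" for m
      using extend_mon[OF assms, of m] cf_nonfd[of m x] by (cases "fd m") auto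
  qed
qed

text \<open>Both arguments are expanded at once, since a product of two strong sums is the strong
  sum of the products.\<close>

lemma slin_mult:
  assumes T: "slin T" and m: "\<And>a b. fd a \<Longrightarrow> fd b \<Longrightarrow> T (mon (a + b)) = T (mon a) * T (mon b)"
  shows "T (x * y) = T x * T y"
proof -
  note e = mon_expansion(1)[of x] mon_expansion(1)[of y]
  have "T (x * y) = T (hsum (\<lambda>(a,b). (cf x a *\<^sub>R mon a) * (cf y b *\<^sub>R mon b)) (UNIV \<times> UNIV))"
    by (subst hsum_times[OF e]) (simp add: mon_expansion)
  also have "\<dots> = hsum (\<lambda>p. T (case p of (a,b) \<Rightarrow> (cf x a *\<^sub>R mon a) * (cf y b *\<^sub>R mon b))) (UNIV \<times> UNIV)"
    by (rule slin_hsum(2)[OF T hsummable_times[OF e]])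
  also have "\<dots> = hsum (\<lambda>(a,b). (cf x a *\<^sub>R T (mon a)) * (cf y b *\<^sub>R T (mon b))) (UNIV \<times> UNIV)"
  proof (rule hsum_cong, clarify)
    fix a b
    show "T (cf x a *\<^sub>R mon a * cf y b *\<^sub>R mon b) = cf x a *\<^sub>R T (mon a) * cf y b *\<^sub>R T (mon b)"
      by (cases "fd a \<and> fd b") (auto simp: slin_scaleR[OF T] m mon_add[symmetric] cf_nonfd slin_0[OF T])
  qed
  also have "\<dots> = T x * T y"
    by (subst hsum_times) (simp_all add: slinD(2)[OF T] flip: slinD(3)[OF T])
  finally show ?thesis .
qed

text \<open>Extended one argument at a time, both sides being strongly linear in each.\<close>

lemma slin_leibniz:
  assumes T: "slin T" and m: "\<And>a b. fd a \<Longrightarrow> fd b \<Longrightarrow> T (mon (a + b)) = T (mon a) * mon b + mon a * T (mon b)"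
  shows "T (x * y) = T x * y + x * T y"
proof -
  have 1: "T (mon a * y) = T (mon a) * y + mon a * T y" if "fd a" for a
  proof (rule slin_eqI[of "\<lambda>y. T (mon a * y)" "\<lambda>y. T (mon a) * y + mon a * T y"])
    show "slin (\<lambda>x. T (mon a * x))" "slin (\<lambda>x. T (mon a) * x + mon a * T x)"
      by (intro slin_comp[OF T] slin_times slin_id slin_plus T)+
  qed (use m that in \<open>simp add: mon_add\<close>)
  show ?thesis
  proof (rule slin_eqI[of "\<lambda>x. T (x * y)" "\<lambda>x. T x * y + x * T y"])
    show "slin (\<lambda>x. T (x * y))" "slin (\<lambda>x. T x * y + x * T y)"
      unfolding mult.commute[of _ y] mult.commute[of _ "T y"]
      by (intro slin_comp[OF T] slin_times slin_id slin_plus T)+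
  qed (use 1 in simp)
qed

text \<open>The hypothesis concerns the joint family over indices and monomials. Summability of each
  \<open>T i\<close> alone would not allow the two summations to be interchanged.\<close>

lemma slin_family:
  assumes "\<And>i. i \<in> I \<Longrightarrow> slin (T i)"
    and W: "\<And>W. adm W \<Longrightarrow> hsummable (\<lambda>(i,m). T i (mon m)) (I \<times> W)"
  shows "hsummable (\<lambda>i. T i x) I" "slin (\<lambda>x. hsum (\<lambda>i. T i x) I)"
proof -
  have s: "hsummable (\<lambda>(i,m). cf x m *\<^sub>R T i (mon m)) (I \<times> sp x)" for x
    using hsummable_scaleR[OF W[OF adm_sp[of x]], of "\<lambda>p. cf x (snd p)"] by (simp add: case_prod_beta')
  have Tx: "T i x = hsum (\<lambda>m. cf x m *\<^sub>R T i (mon m)) (sp x)" if "i \<in> I" for i x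
  proof -
    have "T i x = hsum (\<lambda>m. cf x m *\<^sub>R T i (mon m)) UNIV" by (rule slinD(3)[OF assms(1)[OF that]])
    also have "\<dots> = hsum (\<lambda>m. cf x m *\<^sub>R T i (mon m)) (sp x)"
      by (intro hsum_neutral hsummable_subset[OF slinD(2)[OF assms(1)[OF that]]]) (auto simp: sp_def)
    finally show ?thesis .
  qed
  show "hsummable (\<lambda>i. T i x) I" for x
    using hsummable_Sigma(2)[OF s[of x]] Tx hsummable_cong by (metis (no_types, lifting))
  note sx = this
  show "slin (\<lambda>x. hsum (\<lambda>i. T i x) I)"
    unfolding slin_def
  proof (intro conjI allI impI)
    fix V assume "adm V"
    from W[OF this] have "hsummable (\<lambda>(m,i). T i (mon m)) (V \<times> I)"
      by (simp add: hsummable_swap[of "\<lambda>i m. T i (mon m)"])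
    then show "hsummable (\<lambda>m. hsum (\<lambda>i. T i (mon m)) I) V" by (rule hsummable_Sigma(2))
  next
    fix x
    have "hsum (\<lambda>i. T i x) I = hsum (\<lambda>i. hsum (\<lambda>m. cf x m *\<^sub>R T i (mon m)) (sp x)) I"
      by (rule hsum_cong) (rule Tx)
    also have "\<dots> = hsum (\<lambda>m. hsum (\<lambda>i. cf x m *\<^sub>R T i (mon m)) I) (sp x)" by (rule hsum_swap[OF s])
    also have "\<dots> = hsum (\<lambda>m. cf x m *\<^sub>R hsum (\<lambda>i. T i (mon m)) I) (sp x)"
      by (intro hsum_cong hsum_scaleR sx)
    also have "\<dots> = hsum (\<lambda>m. cf x m *\<^sub>R hsum (\<lambda>i. T i (mon m)) I) UNIV"
    proof (rule hsum_neutral[symmetric])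
      have "hsummable (\<lambda>(m,i). cf x m *\<^sub>R T i (mon m)) (sp x \<times> I)"
        using s[of x] by (simp add: hsummable_swap[of "\<lambda>i m. cf x m *\<^sub>R T i (mon m)"])
      from hsummable_Sigma(2)[OF this]
      show "hsummable (\<lambda>m. cf x m *\<^sub>R hsum (\<lambda>i. T i (mon m)) I) (sp x)"
        by (simp add: hsum_scaleR[OF sx])
    qed (auto simp: sp_def)
    finally show "hsum (\<lambda>i. T i x) I = hsum (\<lambda>m. cf x m *\<^sub>R hsum (\<lambda>i. T i (mon m)) I) UNIV" .
  qed
qed

unbundle no vec_syntax
unbundle fps_syntax

section \<open>Infinitesimals and real power series\<close>

definition small :: "ts \<Rightarrow> bool" where
  "small x \<longleftrightarrow> (\<forall>a\<in>sp x. 0 < a)"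

lemma smallD: "small x \<Longrightarrow> a \<in> sp x \<Longrightarrow> 0 < a"
  by (simp add: small_def)

lemma small_cf: "small x \<Longrightarrow> \<not> 0 < a \<Longrightarrow> cf x a = 0"
  using smallD[of x a] by (auto simp: sp_def)

lemma small_0 [simp]: "small 0"
  by (simp add: small_def)

lemma small_add: "small x \<Longrightarrow> small y \<Longrightarrow> small (x + y)"
  using sp_add[of x y] by (auto simp: small_def)

lemma small_diff: "small x \<Longrightarrow> small y \<Longrightarrow> small (x - y)"
  using sp_diff[of x y] by (auto simp: small_def)

lemma small_uminus [simp]: "small (- x) \<longleftrightarrow> small x"
  by (simp add: small_def)

lemma small_scaleR: "small x \<Longrightarrow> small (r *\<^sub>R x)"
  using sp_scaleR[of r x] by (auto simp: small_def)

lemma small_times: "small x \<Longrightarrow> small y \<Longrightarrow> small (x * y)"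
  using sp_times[of x y] by (fastforce simp: small_def set_plus_def intro: add_pos_pos)

lemma small_hsum: "hsummable F I \<Longrightarrow> (\<And>i. i \<in> I \<Longrightarrow> small (F i)) \<Longrightarrow> small (hsum F I)"
  using sp_hsum[of F I "{a. 0 < a}"] by (auto simp: small_def)

lemma sp_power_mgen: "sp (x ^ n) \<subseteq> mgen (sp x)"
  using sp_power msum_subset_mgen by blast

lemma small_hsummable: assumes "small x" shows "hsummable (\<lambda>n. r n *\<^sub>R x ^ n) I"
proof (rule hsummableI)
  show "adm (mgen (sp x))" using assms by (intro adm_mgen) (auto simp: small_def)
  show "sp (r i *\<^sub>R x ^ i) \<subseteq> mgen (sp x)" for i using sp_scaleR sp_power_mgen by blast
  fix c
  have "{i \<in> I. cf (r i *\<^sub>R x ^ i) c \<noteq> 0} \<subseteq> {n. c \<in> msum n (sp x)}"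
    using sp_power by (auto simp: sp_def)
  then show "finite {i \<in> I. cf (r i *\<^sub>R x ^ i) c \<noteq> 0}"
    using mgen_finite_degree[OF wo_sp[of x]] assms by (auto simp: small_def intro: finite_subset)
qed

text \<open>Evaluation of a real formal power series at an infinitesimal. It is a ring homomorphism
  compatible with composition, so identities for the exponential, logarithmic and binomial series
  are imported from formal power series.\<close>

definition fev :: "real fps \<Rightarrow> ts \<Rightarrow> ts" where
  "fev F x = hsum (\<lambda>n. (F $ n) *\<^sub>R x ^ n) UNIV"

lemma sp_fev: "small x \<Longrightarrow> sp (fev F x) \<subseteq> mgen (sp x)"
  unfolding fev_def using sp_scaleR sp_power_mgen by (intro sp_hsum small_hsummable) blast+

lemma fev_add: "small x \<Longrightarrow> fev (F + G) x = fev F x + fev G x"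
  unfolding fev_def by (subst hsum_add[symmetric]) (simp_all add: small_hsummable scaleR_add_left)

lemma fev_diff: "small x \<Longrightarrow> fev (F - G) x = fev F x - fev G x"
  unfolding fev_def by (subst hsum_diff[symmetric]) (simp_all add: small_hsummable scaleR_diff_left)

lemma fev_eq_sum:
  assumes "finite A" "\<And>n. n \<notin> A \<Longrightarrow> F $ n = 0" shows "fev F x = (\<Sum>n\<in>A. (F $ n) *\<^sub>R x ^ n)"
proof -
  have "fev F x = hsum (\<lambda>n. (F $ n) *\<^sub>R x ^ n) A"
    unfolding fev_def by (rule hsum_neutral) (use assms in \<open>auto intro: hsummable_finite\<close>)
  then show ?thesis by (simp add: hsum_finite assms(1))
qed

lemma fev_1: "fev 1 x = 1"
  by (subst fev_eq_sum[of "{0}"]) auto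

lemma fev_X: "fev fps_X x = x"
  by (subst fev_eq_sum[of "{1}"]) auto

lemma hsum_cauchy:
  fixes A B :: "nat \<Rightarrow> ts"
  assumes A: "hsummable A UNIV" and B: "hsummable B UNIV"
  shows "hsummable (\<lambda>n. \<Sum>i=0..n. A i * B (n - i)) UNIV"
    "hsum (\<lambda>n. \<Sum>i=0..n. A i * B (n - i)) UNIV = hsum A UNIV * hsum B UNIV"
proof -
  have bij: "bij_betw (\<lambda>(n,i). (i, n - i)) (SIGMA n:(UNIV::nat set). {0..n}) (UNIV \<times> UNIV)"
    by (rule bij_betwI[of _ _ _ "\<lambda>(i,j). (i + j, i)"]) auto
  have f: "(\<lambda>p. case (case p of (n,i) \<Rightarrow> (i, n - i)) of (i,j) \<Rightarrow> A i * B j) = (\<lambda>(n,i). A i * B (n - i))"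
    by (auto simp: fun_eq_iff)
  note p = hsummable_times[OF A B]
  have s: "hsummable (\<lambda>(n,i). A i * B (n - i)) (SIGMA n:(UNIV::nat set). {0..n})"
    using hsummable_reindex[OF bij, of "\<lambda>(i,j). A i * B j"] p unfolding f by simp
  show "hsummable (\<lambda>n. \<Sum>i=0..n. A i * B (n - i)) UNIV"
    using hsummable_Sigma(2)[OF s] by (simp add: hsum_finite)
  have "hsum (\<lambda>n. \<Sum>i=0..n. A i * B (n - i)) UNIV = hsum (\<lambda>(n,i). A i * B (n - i)) (SIGMA n:(UNIV::nat set). {0..n})"
    using hsum_Sigma[OF s] by (simp add: hsum_finite)
  also have "\<dots> = hsum (\<lambda>(i,j). A i * B j) (UNIV \<times> UNIV)"
    using hsum_reindex[OF bij, of "\<lambda>(i,j). A i * B j"] unfolding f .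
  also have "\<dots> = hsum A UNIV * hsum B UNIV" by (rule hsum_times[OF A B])
  finally show "hsum (\<lambda>n. \<Sum>i=0..n. A i * B (n - i)) UNIV = hsum A UNIV * hsum B UNIV" .
qed

lemma fev_mult: assumes "small x" shows "fev (F * G) x = fev F x * fev G x"
proof -
  note s = small_hsummable[OF assms]
  have "fev F x * fev G x = hsum (\<lambda>n. \<Sum>i=0..n. ((F $ i) *\<^sub>R x ^ i) * ((G $ (n - i)) *\<^sub>R x ^ (n - i))) UNIV"
    unfolding fev_def by (rule hsum_cauchy(2)[symmetric]) (rule s)+
  also have "\<dots> = fev (F * G) x"
    unfolding fev_def
  proof (rule hsum_cong)
    fix n
    have "((F $ i) *\<^sub>R x ^ i) * ((G $ (n - i)) *\<^sub>R x ^ (n - i)) = (F $ i * G $ (n - i)) *\<^sub>R x ^ n" if "i \<le> n" for i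
      using that by (simp add: power_add[symmetric] mult.commute)
    then show "(\<Sum>i=0..n. ((F $ i) *\<^sub>R x ^ i) * ((G $ (n - i)) *\<^sub>R x ^ (n - i))) = ((F * G) $ n) *\<^sub>R x ^ n"
      by (simp add: fps_mult_nth scaleR_sum_left)
  qed
  finally show ?thesis by simp
qed

lemma fev_power: "small x \<Longrightarrow> fev (F ^ n) x = fev F x ^ n"
  by (induction n) (auto simp: fev_1 fev_mult)

lemma small_power: "small x \<Longrightarrow> n \<noteq> 0 \<Longrightarrow> small (x ^ n)"
proof (induction n)
  case (Suc n)
  then show ?case by (cases "n = 0") (auto intro: small_times)
qed simp

lemma small_fev: assumes "small x" "F $ 0 = 0" shows "small (fev F x)"
  unfolding fev_def
proof (rule small_hsum[OF small_hsummable[OF assms(1)]])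
  show "small ((F $ n) *\<^sub>R x ^ n)" for n
    using assms small_power[of x n] small_scaleR by (cases "n = 0") auto
qed

text \<open>Without constant term, \<open>G ^ i\<close> starts at degree \<open>i\<close>; hence
  only pairs with \<open>i \<le> n\<close> matter, and Neumann's lemma bounds \<open>n\<close> at
  each coefficient.\<close>

lemma fev_compose:
  assumes x: "small x" and G: "G $ 0 = 0" shows "fev (F oo G) x = fev F (fev G x)"
proof -
  have s: "hsummable (\<lambda>(i,n). (F $ i * (G ^ i) $ n) *\<^sub>R x ^ n) (UNIV \<times> UNIV)"
  proof (rule hsummableI)
    show "adm (mgen (sp x))" using x by (intro adm_mgen) (auto simp: small_def)
    show "sp (case p of (i,n) \<Rightarrow> (F $ i * (G ^ i) $ n) *\<^sub>R x ^ n) \<subseteq> mgen (sp x)" for p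
      using sp_scaleR sp_power_mgen by (cases p) fastforce
    fix c
    have fin: "finite {n. c \<in> msum n (sp x)}"
      using mgen_finite_degree[OF wo_sp[of x]] x by (auto simp: small_def)
    have "finite (\<Union>n\<in>{n. c \<in> msum n (sp x)}. {..n} \<times> {n})" using fin by blast
    moreover have "{p \<in> UNIV \<times> UNIV. cf (case p of (i,n) \<Rightarrow> (F $ i * (G ^ i) $ n) *\<^sub>R x ^ n) c \<noteq> 0} \<subseteq> (\<Union>n\<in>{n. c \<in> msum n (sp x)}. {..n} \<times> {n})"
    proof clarify
      fix i n assume "cf ((F $ i * (G ^ i) $ n) *\<^sub>R x ^ n) c \<noteq> 0"
      then have a: "(G ^ i) $ n \<noteq> 0" "cf (x ^ n) c \<noteq> 0" by auto
      have "i \<le> n" using startsby_zero_power_prefix[OF G, of i] a(1) by (meson not_le)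
      moreover have "c \<in> msum n (sp x)" using a(2) sp_power[of x n] by (auto simp: sp_def)
      ultimately show "(i, n) \<in> (\<Union>n\<in>{n. c \<in> msum n (sp x)}. {..n} \<times> {n})" by auto
    qed
    ultimately show "finite {p \<in> UNIV \<times> UNIV. cf (case p of (i,n) \<Rightarrow> (F $ i * (G ^ i) $ n) *\<^sub>R x ^ n) c \<noteq> 0}"
      by (rule rev_finite_subset)
  qed
  have "fev F (fev G x) = hsum (\<lambda>i. (F $ i) *\<^sub>R fev (G ^ i) x) UNIV"
    unfolding fev_def[of F "fev G x"] by (simp add: fev_power[OF x])
  also have "\<dots> = hsum (\<lambda>i. hsum (\<lambda>n. (F $ i * (G ^ i) $ n) *\<^sub>R x ^ n) UNIV) UNIV"
    unfolding fev_def by (simp add: hsum_scaleR[OF small_hsummable[OF x], symmetric])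
  also have "\<dots> = hsum (\<lambda>n. hsum (\<lambda>i. (F $ i * (G ^ i) $ n) *\<^sub>R x ^ n) UNIV) UNIV"
    by (rule hsum_swap[OF s])
  also have "\<dots> = fev (F oo G) x"
    unfolding fev_def
  proof (rule hsum_cong)
    fix n
    have "hsum (\<lambda>i. (F $ i * (G ^ i) $ n) *\<^sub>R x ^ n) UNIV = hsum (\<lambda>i. (F $ i * (G ^ i) $ n) *\<^sub>R x ^ n) {0..n}"
      using startsby_zero_power_prefix[OF G]
      by (intro hsum_neutral hsummable_finite) (auto simp: not_le)
    then show "hsum (\<lambda>i. (F $ i * (G ^ i) $ n) *\<^sub>R x ^ n) UNIV = ((F oo G) $ n) *\<^sub>R x ^ n"
      by (simp add: hsum_finite fps_compose_nth scaleR_sum_left)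
  qed
  finally show ?thesis by simp
qed

lemma slin_fev:
  assumes "slin T" "\<And>x y. T (x * y) = T x * T y" "T 1 = 1" "small x" "small (T x)"
  shows "T (fev F x) = fev F (T x)"
proof -
  have "T (x ^ n) = T x ^ n" for n by (induction n) (auto simp: assms)
  then show ?thesis
    unfolding fev_def using slin_hsum(2)[OF assms(1) small_hsummable[OF assms(4)]] slin_scaleR[OF assms(1)] by simp
qed

section \<open>Exponential and logarithm of infinitesimals\<close>

definition tExp :: "ts \<Rightarrow> ts" where "tExp x = fev (fps_exp 1) x"
definition tLn :: "ts \<Rightarrow> ts" where "tLn x = fev (fps_ln 1) x"
definition tBin :: "real \<Rightarrow> ts \<Rightarrow> ts" where "tBin s x = fev (fps_binomial s) x"

lemma tExp_0 [simp]: "tExp 0 = 1"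
  unfolding tExp_def fev_def by (subst hsum_neutral[of _ "{0}"]) (auto simp: hsummable_finite hsum_finite zero_power)

lemma tExp_add: assumes "small x" "small y" shows "tExp (x + y) = tExp x * tExp y"
proof -
  have "tExp x * tExp y = hsum (\<lambda>n. \<Sum>i=0..n. ((fps_exp 1 $ i) *\<^sub>R x ^ i) * ((fps_exp 1 $ (n - i)) *\<^sub>R y ^ (n - i))) UNIV"
    unfolding tExp_def fev_def by (rule hsum_cauchy(2)[symmetric]) (auto intro: small_hsummable assms)
  also have "\<dots> = tExp (x + y)"
    unfolding tExp_def fev_def
  proof (rule hsum_cong)
    fix n
    have "(fps_exp (1::real) $ n) *\<^sub>R (x + y) ^ n = (\<Sum>i=0..n. (1 / fact n) *\<^sub>R (of_nat (n choose i) * x ^ i * y ^ (n - i)))"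
      by (simp add: binomial_ring scaleR_sum_right atMost_atLeast0)
    also have "\<dots> = (\<Sum>i=0..n. ((fps_exp 1 $ i) *\<^sub>R x ^ i) * ((fps_exp 1 $ (n - i)) *\<^sub>R y ^ (n - i)))"
    proof (rule sum.cong)
      fix i assume "i \<in> {0..n}"
      then have "(1 / fact n) * real (n choose i) = 1 / fact i * (1 / fact (n - i))"
        by (simp add: binomial_fact)
      moreover have "of_nat (n choose i) * x ^ i * y ^ (n - i) = real (n choose i) *\<^sub>R (x ^ i * y ^ (n - i))"
        by (simp add: scaleR_conv_of_real mult.assoc)
      ultimately show "(1 / fact n) *\<^sub>R (of_nat (n choose i) * x ^ i * y ^ (n - i)) =
          ((fps_exp 1 $ i) *\<^sub>R x ^ i) * ((fps_exp 1 $ (n - i)) *\<^sub>R y ^ (n - i))"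
        by simp
    qed simp
    finally show "(\<Sum>i=0..n. ((fps_exp 1 $ i) *\<^sub>R x ^ i) * ((fps_exp 1 $ (n - i)) *\<^sub>R y ^ (n - i))) = (fps_exp (1::real) $ n) *\<^sub>R (x + y) ^ n"
      by simp
  qed
  finally show ?thesis by simp
qed

lemma small_tLn: "small x \<Longrightarrow> small (tLn x)"
  unfolding tLn_def by (rule small_fev) (auto simp: fps_ln_def)

lemma small_tExp: "small x \<Longrightarrow> small (tExp x - 1)"
proof -
  assume "small x"
  moreover have "tExp x - 1 = fev (fps_exp 1 - 1) x" if "small x" using that by (simp add: tExp_def fev_diff fev_1)
  ultimately show "small (tExp x - 1)" using small_fev[of x "fps_exp 1 - 1"] by simp
qed

lemma tExp_tLn: assumes "small x" shows "tExp (tLn x) = 1 + x"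
proof -
  have "(fps_exp 1 - 1) oo fps_ln (1::real) = fps_X"
    using fps_inv_fps_exp_compose(2)[of "1::real"] by (simp add: fps_ln_fps_exp_inv)
  then have "fps_exp 1 oo fps_ln (1::real) = fps_X + 1"
    by (simp add: fps_compose_sub_distrib algebra_simps)
  then show ?thesis using fev_compose[OF assms, of "fps_ln 1" "fps_exp 1"] assms
    by (simp add: tExp_def tLn_def fev_add fev_X fev_1 add.commute)
qed

lemma tLn_tExp: assumes "small x" shows "tLn (tExp x - 1) = x"
proof -
  have "fps_ln (1::real) oo (fps_exp 1 - 1) = fps_X"
    using fps_inv_fps_exp_compose(1)[of "1::real"] by (simp add: fps_ln_fps_exp_inv)
  then show ?thesis using fev_compose[OF assms, of "fps_exp 1 - 1" "fps_ln 1"] assms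
    by (simp add: tExp_def tLn_def fev_diff fev_X fev_1)
qed

lemma tExp_inj: "small x \<Longrightarrow> small y \<Longrightarrow> tExp x = tExp y \<Longrightarrow> x = y"
  by (metis tLn_tExp)

lemma tExp_scaleR: "tExp (s *\<^sub>R x) = fev (fps_exp s) x"
proof -
  have "(s *\<^sub>R x) ^ n = (s ^ n) *\<^sub>R x ^ n" for n by (induction n) auto
  then show ?thesis unfolding tExp_def fev_def by (simp only: fps_exp_nth scaleR_scaleR) simp
qed

text \<open>The composite of the binomial series with exp - 1 solves h' = s h with h(0) = 1, which
  characterizes exp(s X). Real powers thereby become scalings of the logarithm.\<close>

lemma tBin_tExp: assumes "small x" shows "tBin s (tExp x - 1) = tExp (s *\<^sub>R x)"
proof -
  let ?e = "fps_exp (1::real) - 1"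
  let ?h = "fps_binomial s oo ?e"
  have e0: "?e $ 0 = 0" by simp
  have inv: "inverse (1 + fps_X) oo ?e = inverse (fps_exp 1)"
    using fps_inverse_compose[OF e0, of "1 + fps_X"] by (simp add: fps_compose_add_distrib)
  have "fps_deriv ?h = (fps_deriv (fps_binomial s) oo ?e) * fps_deriv ?e"
    by (rule fps_compose_deriv) simp
  also have "fps_deriv (fps_binomial s) = fps_const s * fps_binomial s * inverse (1 + fps_X)"
    by (simp add: fps_binomial_deriv fps_divide_unit)
  also have "(\<dots> oo ?e) = fps_const s * ?h * inverse (fps_exp 1)"
    by (simp add: fps_compose_mult_distrib[OF e0] inv)
  also have "\<dots> * fps_deriv ?e = fps_const s * ?h * (inverse (fps_exp 1) * fps_exp 1)"
    by (simp add: mult.assoc)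
  also have "inverse (fps_exp 1) * fps_exp (1::real) = 1"
    by (intro inverse_mult_eq_1) simp
  finally have "fps_deriv ?h = fps_const s * ?h" by simp
  then have "?h = fps_exp s" unfolding fps_exp_unique_ODE by simp
  then show ?thesis
    using fev_compose[OF assms, of ?e "fps_binomial s"] assms
    by (simp add: tBin_def tExp_scaleR) (simp add: tExp_def fev_diff fev_1)
qed

lemma sp_tLn: "small x \<Longrightarrow> sp (tLn x) \<subseteq> mgen (sp x)"
  unfolding tLn_def by (rule sp_fev)

lemma sp_tExp: "small x \<Longrightarrow> sp (tExp x) \<subseteq> mgen (sp x)"
  unfolding tExp_def by (rule sp_fev)

section \<open>The field of transseries\<close>

definition ld :: "ts \<Rightarrow> lmon" where "ld x = lead (cf x)"
definition lc :: "ts \<Rightarrow> real" where "lc x = cf x (ld x)"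

lemma ld: assumes "x \<noteq> 0" shows ld_in: "ld x \<in> sp x" and ld_le: "a \<in> sp x \<Longrightarrow> ld x \<le> a"
proof -
  have "sp x \<noteq> {}" using assms by simp
  then obtain m where m: "m \<in> sp x" "\<And>a. a \<in> sp x \<Longrightarrow> m \<le> a"
    using wo_sp[of x, unfolded well_ordered_def, rule_format, of "sp x"] by auto
  have "ld x = m" unfolding ld_def lead_def using m by (intro Least_equality) auto
  then show "ld x \<in> sp x" "a \<in> sp x \<Longrightarrow> ld x \<le> a" using m by auto
qed

lemma lc_nonzero [simp]: "x \<noteq> 0 \<Longrightarrow> lc x \<noteq> 0"
  using ld_in[of x] by (simp add: lc_def sp_def)

lemma fd_ld: "x \<noteq> 0 \<Longrightarrow> fd (ld x)"
  using ld_in fd_sp by blast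

definition eps :: "ts \<Rightarrow> ts" where
  "eps x = (1 / lc x) *\<^sub>R (mon (- ld x) * x) - 1"

lemma cf_eps: assumes "x \<noteq> 0" shows "cf (eps x) = eps_lts (cf x)"
proof
  fix c
  show "cf (eps x) c = eps_lts (cf x) c" using fd_ld[OF assms]
    by (simp add: eps_def eps_lts_def ld_def[symmetric] lc_def cf_mon_times cf_one lmonom_def)
qed

lemma small_eps: assumes "x \<noteq> 0" shows "small (eps x)"
  unfolding small_def
proof
  fix a assume a: "a \<in> sp (eps x)"
  have c: "cf (eps x) a = cf x (a + ld x) / lc x - (if a = 0 then 1 else 0)"
    using fd_ld[OF assms] by (simp add: eps_def cf_mon_times cf_one)
  have "cf x (ld x) / lc x = 1" using lc_nonzero[OF assms] by (simp add: lc_def)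
  with a c have "a \<noteq> 0" by (auto simp: sp_def)
  moreover from this c a have "a + ld x \<in> sp x" by (auto simp: sp_def)
  then have "ld x \<le> a + ld x" by (rule ld_le[OF assms])
  ultimately show "0 < a" by auto
qed

lemma ts_decomp: assumes "x \<noteq> 0" shows "x = lc x *\<^sub>R (mon (ld x) * (1 + eps x))"
proof -
  have "mon (ld x) * (1 + eps x) = (1 / lc x) *\<^sub>R (mon (ld x) * mon (- ld x) * x)"
    by (simp add: eps_def mult.assoc)
  also have "mon (ld x) * mon (- ld x) = 1"
    using fd_ld[OF assms] mon_add[of "ld x" "- ld x"] by simp
  finally show ?thesis using assms by simp
qed

text \<open>The leading data can be read off any factorization of this shape; logarithms of
  substituted series are computed this way.\<close>

lemma ts_lead_unique:
  assumes x: "x = r *\<^sub>R (mon a * (1 + e))" "r \<noteq> 0" "fd a" "small e"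
  shows "x \<noteq> 0" "ld x = a" "lc x = r" "eps x = e"
proof -
  have c: "cf x c = r * (if c = a then 1 else 0) + r * cf e (c - a)" for c
    using assms(3) unfolding x(1) by (simp add: cf_mon_times cf_mon distrib_left)
  have ca: "cf x a = r" using small_cf[OF assms(4), of 0] by (simp add: c)
  then show "x \<noteq> 0" using assms(2) by auto
  have le: "a \<le> b" if "b \<in> sp x" for b
  proof (rule ccontr)
    assume "\<not> a \<le> b"
    then have "cf e (b - a) = 0" "b \<noteq> a" by (auto intro!: small_cf[OF assms(4)])
    then show False using that c by (auto simp: sp_def)
  qed
  show l: "ld x = a"
    unfolding ld_def lead_def using ca assms(2) le by (intro Least_equality) (auto simp: sp_def)
  then show lc: "lc x = r" by (simp add: lc_def ca)
  show "eps x = e"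
    unfolding eps_def l lc using mon_add[of "- a" a] assms(2,3) unfolding x(1)
    by (simp flip: mult.assoc)
qed

text \<open>The series 1 / (1 + X) with explicit coefficients, in the form that occurs in
  \<open>recip_lts\<close>.\<close>

definition gps :: "real fps" where "gps = Abs_fps (\<lambda>n. (- 1) ^ n)"

lemma gps: "(1 + fps_X) * gps = 1"
proof (rule fps_ext)
  fix n show "((1 + fps_X) * gps) $ n = 1 $ n"
    by (cases n) (auto simp: gps_def algebra_simps)
qed

lemma fev_gps: assumes "small x" shows "(1 + x) * fev gps x = 1"
  using fev_mult[OF assms, of "1 + fps_X" gps] assms by (simp add: gps fev_1 fev_add fev_X)

instantiation ts :: field
begin
definition inverse_ts :: "ts \<Rightarrow> ts" where
  "inverse_ts x = (if x = 0 then 0 else (1 / lc x) *\<^sub>R (mon (- ld x) * fev gps (eps x)))"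
definition "x div y = x * inverse (y::ts)"
instance
proof
  fix x y :: ts
  show "inverse x * x = 1" if "x \<noteq> 0"
  proof -
    have "inverse x * x = inverse x * (lc x *\<^sub>R (mon (ld x) * (1 + eps x)))"
      using ts_decomp[OF that] by simp
    also have "\<dots> = (mon (- ld x) * mon (ld x)) * ((1 + eps x) * fev gps (eps x))"
      using that by (simp add: inverse_ts_def mult_ac)
    also have "\<dots> = 1"
      using mon_add[of "- ld x" "ld x"] fd_ld[OF that] fev_gps[OF small_eps[OF that]] by simp
    finally show ?thesis .
  qed
  show "x div y = x * inverse y" by (rule divide_ts_def)
  show "inverse (0::ts) = 0" by (simp add: inverse_ts_def)
qed
end

instance ts :: real_field ..

text \<open>The given operations use real series at each coefficient; this identifies them with
  strong sums, both being finite there.\<close>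

lemma suminf_hsum: assumes "hsummable F (UNIV::nat set)" shows "(\<Sum>i. cf (F i) c) = cf (hsum F UNIV) c"
proof -
  have f: "finite {i. cf (F i) c \<noteq> 0}" using hsummableD(2)[OF assms, of c] by simp
  have "(\<Sum>i. cf (F i) c) = (\<Sum>i\<in>{i. cf (F i) c \<noteq> 0}. cf (F i) c)" by (rule suminf_finite[OF f]) auto
  also have "\<dots> = cf (hsum F UNIV) c" by (rule cf_hsum_sum[OF assms f, symmetric]) auto
  finally show ?thesis .
qed

lemma cf_inverse: assumes "x \<noteq> 0" shows "cf (inverse x) = recip_lts (cf x)"
proof
  fix c
  have s: "hsummable (\<lambda>n. (gps $ n) *\<^sub>R eps x ^ n) UNIV" by (rule small_hsummable[OF small_eps[OF assms]])
  have "cf (inverse x) c = cf (fev gps (eps x)) (c + ld x) / lc x"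
  proof -
    have "inverse x = (1 / lc x) *\<^sub>R (mon (- ld x) * fev gps (eps x))"
      by (simp only: inverse_ts_def assms if_False)
    then show ?thesis by (simp add: cf_mon_times fd_ld[OF assms])
  qed
  also have "cf (fev gps (eps x)) (c + ld x) = (\<Sum>i. cf ((gps $ i) *\<^sub>R eps x ^ i) (c + ld x))"
    unfolding fev_def suminf_hsum[OF s] ..
  also have "\<dots> / lc x = recip_lts (cf x) c"
    unfolding recip_lts_def ld_def[symmetric] lc_def[symmetric] cf_eps[OF assms, symmetric] cf_power[symmetric]
    by (simp only: gps_def fps_nth_Abs_fps cf_simps)
  finally show "cf (inverse x) c = recip_lts (cf x) c" .
qed

lemma cf_powi: assumes "x \<noteq> 0" shows "cf (x powi n) = powi_lts (cf x) n"
  using assms by (simp add: power_int_def powi_lts_def cf_power cf_inverse[symmetric])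

text \<open>The logarithm of a monomial: \<open>mon (- lunit 0)\<close> is - log z, and
  \<open>mon (- lunit (Suc j))\<close> is the negative logarithm of
  \<open>mon (lunit j)\<close>.\<close>

definition lmlog :: "lmon \<Rightarrow> ts" where
  "lmlog a = - (zexp a *\<^sub>R mon (- lunit 0)) - (\<Sum>j | lexp a j \<noteq> 0. real_of_int (lexp a j) *\<^sub>R mon (- lunit (Suc j)))"

definition tlog :: "ts \<Rightarrow> ts" where
  "tlog x = of_real (ln (lc x)) + lmlog (ld x) + tLn (eps x)"

lemma dep_lunit: "j < k \<Longrightarrow> dep k (lunit j)"
  by (auto simp: dep_def)

lemma fd_lunit [simp]: "fd (lunit j)"
  using dep_lunit[of j "Suc j"] by (auto simp: fd_def)

lemma cf_tlog: assumes "x \<noteq> 0" shows "cf (tlog x) = log_lts (cf x)"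
proof
  fix c
  let ?g = "\<lambda>i. cf ((fps_ln 1 $ i) *\<^sub>R eps x ^ i) c"
  note s = small_hsummable[OF small_eps[OF assms]]
  have "finite {i. ?g i \<noteq> 0}" using hsummableD(2)[OF s, of UNIV "\<lambda>i. fps_ln 1 $ i" c] by simp
  then have "summable ?g" by (intro summable_finite[of "{i. ?g i \<noteq> 0}"]) auto
  \<comment> \<open>The logarithmic series has no constant term, while \<open>log_lts\<close>
    numbers its terms from exponent 1; hence the shift.\<close>
  then have "(\<Sum>i. ?g (Suc i)) = suminf ?g - ?g 0" by (rule suminf_split_head)
  also have "suminf ?g = cf (tLn (eps x)) c" unfolding tLn_def fev_def by (rule suminf_hsum[OF s])
  finally have "cf (tLn (eps x)) c = (\<Sum>i. ?g (Suc i))" by simp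
  also have "\<dots> = (\<Sum>i. (-1) ^ i / real (Suc i) * power_lts (eps_lts (cf x)) (Suc i) c)"
    unfolding cf_eps[OF assms, symmetric] cf_power[symmetric] cf_simps fps_ln_nth
    by (intro arg_cong[of _ _ suminf] ext) simp
  finally have L: "cf (tLn (eps x)) c = (\<Sum>i. (-1) ^ i / real (Suc i) * power_lts (eps_lts (cf x)) (Suc i) c)" .
  show "cf (tlog x) c = log_lts (cf x) c"
    unfolding tlog_def cf_simps L log_lts_def Let_def lmlog_def ld_def[symmetric] lc_def[symmetric] cf_sum cf_of_real
    by (simp add: lmonom_def cf_mon)
qed

section \<open>Supports of monomial substitutions\<close>

definition zm :: "real \<Rightarrow> lmon" where "zm \<beta> = LMon \<beta> (\<lambda>_. 0)"

text \<open>The leading monomial of \<open>a\<close> after replacing z by z^p: only the power of z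
  is rescaled, as each iterated logarithm keeps its leading monomial.\<close>

definition sig :: "real \<Rightarrow> lmon \<Rightarrow> lmon" where "sig p a = LMon (p * zexp a) (lexp a)"

text \<open>The purely logarithmic corrections by which the monomials of a substituted monomial may
  exceed its leading one: products of l_1, ..., l_k, a well-ordered monoid.\<close>

definition Emon :: "nat \<Rightarrow> lmon set" where
  "Emon k = {m. zexp m = 0 \<and> (\<forall>i. 0 \<le> lexp m i) \<and> dep k m}"

lemma zm_simps [simp]: "zexp (zm \<beta>) = \<beta>" "lexp (zm \<beta>) i = 0" "dep k (zm \<beta>)" "fd (zm \<beta>)"
  by (auto simp: zm_def dep_def fd_def)

lemma zm_add: "zm (a + b) = zm a + zm b" and zm_0: "zm 0 = 0" and zm_minus: "zm (- a) = - zm a"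
  by (auto intro: lmon_eqI)

lemma sig_simps [simp]: "zexp (sig p a) = p * zexp a" "lexp (sig p a) i = lexp a i"
  "dep k (sig p a) \<longleftrightarrow> dep k a" "fd (sig p a) \<longleftrightarrow> fd a"
  by (auto simp: sig_def dep_def fd_def)

lemma sig_add: "sig p (a + b) = sig p a + sig p b" and sig_0 [simp]: "sig p 0 = 0"
  and sig_1 [simp]: "sig 1 a = a" and sig_sig: "sig p (sig q a) = sig (p * q) a"
  and sig_diff: "sig p (a - b) = sig p a - sig p b" and sig_zm: "sig p (zm \<beta>) = zm (p * \<beta>)"
  by (auto intro!: lmon_eqI simp: algebra_simps)

lemma sig_less: "0 < p \<Longrightarrow> sig p a < sig p b \<longleftrightarrow> a < b"
  by (auto simp: less_lmon_def)

lemma sig_eq: "0 < p \<Longrightarrow> sig p a = sig p b \<longleftrightarrow> a = b"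
  by (metis less_irrefl linorder_neqE sig_less)

lemma sig_le: "0 < p \<Longrightarrow> sig p a \<le> sig p b \<longleftrightarrow> a \<le> b"
  by (simp add: le_less sig_less sig_eq)

lemma adm_sig: assumes "0 < p" "adm W" shows "adm (sig p ` W)"
  using assms wo_image[of W "sig p"] by (auto simp: adm_def sig_le)

lemma lunit_pos [simp]: "0 < lunit j"
  by (auto simp: less_lmon_def intro!: exI[of _ j])

lemma zexp_nonneg: "0 \<le> a \<Longrightarrow> 0 \<le> zexp a"
  by (auto simp: less_eq_lmon_def less_lmon_def)

lemma zexp_mono: "a \<le> b \<Longrightarrow> zexp a \<le> zexp b"
  by (auto simp: less_eq_lmon_def less_lmon_def)

lemma Emon_0 [simp]: "0 \<in> Emon k"
  by (auto simp: Emon_def)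

lemma Emon_add: "a \<in> Emon k \<Longrightarrow> b \<in> Emon k \<Longrightarrow> a + b \<in> Emon k"
  by (auto simp: Emon_def)

lemma Emon_plus: "Emon k + Emon k = Emon k"
proof
  show "Emon k + Emon k \<subseteq> Emon k" by (auto simp: set_plus_def Emon_add)
  show "Emon k \<subseteq> Emon k + Emon k" by (metis Emon_0 set_zero_plus2)
qed

lemma Emon_mono: "k \<le> l \<Longrightarrow> Emon k \<subseteq> Emon l"
  by (auto simp: Emon_def intro: dep_mono)

lemma lunit_Emon: "j < k \<Longrightarrow> lunit j \<in> Emon k"
  by (auto simp: Emon_def dep_lunit)

lemma Emon_subset: "Emon k \<subseteq> mgen {lunit i | i. i < k}"
proof
  fix m assume m: "m \<in> Emon k"
  define N where "N = (\<Sum>i<k. nat (lexp m i))"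
  from m N_def show "m \<in> mgen {lunit i | i. i < k}"
  proof (induction N arbitrary: m)
    case 0
    then have "lexp m i = 0" for i
      by (cases "i < k") (auto simp: Emon_def dep_def order_antisym)
    then have "m = 0" using 0 by (intro lmon_eqI) (auto simp: Emon_def)
    then show ?case by simp
  next
    case (Suc N)
    have "\<exists>i<k. nat (lexp m i) \<noteq> 0"
    proof (rule ccontr)
      assume "\<not> ?thesis"
      then have "(\<Sum>i<k. nat (lexp m i)) = 0" by simp
      then show False using Suc by simp
    qed
    then obtain i where i: "i < k" "0 < lexp m i" by auto
    let ?m = "m - lunit i"
    have "?m \<in> Emon k" using Suc.prems i by (auto simp: Emon_def dep_def)
    moreover have "(\<Sum>j<k. nat (lexp m j)) = nat (lexp m i) + (\<Sum>j\<in>{..<k} - {i}. nat (lexp m j))"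
      using i by (subst sum.remove[of _ i]) auto
    moreover have "(\<Sum>j<k. nat (lexp ?m j)) = nat (lexp m i - 1) + (\<Sum>j\<in>{..<k} - {i}. nat (lexp m j))"
      using i by (subst sum.remove[of _ i]) auto
    ultimately have "?m \<in> mgen {lunit i | i. i < k}" using Suc i by (intro Suc.IH) auto
    moreover have "lunit i \<in> mgen {lunit i | i. i < k}" using i by (auto intro: mgen_base)
    ultimately have "lunit i + ?m \<in> mgen {lunit i | i. i < k}" by (intro mgen_add)
    then show ?case by simp
  qed
qed

lemma adm_Emon [simp]: "adm (Emon k)"
proof (rule adm_subset[OF adm_mgen Emon_subset])
  have "finite {lunit i | i. i < k}" by simp
  then show "adm {lunit i | i. i < k}" unfolding adm_def using wo_finite dep_lunit by blast
qed auto

lemma Emon_nonneg: "a \<in> Emon k \<Longrightarrow> 0 \<le> a"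
  by (rule mgen_nonneg[OF subsetD[OF Emon_subset]]) auto

lemma sig_Emon: "a \<in> Emon k \<Longrightarrow> sig p a = a"
  by (intro lmon_eqI) (auto simp: Emon_def)

text \<open>Bookkeeping for Taylor series, \<open>i\<close> being the order. A monomial
  \<open>c\<close> splits finitely often as \<open>x + z\<close> and \<open>x\<close> as
  \<open>sig p m + e\<close>; Neumann's lemma leaves finitely many \<open>i\<close> for
  \<open>z\<close>, and injectivity of \<open>sig p\<close> recovers \<open>m\<close>.\<close>

lemma hsummable_family:
  assumes W: "adm W" and p: "0 < p" and E: "adm E" and Z: "adm Z" "\<And>a. a \<in> Z \<Longrightarrow> 0 < a"
    and F: "\<And>i m. m \<in> W \<Longrightarrow> sp (F i m) \<subseteq> {sig p m} + E + msum i Z"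
  shows "hsummable (\<lambda>(i,m). F i m) (UNIV \<times> W)"
proof (rule hsummableI)
  let ?X = "sig p ` W + E" and ?M = "mgen Z"
  have M: "adm ?M" by (rule adm_mgen) (use Z in auto)
  have X: "adm ?X" by (intro adm_plus adm_sig W p E)
  show "adm (?X + ?M)" by (intro adm_plus X M)
  show "sp (case q of (i,m) \<Rightarrow> F i m) \<subseteq> ?X + ?M" if q: "q \<in> UNIV \<times> W" for q
  proof -
    obtain i m where im: "q = (i,m)" "m \<in> W" using q by auto
    have "{sig p m} + E + msum i Z \<subseteq> ?X + ?M"
      using im by (intro set_plus_mono2 msum_subset_mgen) auto
    then show ?thesis using F[OF im(2), of i] im by auto
  qed
  fix c
  have f1: "finite {x \<in> ?X. c - x \<in> ?M}" using X M by (intro wo_decomp_finite) (auto simp: adm_def)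
  have f2: "finite {s \<in> sig p ` W. x - s \<in> E}" for x
    using adm_sig[OF p W] E by (intro wo_decomp_finite) (auto simp: adm_def)
  have f3: "finite {i. c - x \<in> msum i Z}" for x
    using mgen_finite_degree[of Z] Z by (auto simp: adm_def)
  have f4: "finite {m \<in> W. x - sig p m \<in> E}" for x
  proof (rule finite_imageD)
    show "finite (sig p ` {m \<in> W. x - sig p m \<in> E})" by (rule finite_subset[OF _ f2[of x]]) auto
    show "inj_on (sig p) {m \<in> W. x - sig p m \<in> E}" by (auto simp: inj_on_def sig_eq[OF p])
  qed
  have "finite (\<Union>x\<in>{x \<in> ?X. c - x \<in> ?M}. {i. c - x \<in> msum i Z} \<times> {m \<in> W. x - sig p m \<in> E})"
    using f1 f3 f4 by (intro finite_UN_I finite_cartesian_product)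
  moreover have "{q \<in> UNIV \<times> W. cf (case q of (i,m) \<Rightarrow> F i m) c \<noteq> 0} \<subseteq>
      (\<Union>x\<in>{x \<in> ?X. c - x \<in> ?M}. {i. c - x \<in> msum i Z} \<times> {m \<in> W. x - sig p m \<in> E})"
  proof
    fix q assume q: "q \<in> {q \<in> UNIV \<times> W. cf (case q of (i,m) \<Rightarrow> F i m) c \<noteq> 0}"
    then obtain i m where im: "q = (i,m)" "m \<in> W" "c \<in> sp (F i m)" by (auto simp: sp_def)
    then obtain e z where ez: "e \<in> E" "z \<in> msum i Z" "c = sig p m + e + z"
      using F[OF im(2), of i] by (auto simp: set_plus_def)
    have x: "sig p m + e \<in> ?X" using im ez by (auto intro: set_plus_intro)
    have "z \<in> ?M" using ez msum_subset_mgen by blast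
    then show "q \<in> (\<Union>x\<in>{x \<in> ?X. c - x \<in> ?M}. {i. c - x \<in> msum i Z} \<times> {m \<in> W. x - sig p m \<in> E})"
      using x im ez by (intro UN_I[of "sig p m + e"]) auto
  qed
  ultimately show "finite {q \<in> UNIV \<times> W. cf (case q of (i,m) \<Rightarrow> F i m) c \<noteq> 0}" by (rule rev_finite_subset)
qed

text \<open>The case of a single order: the family is concentrated at \<open>i = 0\<close>, with
  \<open>Z\<close> empty.\<close>

lemma hsummable_kernel:
  assumes "adm W" "0 < p" "adm E" "\<And>m. m \<in> W \<Longrightarrow> sp (K m) \<subseteq> {sig p m} + E"
  shows "hsummable K W"
proof -
  have "hsummable (\<lambda>(i,m). if i = 0 then K m else 0) ((UNIV::nat set) \<times> W)"
    using assms by (intro hsummable_family[of W p E "{}"]) auto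
  from hsummable_Sigma(1)[OF this, of 0] show ?thesis by simp
qed

lemma adm_dep: assumes "adm W" obtains k where "\<And>m. m \<in> W \<Longrightarrow> dep k m"
  using assms by (auto simp: adm_def)

lemma sp_slin:
  assumes T: "slin T" and x: "\<And>m. m \<in> sp x \<Longrightarrow> sp (T (mon m)) \<subseteq> W"
  shows "sp (T x) \<subseteq> W"
proof -
  have "sp (hsum (\<lambda>m. cf x m *\<^sub>R T (mon m)) UNIV) \<subseteq> W"
  proof (rule sp_hsum[OF slinD(2)[OF T]])
    show "sp (cf x m *\<^sub>R T (mon m)) \<subseteq> W" for m
      using x[of m] by (cases "m \<in> sp x") (auto simp: sp_def)
  qed
  then show ?thesis using slinD(3)[OF T, of x] by simp
qed

lemma cf_slin_single:
  assumes T: "slin T" and "\<And>a. a \<in> sp x \<Longrightarrow> a \<noteq> m \<Longrightarrow> cf (T (mon a)) c = 0"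
  shows "cf (T x) c = cf x m * cf (T (mon m)) c"
proof -
  have "cf (hsum (\<lambda>m. cf x m *\<^sub>R T (mon m)) UNIV) c = (\<Sum>a\<in>{m}. cf (cf x a *\<^sub>R T (mon a)) c)"
    by (rule cf_hsum_sum[OF slinD(2)[OF T]]) (use assms(2) in \<open>auto simp: sp_def\<close>)
  then show ?thesis using slinD(3)[OF T, of x] by simp
qed

lemma cf_extend:
  assumes "\<And>W. adm W \<Longrightarrow> hsummable K W" "\<And>a. fd a \<Longrightarrow> cf (K a) = T a"
  shows "cf (extend K x) = lin_ext T (cf x)"
proof
  fix c
  have eq: "cf x m *\<^sub>R extend K (mon m) = cf x m *\<^sub>R K m" for m
    using extend_mon[OF assms(1), of m] cf_nonfd[of m x] by (cases "fd m") auto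
  have s: "hsummable (\<lambda>m. cf x m *\<^sub>R K m) UNIV"
    using slinD(2)[OF slin_extend[OF assms(1)], of x] by (simp only: eq)
  have "cf (extend K x) c = (\<Sum>\<^sub>\<infinity>m. cf x m * cf (K m) c)"
    unfolding extend_def by (simp add: cf_hsum[OF s])
  also have "\<dots> = (\<Sum>\<^sub>\<infinity>m\<in>sp x. cf x m * T m c)"
    by (rule infsum_cong_neutral) (auto simp: assms(2) fd_sp sp_def)
  finally show "cf (extend K x) c = lin_ext T (cf x) c" by (simp add: lin_ext_def)
qed

section \<open>The derivation\<close>

text \<open>The monomial z^(-1) l_1 ... l_(j+1), which is the logarithmic derivative of
  \<open>mon (lunit j)\<close>.\<close>

definition dlm :: "nat \<Rightarrow> lmon" where "dlm j = LMon (-1) (\<lambda>i. if i \<le> j then 1 else 0)"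

lemma dlm_simps [simp]: "zexp (dlm j) = -1" "lexp (dlm j) i = (if i \<le> j then 1 else 0)"
  by (auto simp: dlm_def)

lemma dep_dlm: "dep k (dlm j) \<longleftrightarrow> j < k"
  by (auto simp: dep_def)

lemma fd_dlm [simp]: "fd (dlm j)"
  using dep_dlm[of "Suc j" j] by (auto simp: fd_def)

text \<open>The logarithmic derivative of the monomial; unlike the derivative it is additive in the
  exponents.\<close>

definition wd :: "lmon \<Rightarrow> ts" where
  "wd a = zexp a *\<^sub>R mon (zm (-1)) + (\<Sum>j | lexp a j \<noteq> 0. real_of_int (lexp a j) *\<^sub>R mon (dlm j))"

lemma wd_eq: assumes "dep k a"
  shows "wd a = zexp a *\<^sub>R mon (zm (-1)) + (\<Sum>j<k. real_of_int (lexp a j) *\<^sub>R mon (dlm j))"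
  unfolding wd_def using assms
  by (intro arg_cong2[of _ _ _ _ "(+)"] refl sum.mono_neutral_left) (auto simp: dep_def not_less[symmetric])

lemma fd_common: assumes "fd a" "fd b" obtains k where "dep k a" "dep k b"
proof -
  obtain k l where "dep k a" "dep l b" using assms by (auto simp: fd_def)
  then show thesis using that[of "max k l"] dep_mono by (metis max.cobounded1 max.cobounded2)
qed

lemma wd_add: assumes "fd a" "fd b" shows "wd (a + b) = wd a + wd b"
proof -
  obtain k where k: "dep k a" "dep k b" using fd_common[OF assms] .
  then show ?thesis
    by (simp add: wd_eq[of k] scaleR_add_left sum.distrib)
qed

lemma sp_wd: assumes "dep k a" shows "sp (wd a) \<subseteq> {zm (-1)} + Emon k"
proof -
  have 1: "zm (-1) \<in> {zm (-1)} + Emon k" using set_plus_intro[of "zm (-1)" "{zm (-1)}" 0 "Emon k"] by simp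
  have 2: "dlm j \<in> {zm (-1)} + Emon k" if "j < k" for j
  proof -
    have "dlm j - zm (-1) \<in> Emon k" using that dep_dlm[of k j] by (auto simp: Emon_def)
    from set_plus_intro[OF _ this, of "zm (-1)" "{zm (-1)}"] show ?thesis by simp
  qed
  have "c \<in> {zm (-1)} + Emon k" if "c \<in> sp (wd a)" for c
  proof (rule ccontr)
    assume n: "c \<notin> {zm (-1)} + Emon k"
    then have "cf (wd a) c = 0"
      using 1 2 by (auto simp: wd_eq[OF assms] cf_sum cf_mon intro!: sum.neutral split: if_splits)
    then show False using that by (simp add: sp_def)
  qed
  then show ?thesis by blast
qed

definition dK :: "lmon \<Rightarrow> ts" where "dK a = mon a * wd a"

lemma sp_dK: assumes "dep k a" shows "sp (dK a) \<subseteq> {a} + ({zm (-1)} + Emon k)"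
proof -
  have "fd a" using assms by (auto simp: fd_def)
  then have "sp (dK a) \<subseteq> {a} + sp (wd a)" unfolding dK_def using sp_times[of "mon a" "wd a"] by (simp add: sp_mon)
  also have "\<dots> \<subseteq> {a} + ({zm (-1)} + Emon k)" using sp_wd[OF assms] by (intro set_plus_mono2) auto
  finally show ?thesis .
qed

lemma hsummable_dK: "adm W \<Longrightarrow> hsummable dK W"
proof -
  assume W: "adm W"
  then obtain k where k: "\<And>m. m \<in> W \<Longrightarrow> dep k m" by (rule adm_dep) blast
  show ?thesis
  proof (rule hsummable_kernel[OF W, of 1])
    show "adm ({zm (-1)} + Emon k)" by (intro adm_plus) auto
    show "sp (dK m) \<subseteq> {sig 1 m} + ({zm (-1)} + Emon k)" if "m \<in> W" for m using sp_dK[OF k[OF that]] by simp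
  qed simp
qed

definition td :: "ts \<Rightarrow> ts" where "td = extend dK"

lemma slin_td: "slin td" and td_mon: "fd a \<Longrightarrow> td (mon a) = mon a * wd a"
  unfolding td_def using slin_extend[OF hsummable_dK] extend_mon[OF hsummable_dK] by (auto simp: dK_def)

lemma cf_td: "cf (td x) = deriv_lts (cf x)"
  unfolding td_def deriv_lts_def
proof (rule cf_extend[OF hsummable_dK])
  fix a assume a: "fd a"
  show "cf (dK a) = deriv_lmonom a"
  proof
    fix c
    have f: "finite {j. lexp a j \<noteq> 0}"
      using a by (auto simp: fd_def dep_def) (metis (mono_tags, lifting) finite_nat_set_iff_bounded mem_Collect_eq not_le)
    have e: "a + zm (-1) = a - LMon 1 (\<lambda>_. 0)" by (rule lmon_eqI) auto
    have "dK a = zexp a *\<^sub>R mon (a + zm (-1)) + (\<Sum>j | lexp a j \<noteq> 0. real_of_int (lexp a j) *\<^sub>R mon (a + dlm j))"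
      using a by (simp add: dK_def wd_def distrib_left sum_distrib_left mon_add)
    then show "cf (dK a) c = deriv_lmonom a c"
      using a by (simp add: deriv_lmonom_def cf_sum e[symmetric] dlm_def[symmetric] cf_mon_fd)
  qed
qed

lemma td_mult: "td (x * y) = td x * y + x * td y"
proof (rule slin_leibniz[OF slin_td])
  fix a b assume ab: "fd a" "fd b"
  have "td (mon (a + b)) = mon a * mon b * (wd a + wd b)"
    using td_mon[OF fd_add[OF ab]] by (simp only: mon_add[OF ab] wd_add[OF ab])
  then show "td (mon (a + b)) = td (mon a) * mon b + mon a * td (mon b)"
    by (simp add: td_mon ab algebra_simps)
qed

lemma td_add: "td (x + y) = td x + td y" and td_scaleR: "td (r *\<^sub>R x) = r *\<^sub>R td x"
  and td_0 [simp]: "td 0 = 0" and td_diff: "td (x - y) = td x - td y" and td_minus: "td (- x) = - td x"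
  using slin_add slin_scaleR slin_0 slin_diff slin_uminus slin_td by auto

lemma td_1 [simp]: "td 1 = 0"
  using td_mult[of 1 1] by simp

lemma td_of_real [simp]: "td (of_real r) = 0"
  by (simp add: of_real_def td_scaleR)

lemma td_power: "td (x ^ n) = of_nat n * x ^ (n - 1) * td x"
proof (induction n)
  case (Suc n)
  then show ?case by (cases n) (auto simp: td_mult algebra_simps)
qed simp

section \<open>Logarithmic derivatives\<close>

definition dlog :: "ts \<Rightarrow> ts" where "dlog x = td x / x"

lemma dlog_mult: "x \<noteq> 0 \<Longrightarrow> y \<noteq> 0 \<Longrightarrow> dlog (x * y) = dlog x + dlog y"
  by (simp add: dlog_def td_mult field_simps)

lemma dlog_1 [simp]: "dlog 1 = 0"
  by (simp add: dlog_def)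

lemma dlog_inverse: "x \<noteq> 0 \<Longrightarrow> dlog (inverse x) = - dlog x"
  using dlog_mult[of x "inverse x"] by (simp add: eq_neg_iff_add_eq_0 add.commute)

lemma dlog_power: "x \<noteq> 0 \<Longrightarrow> dlog (x ^ n) = of_nat n * dlog x"
  by (induction n) (auto simp: dlog_mult algebra_simps)

lemma dlog_powi: "x \<noteq> 0 \<Longrightarrow> dlog (x powi n) = of_int n * dlog x"
  by (cases "0 \<le> n") (auto simp: power_int_def dlog_power dlog_inverse)

lemma dlog_prod: "finite A \<Longrightarrow> (\<And>i. i \<in> A \<Longrightarrow> f i \<noteq> 0) \<Longrightarrow> dlog (prod f A) = (\<Sum>i\<in>A. dlog (f i))"
  by (induction A rule: finite_induct) (auto simp: dlog_mult)

lemma dlog_scaleR: "r \<noteq> 0 \<Longrightarrow> dlog (r *\<^sub>R x) = dlog x"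
  by (simp add: dlog_def td_scaleR) (simp add: scaleR_conv_of_real)

lemma mon_nonzero [simp]: "fd a \<Longrightarrow> mon a \<noteq> 0"
  using sp_mon[of a] by (metis insert_not_empty sp_0)

lemma dlog_mon: "fd a \<Longrightarrow> dlog (mon a) = wd a"
  by (simp add: dlog_def td_mon)

lemma td_fev: assumes "small x" shows "td (fev F x) = fev (fps_deriv F) x * td x"
proof -
  let ?G = "\<lambda>n. (F $ n) *\<^sub>R x ^ n"
  note s = small_hsummable[OF assms]
  let ?H = "\<lambda>n. (real n * F $ n) *\<^sub>R (x ^ (n - 1) * td x)"
  have H: "td ((F $ n) *\<^sub>R x ^ n) = ?H n" for n
    by (simp only: td_scaleR td_power) (simp add: scaleR_conv_of_real mult_ac)
  have sH: "hsummable ?H UNIV" using slin_hsum(1)[OF slin_td s, of "\<lambda>n. F $ n" UNIV] H by simp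
  have "td (fev F x) = hsum ?H UNIV"
    unfolding fev_def using slin_hsum(2)[OF slin_td s, of "\<lambda>n. F $ n" UNIV] H by simp
  also have "\<dots> = hsum ?H (range Suc)"
  proof (rule hsum_neutral[OF hsummable_subset[OF sH]])
    show "?H n = 0" if "n \<notin> range Suc" for n using that by (cases n) auto
  qed auto
  also have "\<dots> = hsum (\<lambda>n. ?H (Suc n)) UNIV"
    by (rule hsum_reindex[symmetric]) (auto simp: bij_betw_def)
  also have "\<dots> = hsum (\<lambda>n. td x * ((fps_deriv F $ n) *\<^sub>R x ^ n)) UNIV"
    by (rule hsum_cong) (simp add: mult_ac)
  also have "\<dots> = td x * fev (fps_deriv F) x"
    unfolding fev_def by (rule hsum_times_left(2)[OF s])
  finally show ?thesis by (simp add: mult.commute)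
qed

lemma one_plus_small_nonzero: "small x \<Longrightarrow> 1 + x \<noteq> 0"
  using fev_gps[of x] by auto

lemma td_tLn: assumes "small x" shows "td (tLn x) = td x / (1 + x)"
proof -
  have "(1 + fps_X) * inverse (1 + fps_X) = (1 :: real fps)" by (rule inverse_mult_eq_1') simp
  then have "fev ((1 + fps_X) * inverse (1 + fps_X)) x = 1" by (simp add: fev_1)
  then have "(1 + x) * fev (inverse (1 + fps_X)) x = 1"
    using assms by (simp add: fev_mult fev_add fev_1 fev_X)
  then have "fev (inverse (1 + fps_X)) x = inverse (1 + x)" by (metis inverse_unique)
  then show ?thesis using td_fev[OF assms, of "fps_ln 1"]
    by (simp add: tLn_def fps_ln_deriv divide_inverse mult.commute)
qed

text \<open>Rests on \<open>- lunit (Suc j) + dlm (Suc j) = dlm j\<close>: differentiating the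
  reciprocal of a logarithm removes that logarithm altogether.\<close>

lemma td_lmlog: assumes "fd a" shows "td (lmlog a) = wd a"
proof -
  have 1: "td (mon (- lunit 0)) = - mon (zm (-1))"
  proof -
    have "wd (- lunit 0) = - mon (dlm 0)" using wd_eq[of 1 "- lunit 0"] dep_lunit[of 0 1] by simp
    moreover have "- lunit 0 + dlm 0 = zm (-1)" by (rule lmon_eqI) auto
    ultimately show ?thesis by (simp add: td_mon flip: mon_add)
  qed
  have 2: "td (mon (- lunit (Suc j))) = - mon (dlm j)" for j
  proof -
    have "wd (- lunit (Suc j)) = (\<Sum>i<Suc (Suc j). real_of_int (lexp (- lunit (Suc j)) i) *\<^sub>R mon (dlm i))"
      using wd_eq[of "Suc (Suc j)" "- lunit (Suc j)"] dep_lunit[of "Suc j" "Suc (Suc j)"] by simp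
    also have "\<dots> = (\<Sum>i\<in>{Suc j}. real_of_int (lexp (- lunit (Suc j)) i) *\<^sub>R mon (dlm i))"
      by (rule sum.mono_neutral_right) auto
    also have "\<dots> = - mon (dlm (Suc j))" by simp
    finally have "wd (- lunit (Suc j)) = - mon (dlm (Suc j))" .
    moreover have "- lunit (Suc j) + dlm (Suc j) = dlm j" by (rule lmon_eqI) auto
    ultimately show ?thesis by (simp add: td_mon flip: mon_add)
  qed
  show ?thesis unfolding lmlog_def wd_def
    by (simp add: td_diff td_minus td_scaleR 1 2 slin_sum[OF slin_td] sum_negf)
qed

lemma td_tlog: assumes "x \<noteq> 0" shows "td (tlog x) = dlog x"
proof -
  have "dlog x = dlog (lc x *\<^sub>R (mon (ld x) * (1 + eps x)))" using ts_decomp[OF assms] by simp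
  also have "\<dots> = wd (ld x) + dlog (1 + eps x)"
    using assms fd_ld[OF assms] one_plus_small_nonzero[OF small_eps[OF assms]]
    by (simp add: dlog_scaleR dlog_mult dlog_mon)
  also have "dlog (1 + eps x) = td (tLn (eps x))"
    using small_eps[OF assms] by (simp add: dlog_def td_add td_tLn)
  finally show ?thesis by (simp add: tlog_def td_add td_lmlog fd_ld[OF assms])
qed

text \<open>The kernel of the derivation contains no infinitesimals: the leading monomial of \<open>td x\<close> is
  read off the leading monomial \<open>m\<close> of \<open>x\<close>, via \<open>z\<close> if \<open>zexp m \<noteq> 0\<close> and via the first logarithm
  occurring in \<open>m\<close> otherwise.\<close>

lemma cf_td_mon: assumes "dep k a"
  shows "cf (td (mon a)) c = (if c = a + zm (-1) then zexp a else 0) + (\<Sum>j<k. if c = a + dlm j then real_of_int (lexp a j) else 0)"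
proof -
  have a: "fd a" using assms by (auto simp: fd_def)
  have "td (mon a) = zexp a *\<^sub>R mon (a + zm (-1)) + (\<Sum>j<k. real_of_int (lexp a j) *\<^sub>R mon (a + dlm j))"
    using a by (simp add: td_mon wd_eq[OF assms] distrib_left sum_distrib_left mon_add)
  then show ?thesis using a by (simp add: cf_sum cf_mon if_distrib cong: if_cong)
qed

lemma td_eq_0: assumes "td x = 0" "small x" shows "x = 0"
proof (rule ccontr)
  assume x: "x \<noteq> 0"
  define m where "m = ld x"
  have m: "m \<in> sp x" "\<And>a. a \<in> sp x \<Longrightarrow> m \<le> a" using ld_in[OF x] ld_le[OF x] by (auto simp: m_def)
  obtain k where k: "\<And>a. a \<in> sp x \<Longrightarrow> dep k a" using adm_dep[OF adm_sp] by blast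
  have pos: "0 < m" using assms(2) m by (auto simp: small_def)
  have zm: "0 \<le> zexp m" using pos zexp_nonneg[of m] by simp
  have nlt: "a < m \<Longrightarrow> a \<notin> sp x" for a using m(2)[of a] by auto
  show False
  proof (cases "zexp m = 0")
    case False
    let ?c = "m + zm (-1)"
    \<comment> \<open>No other monomial of \<open>x\<close> contributes at \<open>?c\<close>: an
      equality with \<open>a + dlm j\<close> would give \<open>a\<close> the same power of z and a
      smaller power of l_1, hence \<open>a < m\<close>.\<close>
    have "cf (td (mon a)) ?c = 0" if a: "a \<in> sp x" "a \<noteq> m" for a
    proof -
      have "?c \<noteq> a + dlm j" for j
      proof
        assume h: "?c = a + dlm j"
        have "zexp m = zexp a" using arg_cong[OF h, of zexp] by simp
        moreover have "lexp m i = lexp a i + (if i \<le> j then 1 else 0)" for i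
          using arg_cong[OF h, of "\<lambda>a. lexp a i"] by simp
        ultimately have "a < m" by (auto simp: less_lmon_def intro!: exI[of _ 0])
        then show False using nlt a by blast
      qed
      then show ?thesis using a by (simp add: cf_td_mon[OF k[OF a(1)]])
    qed
    then have "cf (td x) ?c = cf x m * cf (td (mon m)) ?c" by (rule cf_slin_single[OF slin_td])
    moreover have "cf (td (mon m)) ?c = zexp m"
    proof -
      have "zm (-1) \<noteq> dlm j" for j by (metis dlm_simps(2) le0 zero_neq_one zm_simps(2))
      then show ?thesis by (simp add: cf_td_mon[OF k[OF m(1)]])
    qed
    ultimately show False using assms(1) m(1) False by (simp add: sp_def)
  next
    case True
    then obtain j where j: "0 < lexp m j" "\<And>i. i < j \<Longrightarrow> lexp m i = 0"
      using pos by (auto simp: less_lmon_def)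
    have jk: "j < k" using j k[OF m(1)] by (cases "j < k") (auto simp: dep_def)
    let ?c = "m + dlm j"
    \<comment> \<open>If \<open>i < j\<close>, the exponent of \<open>a\<close> at \<open>i\<close>
      would be that of \<open>m\<close>, namely 0, and the term vanishes; if \<open>i > j\<close>,
      the first discrepancy is at \<open>Suc j\<close> and makes \<open>a < m\<close>. Only
      \<open>i = j\<close> with \<open>a = m\<close> remains.\<close>
    have trm: "(if ?c = a + dlm i then real_of_int (lexp a i) else 0) = (if a = m \<and> i = j then real_of_int (lexp m j) else 0)"
      if a: "a \<in> sp x" for a i
    proof (cases "?c = a + dlm i \<and> lexp a i \<noteq> 0")
      case t: True
      then have h: "?c = a + dlm i" by blast
      have z: "zexp a = zexp m" using arg_cong[OF h, of zexp] by simp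
      have l: "lexp m l + (if l \<le> j then 1 else 0) = lexp a l + (if l \<le> i then 1 else 0)" for l
        using arg_cong[OF h, of "\<lambda>a. lexp a l"] by simp
      consider "i < j" | "i = j" | "j < i" by linarith
      then show ?thesis
      proof cases
        case 1 then show ?thesis using l[of i] j(2)[of i] t by simp
      next
        case 2 then show ?thesis using t by auto
      next
        case 3
        have "lexp a (Suc j) < lexp m (Suc j)" using l[of "Suc j"] 3 by simp
        moreover have "\<forall>l<Suc j. lexp a l = lexp m l"
        proof (intro allI impI)
          fix l' assume "l' < Suc j" then show "lexp a l' = lexp m l'" using l[of l'] 3 by simp
        qed
        ultimately have "a < m" unfolding less_lmon_def using z by blast
        then show ?thesis using nlt a by blast
      qed
    qed (use j in auto)
    have c: "cf (td (mon a)) ?c = (if a = m then real_of_int (lexp m j) else 0)" if a: "a \<in> sp x" for a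
    proof -
      have "(if ?c = a + zm (-1) then zexp a else 0) = 0"
      proof -
        have "zexp a = 0" if "?c = a + zm (-1)"
          using arg_cong[OF that, of zexp] True by simp
        then show ?thesis by simp
      qed
      moreover have "(\<Sum>i<k. if ?c = a + dlm i then real_of_int (lexp a i) else 0) = (if a = m then real_of_int (lexp m j) else 0)"
        using jk by (subst trm[OF a]) (auto simp: sum.delta)
      ultimately show ?thesis by (simp add: cf_td_mon[OF k[OF a]])
    qed
    have "cf (td x) ?c = cf x m * cf (td (mon m)) ?c" by (rule cf_slin_single[OF slin_td]) (simp add: c)
    then show False using assms(1) m(1) j c[OF m(1)] by (simp add: sp_def)
  qed
qed

section \<open>Substitution of a power of z\<close>

lemma mgen_Emon: "Z \<subseteq> Emon k \<Longrightarrow> mgen Z \<subseteq> Emon k"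
proof
  fix c assume "Z \<subseteq> Emon k" "c \<in> mgen Z"
  then show "c \<in> Emon k" by (induction rule: mgen_induct[OF \<open>c \<in> mgen Z\<close>]) (auto intro: Emon_add)
qed

lemma cf_times_0:
  assumes "\<And>a. a \<in> sp x \<Longrightarrow> 0 \<le> a" "\<And>a. a \<in> sp y \<Longrightarrow> 0 \<le> a"
  shows "cf (x * y) 0 = cf x 0 * cf y 0"
proof -
  have "a \<in> {0}" if "cf x a \<noteq> 0" "cf y (0 - a) \<noteq> 0" for a
    using that assms(1)[of a] assms(2)[of "- a"] by (auto simp: sp_def)
  then show ?thesis by (subst cf_times_eq[of "{0}"]) auto
qed

lemma fdI: "dep k a \<Longrightarrow> fd a"
  by (auto simp: fd_def)

lemma dep_single: "dep (Suc k) (LMon b (\<lambda>i. if i = k then n else 0))"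
  by (auto simp: dep_def)

lemma dep_cut: "dep k (LMon b (\<lambda>i. if i < k then f i else 0))"
  by (auto simp: dep_def)

text \<open>The unit factors produced when z^p is substituted into logarithms: purely logarithmic
  series with constant term 1. They are closed under products and reciprocals, so they survive
  integer powers.\<close>

definition log_units :: "nat \<Rightarrow> ts set" where "log_units k = {x. sp x \<subseteq> Emon k \<and> cf x 0 = 1}"

lemma log_units_1 [simp]: "1 \<in> log_units k"
  by (auto simp: log_units_def cf_one)

lemma log_units_mono: "k \<le> l \<Longrightarrow> x \<in> log_units k \<Longrightarrow> x \<in> log_units l"
  using Emon_mono by (auto simp: log_units_def)

lemma log_units_decomp: assumes "x \<in> log_units k" shows "small (x - 1)" "sp (x - 1) \<subseteq> Emon k"
proof -
  have a: "a \<in> Emon k \<and> a \<noteq> 0" if "a \<in> sp (x - 1)" for a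
    using that assms by (auto simp: log_units_def sp_def cf_one split: if_splits)
  then show "sp (x - 1) \<subseteq> Emon k" by blast
  show "small (x - 1)" using a Emon_nonneg by (fastforce simp: small_def)
qed

lemma log_units_I: assumes "small e" "sp e \<subseteq> Emon k" shows "1 + e \<in> log_units k"
  using assms small_cf[of e 0] sp_add[of 1 e] by (auto simp: log_units_def cf_one)

lemma log_units_nonzero: "x \<in> log_units k \<Longrightarrow> x \<noteq> 0"
  by (auto simp: log_units_def)

lemma log_units_times: assumes "x \<in> log_units k" "y \<in> log_units k" shows "x * y \<in> log_units k"
proof -
  have "sp (x * y) \<subseteq> sp x + sp y" by (rule sp_times)
  also have "\<dots> \<subseteq> Emon k + Emon k" using assms by (intro set_plus_mono2) (auto simp: log_units_def)
  finally have "sp (x * y) \<subseteq> Emon k" by (simp add: Emon_plus)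
  moreover have "cf (x * y) 0 = cf x 0 * cf y 0"
    by (rule cf_times_0) (use assms in \<open>auto simp: log_units_def intro: Emon_nonneg\<close>)
  ultimately show ?thesis using assms by (simp add: log_units_def)
qed

lemma inverse_1_plus: "small e \<Longrightarrow> inverse (1 + e) = fev gps e"
  using fev_gps by (intro inverse_unique)

lemma log_units_inverse: assumes "x \<in> log_units k" shows "inverse x \<in> log_units k"
proof -
  note d = log_units_decomp[OF assms]
  have i: "inverse x = fev gps (x - 1)" using inverse_1_plus[OF d(1)] by simp
  have sub: "sp (inverse x) \<subseteq> Emon k"
    using sp_fev[OF d(1), of gps] mgen_Emon[OF d(2)] unfolding i by blast
  have "x * inverse x = 1" using log_units_nonzero[OF assms] by simp
  moreover have "cf (x * inverse x) 0 = cf x 0 * cf (inverse x) 0"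
    by (rule cf_times_0) (use assms sub in \<open>auto simp: log_units_def intro: Emon_nonneg\<close>)
  ultimately have "cf x 0 * cf (inverse x) 0 = cf 1 0" by simp
  then show ?thesis using sub assms by (simp add: log_units_def cf_one)
qed

lemma log_units_power: "x \<in> log_units k \<Longrightarrow> x ^ n \<in> log_units k"
  by (induction n) (auto intro: log_units_times)

lemma log_units_powi: "x \<in> log_units k \<Longrightarrow> x powi n \<in> log_units k"
  by (auto simp: power_int_def intro: log_units_power log_units_inverse)

lemma inverse_mon: "fd a \<Longrightarrow> inverse (mon a) = mon (- a)"
  using mon_add[of a "- a"] by (intro inverse_unique) simp

primrec ellS :: "real \<Rightarrow> nat \<Rightarrow> ts" where
  "ellS p 0 = - inverse (tlog (mon (zm p)))"
| "ellS p (Suc j) = - inverse (tlog (ellS p j))"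

text \<open>The leading coefficient of \<open>ellS p j\<close>. Since log(z^p) = p log z, the first
  logarithm acquires 1 / p; one level deeper this factor is only an additive constant, so the
  leading coefficient is 1.\<close>

definition rS :: "real \<Rightarrow> nat \<Rightarrow> real" where "rS p j = (if j = 0 then 1 / p else 1)"

lemma tlog_mon: assumes "fd a" shows "tlog (mon a) = lmlog a"
proof -
  have "mon a = 1 *\<^sub>R (mon a * (1 + 0))" by simp
  note l = ts_lead_unique[OF this _ assms small_0]
  have "tLn 0 = 0" unfolding tLn_def fev_def
    by (subst hsum_neutral[of _ "{0}"]) (auto simp: hsummable_finite hsum_finite zero_power)
  then show ?thesis using l by (simp add: tlog_def)
qed

lemma lmlog_zm: "lmlog (zm p) = - (p *\<^sub>R mon (- lunit 0))"
  by (simp add: lmlog_def)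

lemma lmlog_lunit: "lmlog (lunit j) = - mon (- lunit (Suc j))"
proof -
  have "{i. lexp (lunit j) i \<noteq> 0} = {j}" by auto
  then show ?thesis by (simp add: lmlog_def)
qed

lemma tlog_ell:
  assumes x: "x = r *\<^sub>R (mon (lunit j) * (1 + e))" and r: "0 < r" and e: "small e"
  shows "tlog x = - mon (- lunit (Suc j)) + of_real (ln r) + tLn e"
  using ts_lead_unique[OF x _ _ e] r by (simp add: tlog_def lmlog_lunit)

text \<open>Here log x = - l^(-1) (1 - l (log r + log u)), with l the monomial of
  \<open>lunit (Suc j)\<close>. The bracket is a logarithmic unit of one depth more, and so is its
  reciprocal.\<close>

lemma ell_step:
  assumes x: "x = r *\<^sub>R (mon (lunit j) * u)" and r: "0 < r" and u: "u \<in> log_units (Suc j)"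
  shows "tlog x \<noteq> 0" "\<exists>v\<in>log_units (Suc (Suc j)). - inverse (tlog x) = mon (lunit (Suc j)) * v"
proof -
  let ?k = "Suc (Suc j)"
  define e where "e = u - 1"
  have e: "small e" "sp e \<subseteq> Emon (Suc j)" using log_units_decomp[OF u] by (auto simp: e_def)
  define d where "d = mon (lunit (Suc j)) * (of_real (ln r) + tLn e)"
  have 1: "sp (of_real (ln r) + tLn e) \<subseteq> Emon ?k"
  proof -
    have "sp (tLn e) \<subseteq> Emon ?k"
      using sp_tLn[OF e(1)] mgen_Emon[OF e(2)] Emon_mono[of "Suc j" ?k] by auto
    moreover have "sp (of_real (ln r)) \<subseteq> Emon ?k" by (auto simp: sp_def cf_of_real split: if_splits)
    ultimately show ?thesis using sp_add by blast
  qed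
  have "sp d \<subseteq> {lunit (Suc j)} + Emon ?k"
    using sp_times[of "mon (lunit (Suc j))" "of_real (ln r) + tLn e"] 1
    unfolding d_def by (simp add: sp_mon) (erule order_trans, intro set_plus_mono2 order_refl)
  then have d1: "a \<in> Emon ?k \<and> 0 < a" if a: "a \<in> sp d" for a
  proof -
    obtain b where b: "b \<in> Emon ?k" "a = lunit (Suc j) + b"
      using \<open>sp d \<subseteq> _\<close> a by (auto simp: set_plus_def)
    then show ?thesis using Emon_add[OF lunit_Emon[of "Suc j" ?k] b(1)] Emon_nonneg[OF b(1)]
      by (auto intro: add_pos_nonneg)
  qed
  then have log_units: "1 + (- d) \<in> log_units ?k" by (intro log_units_I) (auto simp: small_def)
  have x': "x = r *\<^sub>R (mon (lunit j) * (1 + e))" using x by (simp add: e_def)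
  have m: "mon (- lunit (Suc j)) * mon (lunit (Suc j)) = 1" by (simp flip: mon_add)
  have "mon (- lunit (Suc j)) * d = of_real (ln r) + tLn e"
    by (simp add: d_def m flip: mult.assoc)
  then have t: "tlog x = - (mon (- lunit (Suc j)) * (1 + (- d)))"
    by (simp add: tlog_ell[OF x' r e(1)] right_diff_distrib)
  show "tlog x \<noteq> 0" using log_units_nonzero[OF log_units] by (simp add: t)
  have "- inverse (tlog x) = mon (lunit (Suc j)) * inverse (1 + (- d))"
    unfolding t by (simp add: inverse_mon)
  then show "\<exists>v\<in>log_units ?k. - inverse (tlog x) = mon (lunit (Suc j)) * v" using log_units_inverse[OF log_units] by blast
qed

lemma rS_pos: "0 < p \<Longrightarrow> 0 < rS p j"
  by (simp add: rS_def)

lemma ellS_0: assumes "0 < p" shows "ellS p 0 = (1 / p) *\<^sub>R mon (lunit 0)" "tlog (mon (zm p)) \<noteq> 0"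
  using assms by (simp_all add: tlog_mon lmlog_zm inverse_mon inverse_scaleR_distrib divide_inverse)

lemma ellS_form: assumes "0 < p" shows "\<exists>u\<in>log_units (Suc j). ellS p j = rS p j *\<^sub>R (mon (lunit j) * u)"
proof (induction j)
  case 0
  show ?case using ellS_0[OF assms] by (intro bexI[of _ 1]) (auto simp: rS_def)
next
  case (Suc j)
  then obtain u where u: "u \<in> log_units (Suc j)" "ellS p j = rS p j *\<^sub>R (mon (lunit j) * u)" by blast
  from ell_step(2)[OF u(2) rS_pos[OF assms] u(1)] show ?case by (auto simp: rS_def)
qed

lemma ellS_nonzero [simp]: assumes "0 < p" shows "ellS p j \<noteq> 0"
proof -
  obtain u where "u \<in> log_units (Suc j)" "ellS p j = rS p j *\<^sub>R (mon (lunit j) * u)" using ellS_form[OF assms] by blast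
  then show ?thesis using rS_pos[OF assms, of j] log_units_nonzero by auto
qed

lemma tlog_ellS_nonzero: assumes "0 < p" shows "tlog (ellS p j) \<noteq> 0"
proof -
  obtain u where "u \<in> log_units (Suc j)" "ellS p j = rS p j *\<^sub>R (mon (lunit j) * u)" using ellS_form[OF assms] by blast
  then show ?thesis using ell_step(1) rS_pos[OF assms] by blast
qed

text \<open>Reciprocal and logarithm are matched with the given operations away from 0, which is why
  nonvanishing of \<open>ellS\<close> and of its logarithm is tracked.\<close>

lemma cf_step: assumes "x \<noteq> 0" "tlog x \<noteq> 0"
  shows "- recip_lts (log_lts (cf x)) = cf (- inverse (tlog x))"
  unfolding cf_tlog[OF assms(1), symmetric] cf_inverse[OF assms(2), symmetric] by (rule ext) simp

lemma cf_ellS: assumes "0 < p" shows "ell_sub (scale_lts 1 (zpow p)) j = cf (ellS p j)"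
proof (induction j)
  case 0
  have z: "scale_lts 1 (zpow p) = cf (mon (zm p))"
    by (auto simp: scale_lts_def zpow_def cf_mon_fd zm_def[symmetric])
  show ?case unfolding ell_sub.simps ellS.simps z by (rule cf_step) (use ellS_0(2)[OF assms] in auto)
next
  case (Suc j)
  show ?case unfolding ell_sub.simps(2) ellS.simps(2) Suc
    by (rule cf_step) (use tlog_ellS_nonzero[OF assms] assms in auto)
qed

definition psubst_kernel :: "real \<Rightarrow> lmon \<Rightarrow> ts" where
  "psubst_kernel p m = mon (zm (p * zexp m)) * (\<Prod>j<depth m. ellS p j powi lexp m j)"

lemma dep_depth: assumes "dep k m" shows "dep (depth m) m" "depth m \<le> k"
  using assms unfolding dep_def depth_def by (rule LeastI, rule Least_le)

text \<open>Any depth bound may replace the exact depth, so that several monomials can be treated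
  with one range of the product.\<close>

lemma psubst_kernel_eq: assumes "dep k m" shows "psubst_kernel p m = mon (zm (p * zexp m)) * (\<Prod>j<k. ellS p j powi lexp m j)"
proof -
  have "(\<Prod>j<depth m. ellS p j powi lexp m j) = (\<Prod>j<k. ellS p j powi lexp m j)"
    using dep_depth[OF assms] by (intro prod.mono_neutral_left) (auto simp: dep_def)
  then show ?thesis by (simp add: psubst_kernel_def)
qed

lemma psubst_kernel_add: assumes "0 < p" "fd a" "fd b" shows "psubst_kernel p (a + b) = psubst_kernel p a * psubst_kernel p b"
proof -
  obtain k where k: "dep k a" "dep k b" using fd_common[OF assms(2,3)] .
  show ?thesis using assms
    by (simp add: psubst_kernel_eq[OF k(1)] psubst_kernel_eq[OF k(2)] psubst_kernel_eq[OF dep_simps(2)[OF k]] power_int_add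
        distrib_left zm_add mon_add prod.distrib mult_ac)
qed

lemma foldr_mult: "foldr (\<lambda>j. mult_lts (cf (g j))) [0..<n] (cf x) = cf ((\<Prod>j<n. g j) * x)"
proof (induction n arbitrary: x)
  case (Suc n)
  have "mult_lts (cf (g n)) (cf x) = cf (g n * x)" by (auto simp: cf_times_mult_lts)
  then show ?case using Suc[of "g n * x"] by (simp add: mult_ac)
qed simp

lemma cf_psubst_kernel: assumes "0 < p" "fd m" shows "cf (psubst_kernel p m) = subst_lmonom 1 p m"
proof -
  have z: "scale_lts (1 powr zexp m) (zpow (p * zexp m)) = cf (mon (zm (p * zexp m)))"
    by (auto simp: scale_lts_def zpow_def cf_mon_fd zm_def[symmetric])
  have e: "powi_lts (ell_sub (scale_lts 1 (zpow p)) j) n = cf (ellS p j powi n)" for j n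
    using assms by (simp add: cf_ellS cf_powi)
  show ?thesis unfolding subst_lmonom_def z e foldr_mult psubst_kernel_def by (simp add: mult.commute)
qed

lemma mon_powi: "mon (lunit k) powi n = mon (LMon 0 (\<lambda>i. if i = k then n else 0))"
proof -
  have nat: "mon (lunit k) ^ n = mon (LMon 0 (\<lambda>i. if i = k then int n else 0))" for n
  proof (induction n)
    case 0
    have "LMon 0 (\<lambda>i. if i = k then int 0 else 0) = 0" by (rule lmon_eqI) auto
    then show ?case by simp
  next
    case (Suc n)
    let ?m = "\<lambda>n. LMon 0 (\<lambda>i. if i = k then int n else 0)"
    have fd: "fd (?m n)" by (rule fdI[OF dep_single])
    have "?m (Suc n) = lunit k + ?m n" by (rule lmon_eqI) auto
    then show ?case using Suc fd by (simp add: mon_add)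
  qed
  show ?thesis
  proof (cases "0 \<le> n")
    case True
    then have "int (nat n) = n" by simp
    then show ?thesis using True nat[of "nat n"] by (simp only: power_int_def if_True)
  next
    case False
    have fd: "fd (LMon 0 (\<lambda>i. if i = k then int (nat (- n)) else 0))"
      by (rule fdI[OF dep_single])
    have "- LMon 0 (\<lambda>i. if i = k then int (nat (- n)) else 0) = LMon 0 (\<lambda>i. if i = k then n else 0)"
      using False by (intro lmon_eqI) auto
    then show ?thesis using False inverse_mon[OF fd] by (simp add: power_int_def power_inverse nat)
  qed
qed

lemma scaleR_powi: "(r *\<^sub>R x) powi n = (r powi n) *\<^sub>R (x powi n)" for x :: ts
  by (simp add: scaleR_conv_of_real power_int_mult_distrib)

text \<open>The scalar comes from l_1 alone, because \<open>rS p j = 1\<close> for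
  \<open>j > 0\<close>. It becomes the diagonal entry of the substitution.\<close>

lemma prod_ellS:
  assumes "0 < p"
  shows "\<exists>u\<in>log_units k. (\<Prod>j<k. ellS p j powi lexp m j) =
    (if k = 0 then 1 else p powi (- lexp m 0)) *\<^sub>R (mon (LMon 0 (\<lambda>i. if i < k then lexp m i else 0)) * u)"
proof (induction k)
  case 0
  have "LMon 0 (\<lambda>i. 0) = 0" by (rule lmon_eqI) auto
  then show ?case by (intro bexI[of _ 1]) auto
next
  case (Suc k)
  let ?m = "\<lambda>k. LMon 0 (\<lambda>i. if i < k then lexp m i else 0)"
  let ?c = "\<lambda>k::nat. if k = 0 then 1 else p powi (- lexp m 0)"
  obtain u where u: "u \<in> log_units k" "(\<Prod>j<k. ellS p j powi lexp m j) = ?c k *\<^sub>R (mon (?m k) * u)"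
    using Suc by blast
  obtain v where v: "v \<in> log_units (Suc k)" "ellS p k = rS p k *\<^sub>R (mon (lunit k) * v)"
    using ellS_form[OF assms] by blast
  let ?l = "LMon 0 (\<lambda>i. if i = k then lexp m k else 0)"
  have e: "ellS p k powi lexp m k = (rS p k powi lexp m k) *\<^sub>R (mon ?l * v powi lexp m k)"
    unfolding v(2) scaleR_powi power_int_mult_distrib mon_powi ..
  have fd: "fd (?m k)" "fd ?l"
    by (rule fdI[OF dep_cut], rule fdI[OF dep_single])
  have "?m (Suc k) = ?m k + ?l" by (rule lmon_eqI) auto
  then have m: "mon (?m (Suc k)) = mon (?m k) * mon ?l" using fd by (simp add: mon_add)
  have c: "?c (Suc k) = ?c k * (rS p k powi lexp m k)"
    using assms by (simp add: rS_def power_int_minus power_int_inverse divide_inverse)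
  have "(\<Prod>j<Suc k. ellS p j powi lexp m j) = ?c (Suc k) *\<^sub>R (mon (?m (Suc k)) * (u * v powi lexp m k))"
    unfolding prod.lessThan_Suc u(2) e m c by (simp add: mult_ac)
  moreover have "u * v powi lexp m k \<in> log_units (Suc k)"
    using log_units_mono[OF _ u(1), of "Suc k"] v(1) by (intro log_units_times log_units_powi) auto
  ultimately show ?case by blast
qed

lemma psubst_kernel_form:
  assumes "0 < p" "dep k m"
  shows "\<exists>u\<in>log_units k. psubst_kernel p m = (p powi (- lexp m 0)) *\<^sub>R (mon (sig p m) * u)"
proof -
  obtain u where u: "u \<in> log_units k" "(\<Prod>j<k. ellS p j powi lexp m j) =
    (if k = 0 then 1 else p powi (- lexp m 0)) *\<^sub>R (mon (LMon 0 (\<lambda>i. if i < k then lexp m i else 0)) * u)"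
    using prod_ellS[OF assms(1)] by blast
  have c: "(if k = 0 then 1 else p powi (- lexp m 0)) = p powi (- lexp m 0)"
    using assms(2) by (auto simp: dep_def)
  let ?l = "LMon 0 (\<lambda>i. if i < k then lexp m i else 0)"
  have fd: "fd ?l" by (rule fdI[OF dep_cut])
  have "sig p m = zm (p * zexp m) + ?l" using assms(2) by (intro lmon_eqI) (auto simp: dep_def)
  then have "mon (sig p m) = mon (zm (p * zexp m)) * mon ?l" using fd by (simp add: mon_add)
  then have "psubst_kernel p m = (p powi (- lexp m 0)) *\<^sub>R (mon (sig p m) * u)"
    unfolding psubst_kernel_eq[OF assms(2)] u(2) c by (simp add: mult_ac)
  then show ?thesis using u(1) by blast
qed

lemma psubst_kernel_nonzero: assumes "0 < p" "fd m" shows "psubst_kernel p m \<noteq> 0"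
  using assms by (simp add: psubst_kernel_def)

lemma sp_psubst_kernel: assumes "0 < p" "dep k m" shows "sp (psubst_kernel p m) \<subseteq> {sig p m} + Emon k"
proof -
  obtain u where u: "u \<in> log_units k" "psubst_kernel p m = (p powi (- lexp m 0)) *\<^sub>R (mon (sig p m) * u)"
    using psubst_kernel_form[OF assms] by blast
  have "fd m" using assms by (auto simp: fd_def)
  then have "sp (mon (sig p m) * u) \<subseteq> {sig p m} + sp u"
    using sp_times[of "mon (sig p m)" u] by (simp add: sp_mon)
  also have "\<dots> \<subseteq> {sig p m} + Emon k" using u(1) by (intro set_plus_mono2) (auto simp: log_units_def)
  finally show ?thesis unfolding u(2) by (rule order_trans[OF sp_scaleR])
qed

lemma cf_psubst_kernel_lead: assumes "0 < p" "fd m" shows "cf (psubst_kernel p m) (sig p m) = p powi (- lexp m 0)"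
proof -
  obtain k where "dep k m" using assms(2) by (auto simp: fd_def)
  from psubst_kernel_form[OF assms(1) this] show ?thesis using assms(2) by (auto simp: cf_mon_times log_units_def)
qed

lemma hsummable_psubst_kernel: assumes "0 < p" "adm W" shows "hsummable (psubst_kernel p) W"
proof -
  obtain k where k: "\<And>m. m \<in> W \<Longrightarrow> dep k m" using adm_dep[OF assms(2)] by blast
  show ?thesis by (rule hsummable_kernel[OF assms(2,1) adm_Emon[of k]]) (rule sp_psubst_kernel[OF assms(1) k])
qed

text \<open>\<open>psubst p x\<close> is the paper's \<open>x(z\<^sup>p)\<close>, and \<open>tcomp p e x\<close> below is \<open>x \<circ> f\<close> for \<open>f = z\<^sup>p (1 + e)\<close>.\<close>

definition psubst :: "real \<Rightarrow> ts \<Rightarrow> ts" where "psubst p = extend (psubst_kernel p)"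

lemma slin_psubst: "0 < p \<Longrightarrow> slin (psubst p)"
  unfolding psubst_def using slin_extend[of "psubst_kernel p"] hsummable_psubst_kernel by blast

lemma psubst_mon: "0 < p \<Longrightarrow> fd m \<Longrightarrow> psubst p (mon m) = psubst_kernel p m"
  unfolding psubst_def using extend_mon[of "psubst_kernel p"] hsummable_psubst_kernel by blast

lemma cf_psubst: "0 < p \<Longrightarrow> cf (psubst p x) = subst_lts 1 p (cf x)"
  unfolding psubst_def subst_lts_def by (rule cf_extend) (auto intro: hsummable_psubst_kernel cf_psubst_kernel)

lemma psubst_mult: "0 < p \<Longrightarrow> psubst p (x * y) = psubst p x * psubst p y"
  by (rule slin_mult[OF slin_psubst]) (simp_all add: psubst_mon psubst_kernel_add)

lemma psubst_zm: "0 < p \<Longrightarrow> psubst p (mon (zm \<beta>)) = mon (zm (p * \<beta>))"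
  using psubst_kernel_eq[of 0 "zm \<beta>" p] by (simp add: psubst_mon)

lemma psubst_one: "0 < p \<Longrightarrow> psubst p 1 = 1"
  using psubst_zm[of p 0] by (simp add: zm_0)

lemma sp_psubst: assumes "0 < p" "\<And>m. m \<in> sp x \<Longrightarrow> dep k m" shows "sp (psubst p x) \<subseteq> sig p ` sp x + Emon k"
proof (rule sp_slin[OF slin_psubst[OF assms(1)]])
  fix m assume m: "m \<in> sp x"
  have "sp (psubst p (mon m)) \<subseteq> {sig p m} + Emon k" using sp_psubst_kernel[OF assms] fd_sp m assms by (simp add: psubst_mon)
  also have "\<dots> \<subseteq> sig p ` sp x + Emon k" using m by (intro set_plus_mono2) auto
  finally show "sp (psubst p (mon m)) \<subseteq> sig p ` sp x + Emon k" .
qed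

lemma psubst_kernel_lunit: assumes "0 < p" shows "psubst_kernel p (lunit j) = ellS p j"
proof -
  have "(\<Prod>i<Suc j. ellS p i powi lexp (lunit j) i) = (\<Prod>i\<in>{j}. ellS p i powi lexp (lunit j) i)"
    by (rule prod.mono_neutral_right) auto
  then show ?thesis using psubst_kernel_eq[OF dep_lunit[of j "Suc j"], of p] by (simp add: zm_0)
qed

lemma psubst_kernel_minus_lunit: assumes "0 < p" shows "psubst_kernel p (- lunit j) = inverse (ellS p j)"
proof -
  have "psubst_kernel p (- lunit j + lunit j) = psubst_kernel p (- lunit j) * ellS p j"
    using assms by (subst psubst_kernel_add) (auto simp: psubst_kernel_lunit)
  moreover have "psubst_kernel p 0 = 1" using psubst_one[OF assms] psubst_mon[OF assms, of 0] by simp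
  ultimately show ?thesis using assms by (metis add.left_inverse inverse_unique mult.commute)
qed

lemma ellS_one: "ellS 1 j = mon (lunit j)"
proof (induction j)
  case 0 show ?case using ellS_0(1)[of 1] by simp
next
  case (Suc j)
  then show ?case by (simp add: tlog_mon lmlog_lunit inverse_mon)
qed

lemma psubst_id: "psubst 1 x = x"
proof (rule slin_eqI[of "psubst 1" "\<lambda>x. x"])
  fix m assume "fd m"
  then obtain k where k: "dep k m" by (auto simp: fd_def)
  have l: "mon (LMon 0 (\<lambda>i. if i < k then lexp m i else 0)) = (\<Prod>j<k. mon (lunit j) powi lexp m j)" for k
  proof (induction k)
    case 0
    have "LMon 0 (\<lambda>i. 0) = 0" by (rule lmon_eqI) auto
    then show ?case by simp
  next
    case (Suc k)
    let ?m = "\<lambda>k. LMon 0 (\<lambda>i. if i < k then lexp m i else 0)" and ?l = "LMon 0 (\<lambda>i. if i = k then lexp m k else 0)"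
    have "?m (Suc k) = ?m k + ?l" by (rule lmon_eqI) auto
    moreover have "fd (?m k)" "fd ?l" by (rule fdI[OF dep_cut], rule fdI[OF dep_single])
    ultimately have "mon (?m (Suc k)) = mon (?m k) * mon ?l" by (simp add: mon_add)
    then show ?case using Suc by (simp add: mon_powi)
  qed
  have "m = zm (zexp m) + LMon 0 (\<lambda>i. if i < k then lexp m i else 0)"
    using k by (intro lmon_eqI) (auto simp: dep_def)
  moreover have "fd (LMon 0 (\<lambda>i. if i < k then lexp m i else 0))"
    by (rule fdI[OF dep_cut])
  ultimately have "mon m = mon (zm (zexp m)) * (\<Prod>j<k. mon (lunit j) powi lexp m j)"
    using l[of k] by (metis mon_add zm_simps(4))
  moreover have "psubst 1 (mon m) = mon (zm (zexp m)) * (\<Prod>j<k. mon (lunit j) powi lexp m j)"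
    using \<open>fd m\<close> by (simp add: psubst_mon psubst_kernel_eq[OF k] ellS_one)
  ultimately show "psubst 1 (mon m) = mon m" by simp
qed (auto intro: slin_psubst slin_id)

lemma wd_zm: "wd (zm q) = q *\<^sub>R mon (zm (-1))"
  by (simp add: wd_def)

lemma dlog_minus: "dlog (- x) = dlog x"
  by (simp add: dlog_def td_minus)

text \<open>Induction over the depth from dlog(-1 / log y) = - dlog(log y) = - dlog y / log
  y.\<close>

lemma dlog_ellS: assumes "0 < p" shows "dlog (ellS p j) = p *\<^sub>R (mon (zm (-1)) * (\<Prod>i\<le>j. ellS p i))"
proof (induction j)
  case 0
  have "wd (lunit 0) = mon (dlm 0)" using wd_eq[OF dep_lunit[of 0 1]] by simp
  moreover have "zm (-1) + lunit 0 = dlm 0" by (rule lmon_eqI) auto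
  ultimately show ?case using assms by (simp add: ellS_0 dlog_scaleR dlog_mon flip: mon_add del: ellS.simps)
next
  case (Suc j)
  let ?y = "tlog (ellS p j)"
  have y: "?y \<noteq> 0" by (rule tlog_ellS_nonzero[OF assms])
  have "dlog (ellS p (Suc j)) = - dlog ?y" using y by (simp add: dlog_minus dlog_inverse)
  also have "\<dots> = ellS p (Suc j) * dlog (ellS p j)"
    using assms by (simp add: dlog_def[of ?y] td_tlog divide_inverse mult.commute)
  finally show ?case using Suc by (simp add: mult_ac del: ellS.simps)
qed

lemma psubst_kernel_dlm: assumes "0 < p" shows "psubst_kernel p (dlm j) = mon (zm (- p)) * (\<Prod>i\<le>j. ellS p i)"
  using psubst_kernel_eq[of "Suc j" "dlm j" p] by (simp add: dep_dlm lessThan_Suc_atMost)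

text \<open>On monomials the two sides are compared through logarithmic derivatives, which turn the
  product defining \<open>psubst_kernel\<close> into a sum.\<close>

lemma td_psubst: assumes p: "0 < p" shows "td (psubst p x) = psubst p (td x) * (p *\<^sub>R mon (zm (p - 1)))"
proof (rule slin_eqI[of "\<lambda>x. td (psubst p x)" "\<lambda>x. psubst p (td x) * (p *\<^sub>R mon (zm (p - 1)))"])
  show "slin (\<lambda>x. td (psubst p x))" by (rule slin_comp[OF slin_td slin_psubst[OF p]])
  show "slin (\<lambda>x. psubst p (td x) * (p *\<^sub>R mon (zm (p - 1))))"
    unfolding mult.commute[of _ "p *\<^sub>R mon (zm (p - 1))"]
    by (rule slin_times[OF slin_comp[OF slin_psubst[OF p] slin_td]])
  fix m assume m: "fd m"
  then obtain k where k: "dep k m" by (auto simp: fd_def)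
  have z: "mon (zm (- p)) * mon (zm (p - 1)) = mon (zm (- 1))"
    using mon_add[of "zm (- p)" "zm (p - 1)"] zm_add[of "- p" "p - 1"] by simp
  have "dlog (psubst_kernel p m) = wd (zm (p * zexp m)) + dlog (\<Prod>j<k. ellS p j powi lexp m j)"
    unfolding psubst_kernel_eq[OF k] using p by (subst dlog_mult) (auto simp: dlog_mon)
  also have "dlog (\<Prod>j<k. ellS p j powi lexp m j) = (\<Sum>j<k. of_int (lexp m j) * dlog (ellS p j))"
    using p by (subst dlog_prod) (auto simp: dlog_powi)
  finally have "dlog (psubst_kernel p m) = (p * zexp m) *\<^sub>R mon (zm (-1))
      + (\<Sum>j<k. real_of_int (lexp m j) *\<^sub>R (p *\<^sub>R (mon (zm (-1)) * (\<Prod>i\<le>j. ellS p i))))"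
    by (simp add: wd_zm dlog_ellS[OF p] scaleR_conv_of_real)
  also have "\<dots> = psubst p (wd m) * (p *\<^sub>R mon (zm (p - 1)))"
  proof -
    have "psubst_kernel p (zm (- 1)) = mon (zm (- p))" using psubst_zm[OF p, of "-1"] psubst_mon[OF p, of "zm (-1)"] by simp
    then have "psubst p (wd m) = zexp m *\<^sub>R mon (zm (- p)) + (\<Sum>j<k. real_of_int (lexp m j) *\<^sub>R (mon (zm (- p)) * (\<Prod>i\<le>j. ellS p i)))"
      by (simp add: wd_eq[OF k] slin_add[OF slin_psubst[OF p]] slin_scaleR[OF slin_psubst[OF p]] slin_sum[OF slin_psubst[OF p]]
          p psubst_mon psubst_kernel_dlm)
    then show ?thesis
      by (simp add: distrib_left sum_distrib_left scaleR_add_right scaleR_sum_right mult_ac flip: z)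
  qed
  finally have "td (psubst_kernel p m) = psubst_kernel p m * (psubst p (wd m) * (p *\<^sub>R mon (zm (p - 1))))"
    using psubst_kernel_nonzero[OF p m] by (simp add: dlog_def field_simps)
  then show "td (psubst p (mon m)) = psubst p (td (mon m)) * (p *\<^sub>R mon (zm (p - 1)))"
    using m p by (simp add: td_mon psubst_mult psubst_mon mult.assoc)
qed

text \<open>The constant terms of \<open>log \<ell>\<^sub>j\<close> after the substitution; they carry the multiplicative part of
  the substitution, which the derivation does not see.\<close>

lemma psubst_minus_lunit_0: "0 < p \<Longrightarrow> psubst p (mon (- lunit 0)) = p *\<^sub>R mon (- lunit 0)"
  by (simp add: psubst_mon psubst_kernel_minus_lunit tlog_mon lmlog_zm)

lemma psubst_minus_lunit_Suc: assumes "0 < p"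
  obtains e where "small e" "psubst p (mon (- lunit (Suc j))) = mon (- lunit (Suc j)) - of_real (ln (rS p j)) + e"
proof -
  obtain u where u: "u \<in> log_units (Suc j)" "ellS p j = rS p j *\<^sub>R (mon (lunit j) * u)" using ellS_form[OF assms] by blast
  define e where "e = u - 1"
  have e: "small e" using log_units_decomp[OF u(1)] by (simp add: e_def)
  have "ellS p j = rS p j *\<^sub>R (mon (lunit j) * (1 + e))" using u by (simp add: e_def)
  from tlog_ell[OF this rS_pos[OF assms] e]
  have "psubst p (mon (- lunit (Suc j))) = mon (- lunit (Suc j)) - of_real (ln (rS p j)) + (- tLn e)"
    using assms by (simp add: psubst_mon psubst_kernel_minus_lunit)
  then show thesis by (rule that[rotated]) (simp add: small_tLn[OF e])
qed

section \<open>Composition\<close>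

text \<open>The Taylor term of order \<open>i\<close> of x o f at z^p, where f - z^p = z^p
  e.\<close>

definition tcomp_term :: "real \<Rightarrow> ts \<Rightarrow> nat \<Rightarrow> ts \<Rightarrow> ts" where
  "tcomp_term p e i x = (1 / fact i) *\<^sub>R ((mon (zm p) * e) ^ i * psubst p ((td ^^ i) x))"

definition tcomp :: "real \<Rightarrow> ts \<Rightarrow> ts \<Rightarrow> ts" where
  "tcomp p e x = hsum (\<lambda>i. tcomp_term p e i x) UNIV"

lemma of_nat_times_ts: "of_nat n * y = real n *\<^sub>R (y :: ts)"
  by (simp add: scaleR_conv_of_real)

lemma slin_td_pow: "slin (td ^^ i)"
proof (induction i)
  case 0 show ?case using slin_id by (simp add: id_def)
next
  case (Suc i) show ?case using slin_comp[OF slin_td Suc] by (simp add: comp_def)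
qed

lemma sp_td:
  assumes "sp x \<subseteq> {a} + Emon k" "dep k a" shows "sp (td x) \<subseteq> {a + zm (-1)} + Emon k"
proof (rule sp_slin[OF slin_td])
  fix m assume "m \<in> sp x"
  then obtain e where e: "e \<in> Emon k" "m = a + e" using assms(1) by (auto simp: set_plus_def)
  then have m: "dep k m" using assms(2) by (auto simp: Emon_def)
  then have "sp (td (mon m)) \<subseteq> {m} + ({zm (-1)} + Emon k)"
    using sp_dK[OF m] fdI[OF m] by (simp add: td_mon dK_def)
  also have "\<dots> \<subseteq> {a + zm (-1)} + Emon k"
  proof
    fix c assume "c \<in> {m} + ({zm (-1)} + Emon k)"
    then obtain e' where "e' \<in> Emon k" "c = m + (zm (-1) + e')" by (auto simp: set_plus_def)
    then have "c = (a + zm (-1)) + (e + e')" "e + e' \<in> Emon k" using e Emon_add by (auto simp: add_ac)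
    then show "c \<in> {a + zm (-1)} + Emon k" by (auto simp: set_plus_def)
  qed
  finally show "sp (td (mon m)) \<subseteq> {a + zm (-1)} + Emon k" .
qed

lemma sp_td_pow: assumes "dep k m" shows "sp ((td ^^ i) (mon m)) \<subseteq> {m + zm (- real i)} + Emon k"
proof (induction i)
  case 0
  have "{m} \<subseteq> {m} + Emon k" by (metis Emon_0 add_0_right set_plus_intro singleton_iff subsetI)
  then show ?case using fdI[OF assms] by (simp add: zm_0 sp_mon)
next
  case (Suc i)
  have "m + zm (- real i) + zm (-1) = m + zm (- real (Suc i))" by (rule lmon_eqI) auto
  then show ?case using sp_td[OF Suc dep_simps(2)[OF assms zm_simps(3)]]
    by (simp only: funpow.simps comp_apply)
qed

lemma mon_zm_power: "mon (zm p) ^ i = mon (zm (real i * p))"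
  by (induction i) (auto simp: zm_0 distrib_right zm_add mon_add)

text \<open>Each derivative costs a factor z^(-1), which the substitution turns into z^(-p) and the
  increment \<open>mon (zm p) * e\<close> cancels. What remains is a logarithmic correction and
  \<open>i\<close> summands from the support of \<open>e\<close>, the shape required by
  \<open>hsummable_family\<close>.\<close>

lemma sp_tcomp_term:
  assumes p: "0 < p" and k: "dep k m"
  shows "sp (tcomp_term p e i (mon m)) \<subseteq> {sig p m} + Emon k + msum i (sp e)"
proof
  fix c assume "c \<in> sp (tcomp_term p e i (mon m))"
  then have "c \<in> sp ((mon (zm p) * e) ^ i * psubst p ((td ^^ i) (mon m)))"
    unfolding tcomp_term_def using sp_scaleR by blast
  then have "c \<in> sp ((mon (zm p) * e) ^ i) + sp (psubst p ((td ^^ i) (mon m)))" using sp_times by blast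
  then obtain u v where u: "u \<in> sp ((mon (zm p) * e) ^ i)" and v: "v \<in> sp (psubst p ((td ^^ i) (mon m)))" and c: "c = u + v"
    by (rule set_plus_elim)
  have "sp ((mon (zm p) * e) ^ i) \<subseteq> {zm (real i * p)} + msum i (sp e)"
  proof -
    have "sp ((mon (zm p) * e) ^ i) \<subseteq> sp (mon (zm (real i * p))) + sp (e ^ i)"
      unfolding power_mult_distrib mon_zm_power by (rule sp_times)
    also have "\<dots> \<subseteq> {zm (real i * p)} + msum i (sp e)"
      using sp_power by (intro set_plus_mono2) (auto simp: sp_mon)
    finally show ?thesis .
  qed
  then obtain z where z: "z \<in> msum i (sp e)" "u = zm (real i * p) + z" using u by (auto simp: set_plus_def)
  have d: "dep k a" if "a \<in> sp ((td ^^ i) (mon m))" for a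
    using sp_td_pow[OF k, of i] that k by (auto simp: set_plus_def Emon_def)
  have "sp (psubst p ((td ^^ i) (mon m))) \<subseteq> sig p ` sp ((td ^^ i) (mon m)) + Emon k"
    by (rule sp_psubst[OF p d])
  then obtain b e1 where b: "b \<in> sp ((td ^^ i) (mon m))" "e1 \<in> Emon k" "v = sig p b + e1"
    using v by (auto simp: set_plus_def)
  obtain e2 where e2: "e2 \<in> Emon k" "b = m + zm (- real i) + e2"
    using sp_td_pow[OF k, of i] b(1) by (auto simp: set_plus_def)
  have "sig p b = sig p m + zm (- (real i * p)) + e2"
    using e2 sig_Emon[OF e2(1)] by (simp add: sig_add sig_zm mult.commute)
  then have "c = sig p m + (e1 + e2) + z"
    unfolding c z(2) b(3) by (simp add: zm_minus algebra_simps)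
  moreover have "e1 + e2 \<in> Emon k" using b e2 Emon_add by blast
  ultimately show "c \<in> {sig p m} + Emon k + msum i (sp e)" using z by (auto intro!: set_plus_intro)
qed

lemma slin_tcomp_term: "0 < p \<Longrightarrow> slin (tcomp_term p e i)"
  unfolding tcomp_term_def by (intro slin_cmult slin_times slin_comp[OF slin_psubst slin_td_pow])

lemma hsummable_tcomp_term_family:
  assumes "0 < p" "small e" "adm W"
  shows "hsummable (\<lambda>(i,m). tcomp_term p e i (mon m)) (UNIV \<times> W)"
proof -
  obtain k where k: "\<And>m. m \<in> W \<Longrightarrow> dep k m" using adm_dep[OF assms(3)] by blast
  show ?thesis
    by (rule hsummable_family[OF assms(3,1) adm_Emon[of k] adm_sp[of e]])
      (use assms(2) sp_tcomp_term[OF assms(1) k] in \<open>auto simp: small_def\<close>)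
qed

lemma hsummable_tcomp_term: assumes "0 < p" "small e" shows "hsummable (\<lambda>i. tcomp_term p e i x) UNIV"
  by (rule slin_family(1)[OF slin_tcomp_term[OF assms(1)] hsummable_tcomp_term_family[OF assms]])

lemma slin_tcomp: assumes "0 < p" "small e" shows "slin (tcomp p e)"
  unfolding tcomp_def[abs_def] by (rule slin_family(2)[OF slin_tcomp_term[OF assms(1)] hsummable_tcomp_term_family[OF assms]])

lemma tcomp_term_0: "tcomp_term p e 0 x = psubst p x"
  by (simp add: tcomp_term_def)

lemma tcomp_term_Suc: "tcomp_term p e (Suc i) x = (1 / real (Suc i)) *\<^sub>R ((mon (zm p) * e) * tcomp_term p e i (td x))"
proof -
  have "(td ^^ Suc i) x = (td ^^ i) (td x)" by (simp add: funpow_Suc_right del: funpow.simps)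
  then show ?thesis unfolding tcomp_term_def by (simp add: mult.assoc del: funpow.simps)
qed

lemma hsum_shift:
  assumes "hsummable F (UNIV::nat set)"
  shows "hsummable (\<lambda>i. F (Suc i)) UNIV" "hsum F UNIV = F 0 + hsum (\<lambda>i. F (Suc i)) UNIV"
proof -
  have b: "bij_betw Suc UNIV (range Suc)" by (simp add: bij_betw_def)
  have r: "hsummable F (range Suc)" by (rule hsummable_subset[OF assms]) auto
  then show s: "hsummable (\<lambda>i. F (Suc i)) UNIV" using hsummable_reindex[OF b, of F] by simp
  show "hsum F UNIV = F 0 + hsum (\<lambda>i. F (Suc i)) UNIV"
  proof (rule ts_eqI)
    fix c
    have f: "finite {i. cf (F i) c \<noteq> 0}" using hsummableD(2)[OF assms] by simp
    have "cf (hsum F UNIV) c = (\<Sum>i. cf (F i) c)" by (rule suminf_hsum[OF assms, symmetric])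
    also have "\<dots> = cf (F 0) c + (\<Sum>i. cf (F (Suc i)) c)"
      using suminf_split_head[OF summable_finite[OF f, of "\<lambda>i. cf (F i) c"]] by simp
    finally show "cf (hsum F UNIV) c = cf (F 0 + hsum (\<lambda>i. F (Suc i)) UNIV) c"
      by (simp add: suminf_hsum[OF s])
  qed
qed

lemma tcomp_split:
  assumes "0 < p" "small e"
  shows "hsummable (\<lambda>i. tcomp_term p e (Suc i) x) UNIV" "tcomp p e x = psubst p x + hsum (\<lambda>i. tcomp_term p e (Suc i) x) UNIV"
  using hsum_shift[OF hsummable_tcomp_term[OF assms, of x]] by (simp_all add: tcomp_def tcomp_term_0)

lemma cf_td_pow: "cf ((td ^^ i) x) = (deriv_lts ^^ i) (cf x)"
  by (induction i) (simp_all add: cf_td)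

text \<open>The link to the given composition: \<open>comp_lts\<close> reads exponent and
  coefficient off the leading term, and for z^p (1 + e) they are \<open>p\<close> and 1.\<close>

lemma cf_tcomp:
  assumes p: "0 < p" and e: "small e"
  shows "cf x \<circ>\<^sub>t cf (mon (zm p) * (1 + e)) = cf (tcomp p e x)"
proof
  fix c
  let ?f = "mon (zm p) * (1 + e)"
  have "?f = 1 *\<^sub>R (mon (zm p) * (1 + e))" by simp
  note l = ts_lead_unique[OF this _ zm_simps(4) e]
  have lead: "lead (cf ?f) = zm p" "cf ?f (zm p) = 1" using l by (simp_all add: ld_def lc_def)
  have f1: "cf ?f - scale_lts 1 (zpow p) = cf (mon (zm p) * e)"
  proof
    fix a
    have "scale_lts 1 (zpow p) a = cf (mon (zm p)) a"
      by (simp add: scale_lts_def zpow_def cf_mon_fd zm_def[symmetric])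
    then show "(cf ?f - scale_lts 1 (zpow p)) a = cf (mon (zm p) * e) a" by (simp add: distrib_left)
  qed
  have ml: "mult_lts (cf y) (cf z) c = cf (y * z) c" for y z by (simp add: cf_times_mult_lts)
  have "(cf x \<circ>\<^sub>t cf ?f) c = cf (psubst p x) c + (\<Sum>i. cf (psubst p ((td ^^ Suc i) x) * (mon (zm p) * e) ^ Suc i) c / fact (Suc i))"
    unfolding comp_lts_def Let_def lead zm_simps f1 cf_psubst[OF p, symmetric] cf_td_pow[symmetric] cf_power[symmetric] ml ..
  also have "\<dots> = cf (psubst p x) c + (\<Sum>i. cf (tcomp_term p e (Suc i) x) c)"
    unfolding tcomp_term_def by (simp only: cf_simps) (simp add: mult.commute[of "psubst p _"] del: funpow.simps power_Suc fact_Suc)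
  also have "\<dots> = cf (tcomp p e x) c"
    using tcomp_split[OF p e, of x] by (simp add: suminf_hsum)
  finally show "(cf x \<circ>\<^sub>t cf ?f) c = cf (tcomp p e x) c" .
qed

text \<open>Taylor coefficients form a ring homomorphism into formal power series: both sides of the
  multiplicativity satisfy the same recursion under \<open>fps_deriv\<close>.\<close>

lemma taylor_mult:
  "(1 / fact n) *\<^sub>R (td ^^ n) (x * y) =
    (\<Sum>i=0..n. ((1 / fact i) *\<^sub>R (td ^^ i) x) * ((1 / fact (n - i)) *\<^sub>R (td ^^ (n - i)) y))"
proof -
  define G :: "ts \<Rightarrow> ts fps" where "G x = Abs_fps (\<lambda>n. (1 / fact n) *\<^sub>R (td ^^ n) x)" for x
  have der: "fps_deriv (G x) = G (td x)" for x
  proof (rule fps_ext)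
    fix n
    have "(td ^^ Suc n) x = (td ^^ n) (td x)" by (simp add: funpow_Suc_right del: funpow.simps)
    then have "fps_deriv (G x) $ n = of_nat (Suc n) * ((1 / fact (Suc n)) *\<^sub>R (td ^^ n) (td x))"
      by (simp add: G_def del: funpow.simps)
    also have "\<dots> = (real (Suc n) * (1 / fact (Suc n))) *\<^sub>R (td ^^ n) (td x)"
      by (simp only: of_nat_times_ts scaleR_scaleR)
    also have "real (Suc n) * (1 / fact (Suc n)) = 1 / fact n" by simp
    finally show "fps_deriv (G x) $ n = G (td x) $ n" by (simp add: G_def)
  qed
  have "G (x * y) $ n = (G x * G y) $ n" for x y
  proof (induction n arbitrary: x y)
    case 0 show ?case by (simp add: G_def)
  next
    case (Suc n)
    have "of_nat (Suc n) * G (x * y) $ Suc n = fps_deriv (G (x * y)) $ n" by simp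
    also have "\<dots> = G (td x * y) $ n + G (x * td y) $ n"
      unfolding der td_mult by (simp add: G_def slin_add[OF slin_td_pow] scaleR_add_right)
    also have "\<dots> = fps_deriv (G x * G y) $ n" by (simp add: Suc der)
    also have "\<dots> = of_nat (Suc n) * (G x * G y) $ Suc n"
      by (simp only: fps_deriv_nth Suc_eq_plus1)
    finally show ?case by (metis mult_left_cancel of_nat_eq_0_iff nat.distinct(2))
  qed
  then show ?thesis by (simp add: G_def fps_mult_nth)
qed

lemma tcomp_term_mult: assumes "0 < p" shows "tcomp_term p e n (x * y) = (\<Sum>i=0..n. tcomp_term p e i x * tcomp_term p e (n - i) y)"
proof -
  let ?v = "mon (zm p) * e"
  have CT': "tcomp_term p e n x = ?v ^ n * psubst p ((1 / fact n) *\<^sub>R (td ^^ n) x)" for n x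
    by (simp add: tcomp_term_def slin_scaleR[OF slin_psubst[OF assms]])
  have "tcomp_term p e n (x * y) = (\<Sum>i=0..n. ?v ^ n * (psubst p ((1 / fact i) *\<^sub>R (td ^^ i) x) * psubst p ((1 / fact (n - i)) *\<^sub>R (td ^^ (n - i)) y)))"
    unfolding CT' taylor_mult slin_sum[OF slin_psubst[OF assms]] psubst_mult[OF assms] sum_distrib_left ..
  also have "\<dots> = (\<Sum>i=0..n. tcomp_term p e i x * tcomp_term p e (n - i) y)"
  proof (rule sum.cong)
    fix i assume "i \<in> {0..n}"
    then have "?v ^ n = ?v ^ i * ?v ^ (n - i)" by (simp flip: power_add)
    then show "?v ^ n * (psubst p ((1 / fact i) *\<^sub>R (td ^^ i) x) * psubst p ((1 / fact (n - i)) *\<^sub>R (td ^^ (n - i)) y)) = tcomp_term p e i x * tcomp_term p e (n - i) y"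
      unfolding CT' by (simp only: mult_ac)
  qed simp
  finally show ?thesis .
qed

lemma tcomp_mult: assumes "0 < p" "small e" shows "tcomp p e (x * y) = tcomp p e x * tcomp p e y"
  unfolding tcomp_def hsum_cauchy(2)[OF hsummable_tcomp_term[OF assms] hsummable_tcomp_term[OF assms], symmetric]
  by (rule hsum_cong) (rule tcomp_term_mult[OF assms(1)])

lemma td_zm: "td (mon (zm q)) = q *\<^sub>R mon (zm (q - 1))"
proof -
  have "zm q + zm (-1) = zm (q - 1)" by (rule lmon_eqI) auto
  then show ?thesis by (simp add: td_mon wd_zm flip: mon_add)
qed

text \<open>The derivative of a Taylor term has a part \<open>A\<close> from the increment and a
  part \<open>B\<close> from the inner substitution. Since \<open>A (Suc i)\<close> involves the
  term of order \<open>i\<close> for \<open>td x\<close>, both parts add up to multiples of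
  \<open>tcomp p e (td x)\<close>.\<close>

lemma td_tcomp:
  assumes p: "0 < p" and e: "small e"
  shows "td (tcomp p e x) = tcomp p e (td x) * td (mon (zm p) * (1 + e))"
proof -
  let ?v = "mon (zm p) * e"
  note s = hsummable_tcomp_term[OF assms]
  define A where "A i = (if i = 0 then 0 else td ?v * tcomp_term p e (i - 1) (td x))" for i
  define B where "B i = (p *\<^sub>R mon (zm (p - 1))) * tcomp_term p e i (td x)" for i
  have AS: "A (Suc i) = td ?v * tcomp_term p e i (td x)" for i by (simp add: A_def)
  have tdCT: "td (tcomp_term p e i x) = A i + B i" for i
  proof -
    have shift: "(td ^^ i) (td x) = td ((td ^^ i) x)" by (simp add: funpow_swap1)
    have "td (tcomp_term p e i x) = (1 / fact i) *\<^sub>R (of_nat i * ?v ^ (i - 1) * td ?v * psubst p ((td ^^ i) x))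
        + (1 / fact i) *\<^sub>R (?v ^ i * (psubst p (td ((td ^^ i) x)) * (p *\<^sub>R mon (zm (p - 1)))))"
      by (simp only: tcomp_term_def td_scaleR td_mult[of "_ ^ _"] td_power td_psubst[OF p] scaleR_add_right)
    also have "(1 / fact i) *\<^sub>R (?v ^ i * (psubst p (td ((td ^^ i) x)) * (p *\<^sub>R mon (zm (p - 1))))) = B i"
      unfolding B_def tcomp_term_def shift by (simp add: mult_ac)
    also have "(1 / fact i) *\<^sub>R (of_nat i * ?v ^ (i - 1) * td ?v * psubst p ((td ^^ i) x)) = A i"
    proof (cases i)
      case (Suc j)
      have sh: "(td ^^ Suc j) x = (td ^^ j) (td x)" by (simp add: funpow_Suc_right del: funpow.simps)
      have "(1 / fact (Suc j)) *\<^sub>R (of_nat (Suc j) * ?v ^ j * td ?v * psubst p ((td ^^ Suc j) x))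
        = ((1 / fact (Suc j)) * real (Suc j)) *\<^sub>R (?v ^ j * td ?v * psubst p ((td ^^ Suc j) x))"
        by (simp only: of_nat_times_ts scaleR_scaleR mult.assoc mult_scaleR_left)
      also have "(1 / fact (Suc j)) * real (Suc j) = 1 / fact j" by simp
      finally show ?thesis unfolding Suc AS tcomp_term_def sh by (simp add: mult_ac)
    qed (simp add: A_def)
    finally show ?thesis by simp
  qed
  have sB: "hsummable B UNIV" unfolding B_def by (rule hsum_times_left(1)[OF s])
  \<comment> \<open>\<open>A\<close> is shifted by one index, so its summability is taken from that
    of \<open>A i + B i\<close> and of \<open>B\<close>.\<close>
  have "hsummable (\<lambda>i. (A i + B i) - B i) UNIV"
    using slin_hsum(1)[OF slin_td s, of x] sB unfolding tdCT by (intro hsummable_diff)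
  then have sA: "hsummable A UNIV" by simp
  have "td (tcomp p e x) = hsum (\<lambda>i. A i + B i) UNIV"
    unfolding tcomp_def slin_hsum(2)[OF slin_td s] tdCT ..
  also have "\<dots> = hsum A UNIV + hsum B UNIV" by (rule hsum_add[OF sA sB])
  also have "hsum A UNIV = td ?v * tcomp p e (td x)"
    using hsum_shift(2)[OF sA] by (simp add: AS hsum_times_left[OF s] tcomp_def A_def[of 0])
  also have "hsum B UNIV = (p *\<^sub>R mon (zm (p - 1))) * tcomp p e (td x)"
    unfolding B_def tcomp_def by (rule hsum_times_left(2)[OF s])
  also have "td ?v * tcomp p e (td x) + (p *\<^sub>R mon (zm (p - 1))) * tcomp p e (td x) = tcomp p e (td x) * td (mon (zm p) * (1 + e))"
  proof -
    have "td (mon (zm p) * (1 + e)) = p *\<^sub>R mon (zm (p - 1)) + td ?v"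
      by (simp only: distrib_left td_add mult_1_right td_zm)
    then show ?thesis by (simp add: algebra_simps)
  qed
  finally show ?thesis .
qed

lemma td_pow_zm: "(td ^^ i) (mon (zm q)) = (fact i * (q gchoose i)) *\<^sub>R mon (zm (q - real i))"
proof (induction i)
  case (Suc i)
  have "fact i * (q gchoose i) * (q - real i) = fact (Suc i) * (q gchoose Suc i)"
    by (simp add: gbinomial_prod_rev)
  moreover have "q - real i - 1 = q - real (Suc i)" by simp
  ultimately show ?case by (simp only: funpow.simps comp_apply Suc td_scaleR td_zm scaleR_scaleR)
qed simp

lemma mon_zm_mult: "mon (zm a) * mon (zm b) = mon (zm (a + b))"
  by (simp add: zm_add mon_add)

lemma tcomp_term_zm: assumes "0 < p" shows "tcomp_term p e i (mon (zm q)) = (q gchoose i) *\<^sub>R (mon (zm (p * q)) * e ^ i)"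
proof -
  have "(mon (zm p) * e) ^ i * psubst p (mon (zm (q - real i))) = mon (zm (real i * p)) * mon (zm (p * (q - real i))) * e ^ i"
    by (simp add: power_mult_distrib mon_zm_power psubst_zm[OF assms] mult_ac)
  also have "\<dots> = mon (zm (p * q)) * e ^ i"
    unfolding mon_zm_mult by (simp add: algebra_simps)
  finally show ?thesis
    by (simp add: tcomp_term_def td_pow_zm slin_scaleR[OF slin_psubst[OF assms]])
qed

lemma tcomp_zm: assumes "0 < p" "small e" shows "tcomp p e (mon (zm q)) = mon (zm (p * q)) * tBin q e"
proof -
  have "tcomp p e (mon (zm q)) = hsum (\<lambda>i. mon (zm (p * q)) * ((fps_binomial q $ i) *\<^sub>R e ^ i)) UNIV"
    unfolding tcomp_def tcomp_term_zm[OF assms(1)] by simp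
  then show ?thesis
    unfolding tBin_def fev_def using hsum_times_left(2)[OF small_hsummable[OF assms(2)]] by simp
qed

lemma tBin_0: "tBin 0 e = 1"
  by (simp add: tBin_def fev_1)

lemma tcomp_one: assumes "0 < p" "small e" shows "tcomp p e 1 = 1"
  using tcomp_zm[OF assms, of 0] by (simp add: zm_0 tBin_0)

lemma td_minus_lunit_0: "td (mon (- lunit 0)) = - mon (zm (-1))"
  using td_lmlog[of "zm 1"] by (simp add: lmlog_zm td_minus wd_zm equation_minus_iff)

lemma td_minus_lunit_Suc: "td (mon (- lunit (Suc j))) = - mon (dlm j)"
proof -
  have "wd (lunit j) = (\<Sum>i<Suc j. real_of_int (lexp (lunit j) i) *\<^sub>R mon (dlm i))"
    using wd_eq[OF dep_lunit[of j "Suc j"]] by simp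
  also have "\<dots> = (\<Sum>i\<in>{j}. real_of_int (lexp (lunit j) i) *\<^sub>R mon (dlm i))"
    by (rule sum.mono_neutral_right) auto
  finally show ?thesis using td_lmlog[of "lunit j"] by (simp add: lmlog_lunit td_minus equation_minus_iff)
qed

lemma gbinomial_minus_one: "(-1 gchoose i) = (-1::real) ^ i"
  using gbinomial_minus[of "1::real" i] by (simp add: binomial_gbinomial[symmetric])

text \<open>As \<open>mon (- lunit 0)\<close> is - log z, this amounts to log f = p log z + log(1 +
  e); the Taylor coefficients of the logarithm are those of \<open>fps_ln\<close>.\<close>

lemma tcomp_minus_lunit_0:
  assumes p: "0 < p" and e: "small e"
  shows "tcomp p e (mon (- lunit 0)) = p *\<^sub>R mon (- lunit 0) - tLn e"
proof -
  have T: "tcomp_term p e (Suc i) (mon (- lunit 0)) = - ((fps_ln 1 $ Suc i) *\<^sub>R e ^ Suc i)" for i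
  proof -
    have "tcomp_term p e i (- mon (zm (-1))) = - (((-1) ^ i) *\<^sub>R (mon (zm (- p)) * e ^ i))"
      using slin_uminus[OF slin_tcomp_term[OF p]] tcomp_term_zm[OF p, of e i "-1"] by (simp add: gbinomial_minus_one)
    moreover have "mon (zm p) * mon (zm (- p)) = 1" by (simp add: mon_zm_mult zm_0)
    then have "(mon (zm p) * e) * (mon (zm (- p)) * e ^ i) = e ^ Suc i"
      by (metis (no_types, lifting) mult.assoc mult.commute mult_1 power_Suc)
    ultimately show ?thesis
      by (simp add: tcomp_term_Suc td_minus_lunit_0 fps_ln_nth)
  qed
  note s = small_hsummable[OF e, of "\<lambda>n. fps_ln 1 $ n" UNIV]
  have "tLn e = hsum (\<lambda>i. (fps_ln 1 $ Suc i) *\<^sub>R e ^ Suc i) UNIV"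
    using hsum_shift(2)[OF s] unfolding tLn_def fev_def by simp
  then have "hsum (\<lambda>i. tcomp_term p e (Suc i) (mon (- lunit 0))) UNIV = - tLn e"
    unfolding T using hsum_uminus[OF hsum_shift(1)[OF s]] by simp
  then show ?thesis using tcomp_split(2)[OF p e, of "mon (- lunit 0)"] by (simp add: psubst_minus_lunit_0[OF p])
qed

text \<open>Every Taylor term of positive order contains z^p e times substituted derivatives whose
  powers of z cancel z^p; so it is infinitesimal, and the constant is the one already present in
  \<open>psubst\<close>.\<close>

lemma tcomp_minus_lunit_Suc:
  assumes p: "0 < p" and e: "small e"
  obtains d where "small d" "tcomp p e (mon (- lunit (Suc j))) = mon (- lunit (Suc j)) - of_real (ln (rS p j)) + d"
proof -
  let ?x = "mon (- lunit (Suc j))" and ?v = "mon (zm p) * e"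
  obtain d1 where d1: "small d1" "psubst p ?x = ?x - of_real (ln (rS p j)) + d1" using psubst_minus_lunit_Suc[OF p] .
  let ?d2 = "hsum (\<lambda>i. tcomp_term p e (Suc i) ?x) UNIV"
  have sm: "small (tcomp_term p e (Suc i) ?x)" for i
  proof -
    have d: "dep (Suc j) (dlm j)" by (simp add: dep_dlm)
    have "tcomp_term p e i (td ?x) = - tcomp_term p e i (mon (dlm j))"
      by (simp add: td_minus_lunit_Suc slin_uminus[OF slin_tcomp_term[OF p]])
    then have eq: "tcomp_term p e (Suc i) ?x = (- (1 / real (Suc i))) *\<^sub>R (?v * tcomp_term p e i (mon (dlm j)))"
      by (simp add: tcomp_term_Suc)
    have "small (?v * tcomp_term p e i (mon (dlm j)))"
      unfolding small_def
    proof
      fix c assume "c \<in> sp (?v * tcomp_term p e i (mon (dlm j)))"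
      then have "c \<in> sp ?v + sp (tcomp_term p e i (mon (dlm j)))" using sp_times by blast
      then obtain a b where a: "a \<in> sp ?v" and b: "b \<in> sp (tcomp_term p e i (mon (dlm j)))" and c: "c = a + b"
        by (rule set_plus_elim)
      obtain a' where a': "a' \<in> sp e" "a = zm p + a'" using a sp_times[of "mon (zm p)" e] by (auto simp: sp_mon set_plus_def)
      obtain b1 b2 where b': "b1 \<in> Emon (Suc j)" "b2 \<in> msum i (sp e)" "b = sig p (dlm j) + b1 + b2"
        using sp_tcomp_term[OF p d, of e i] b by (auto simp: set_plus_def)
      have "zm p + sig p (dlm j) \<in> Emon (Suc j)" using d by (auto simp: Emon_def)
      then have *: "0 \<le> zm p + sig p (dlm j)" "0 \<le> b1" "0 < a'" "0 \<le> b2"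
        using b' a' e Emon_nonneg msum_nonneg(1)[of "sp e"] by (auto simp: small_def)
      have "0 < x + b1 + b2 + a'" if "0 \<le> x" for x :: lmon
        using that \<open>0 \<le> b1\<close> \<open>0 < a'\<close> \<open>0 \<le> b2\<close> by (intro add_nonneg_pos add_nonneg_nonneg)
      from this[OF \<open>0 \<le> zm p + sig p (dlm j)\<close>] show "0 < c" unfolding c a'(2) b'(3) by (simp add: add_ac)
    qed
    then show ?thesis unfolding eq by (rule small_scaleR)
  qed
  have "small ?d2" by (rule small_hsum[OF tcomp_split(1)[OF p e]]) (rule sm)
  then have "small (d1 + ?d2)" using d1 small_add by blast
  moreover have "tcomp p e ?x = ?x - of_real (ln (rS p j)) + (d1 + ?d2)"
    using tcomp_split(2)[OF p e, of ?x] d1 by simp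
  ultimately show thesis using that by blast
qed

lemma tcomp_0: "0 < p \<Longrightarrow> tcomp p 0 x = psubst p x"
proof -
  assume p: "0 < p"
  have "tcomp_term p 0 (Suc i) x = 0" for i by (simp add: tcomp_term_Suc)
  then show ?thesis using tcomp_split(2)[OF p small_0, of x] hsum_neutral[OF hsummable_finite[of "{}"], of UNIV "\<lambda>i. tcomp_term p 0 (Suc i) x"]
    by (simp add: hsum_finite)
qed

lemma tcomp_id: "tcomp 1 0 x = x"
  by (simp add: tcomp_0 psubst_id)

lemma sp_tcomp_mon:
  assumes "0 < p" "small e" "dep k m"
  shows "sp (tcomp p e (mon m)) \<subseteq> {sig p m} + (Emon k + mgen (sp e))"
  unfolding tcomp_def
proof (rule sp_hsum[OF hsummable_tcomp_term[OF assms(1,2)]])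
  fix i
  have "{sig p m} + Emon k + msum i (sp e) \<subseteq> {sig p m} + Emon k + mgen (sp e)"
    by (intro set_plus_mono2 msum_subset_mgen order_refl)
  then show "sp (tcomp_term p e i (mon m)) \<subseteq> {sig p m} + (Emon k + mgen (sp e))"
    using sp_tcomp_term[OF assms(1,3), of e i] by (simp add: add.assoc)
qed

lemma tcomp_mon_ge: assumes "0 < p" "small e" "fd m" "c \<in> sp (tcomp p e (mon m))" shows "sig p m \<le> c"
proof -
  obtain k where k: "dep k m" using assms(3) by (auto simp: fd_def)
  obtain a b where "a \<in> Emon k" "b \<in> mgen (sp e)" "c = sig p m + (a + b)"
    using sp_tcomp_mon[OF assms(1,2) k] assms(4) by (auto simp: set_plus_def)
  moreover from this have "0 \<le> a" "0 \<le> b" using Emon_nonneg mgen_nonneg assms(2) by (auto simp: small_def)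
  ultimately show ?thesis by simp
qed

text \<open>A Taylor term of positive order adds at least one positive monomial of \<open>e\<close>
  and cannot reach the leading one, so the diagonal entry is that of the substitution of z^p. The
  exponent of l_1 enters because l_1 becomes l_1 / p.\<close>

lemma cf_tcomp_lead_mon:
  assumes p: "0 < p" and e: "small e" and m: "fd m"
  shows "cf (tcomp p e (mon m)) (sig p m) = p powi (- lexp m 0)"
proof -
  obtain k where k: "dep k m" using m by (auto simp: fd_def)
  have "cf (tcomp_term p e (Suc i) (mon m)) (sig p m) = 0" for i
  proof (rule ccontr)
    assume "cf (tcomp_term p e (Suc i) (mon m)) (sig p m) \<noteq> 0"
    then have "sig p m \<in> {sig p m} + Emon k + msum (Suc i) (sp e)" using sp_tcomp_term[OF p k, of e "Suc i"] by (auto simp: sp_def)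
    then obtain a b where ab: "a \<in> Emon k" "b \<in> msum (Suc i) (sp e)" "sig p m = sig p m + a + b"
      by (auto simp: set_plus_def simp del: msum.simps)
    then have "0 \<le> a" "0 < b" using Emon_nonneg msum_nonneg(2)[of "sp e"] e by (auto simp: small_def simp del: msum.simps)
    then show False using ab(3) add_nonneg_pos[of a b] by (simp add: add.assoc)
  qed
  then have "cf (hsum (\<lambda>i. tcomp_term p e (Suc i) (mon m)) UNIV) (sig p m) = 0"
    by (simp add: cf_hsum[OF tcomp_split(1)[OF p e]])
  then show ?thesis using tcomp_split(2)[OF p e, of "mon m"] by (simp add: psubst_mon[OF p m] cf_psubst_kernel_lead[OF p m])
qed

text \<open>Strict monotonicity of \<open>sig p\<close> keeps the images of the other monomials
  above the leading monomial of the image of \<open>ld x\<close>.\<close>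

lemma tcomp_lead:
  assumes p: "0 < p" and e: "small e" and x: "x \<noteq> 0"
  shows "cf (tcomp p e x) (sig p (ld x)) = lc x * p powi (- lexp (ld x) 0)"
    "tcomp p e x \<noteq> 0" "ld (tcomp p e x) = sig p (ld x)"
proof -
  have ge: "sig p (ld x) \<le> c" if "c \<in> sp (tcomp p e x)" for c
  proof -
    have "sp (tcomp p e x) \<subseteq> {c. sig p (ld x) \<le> c}"
    proof (rule sp_slin[OF slin_tcomp[OF p e]])
      fix m assume m: "m \<in> sp x"
      then have "sig p (ld x) \<le> sig p m" using ld_le[OF x] sig_le[OF p] by blast
      then show "sp (tcomp p e (mon m)) \<subseteq> {c. sig p (ld x) \<le> c}"
        using tcomp_mon_ge[OF p e fd_sp[OF m]] order_trans by blast
    qed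
    then show ?thesis using that by blast
  qed
  have "cf (tcomp p e x) (sig p (ld x)) = cf x (ld x) * cf (tcomp p e (mon (ld x))) (sig p (ld x))"
  proof (rule cf_slin_single[OF slin_tcomp[OF p e]])
    fix a assume a: "a \<in> sp x" "a \<noteq> ld x"
    then have "sig p (ld x) < sig p a" using ld_le[OF x a(1)] sig_less[OF p] by auto
    then show "cf (tcomp p e (mon a)) (sig p (ld x)) = 0"
      using tcomp_mon_ge[OF p e fd_sp[OF a(1)], of "sig p (ld x)"] by (meson not_le notin_sp)
  qed
  then show c: "cf (tcomp p e x) (sig p (ld x)) = lc x * p powi (- lexp (ld x) 0)"
    by (simp add: lc_def cf_tcomp_lead_mon[OF p e fd_ld[OF x]])
  then have in_sp: "sig p (ld x) \<in> sp (tcomp p e x)" using p lc_nonzero[OF x] by (simp add: sp_def)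
  then show nz: "tcomp p e x \<noteq> 0" by auto
  show "ld (tcomp p e x) = sig p (ld x)"
    using ge[OF ld_in[OF nz]] ld_le[OF nz in_sp] by (rule antisym[rotated])
qed

lemma tcomp_inj: assumes "0 < p" "small e" "tcomp p e x = tcomp p e y" shows "x = y"
  using tcomp_lead(2)[OF assms(1,2), of "x - y"] assms(3) slin_diff[OF slin_tcomp[OF assms(1,2)], of x y] by auto

lemma small_iff_ld: "small x \<longleftrightarrow> x = 0 \<or> 0 < ld x"
  using ld_in[of x] ld_le[of x] by (cases "x = 0") (auto simp: small_def intro: less_le_trans)

lemma sig_pos: "0 < p \<Longrightarrow> 0 < a \<Longrightarrow> 0 < sig p a"
  using sig_less[of p 0 a] by simp

lemma small_tcomp: assumes "0 < p" "small e" "small x" shows "small (tcomp p e x)"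
proof (cases "x = 0")
  case True then show ?thesis by (simp add: slin_0[OF slin_tcomp[OF assms(1,2)]])
next
  case False
  then show ?thesis using tcomp_lead[OF assms(1,2) False] assms(3) sig_pos[OF assms(1)] by (simp add: small_iff_ld)
qed

section \<open>Uniqueness of substitutions and associativity\<close>

lemma mon_factor: assumes "dep k m"
  shows "mon m = mon (zm (zexp m)) * (\<Prod>j<k. mon (lunit j) powi lexp m j)"
  using psubst_kernel_eq[OF assms, of 1] psubst_mon[of 1 m] fdI[OF assms] by (simp add: psubst_id ellS_one)

lemma hom_inverse:
  assumes "\<And>x y. T (x * y) = T x * T (y :: ts)" "T 1 = (1 :: ts)" "x \<noteq> 0"
  shows "T (inverse x) = inverse (T x)"
  using assms(1)[of x "inverse x"] assms(2,3) by (intro inverse_unique[symmetric]) simp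

lemma hom_powi:
  assumes "\<And>x y. T (x * y) = T x * T (y :: ts)" "T 1 = (1 :: ts)" "x \<noteq> 0"
  shows "T (x powi n) = T x powi n"
proof -
  have "T (y ^ n) = T y ^ n" for y n by (induction n) (auto simp: assms)
  then show ?thesis using hom_inverse[of T x] assms by (simp add: power_int_def)
qed

lemma hom_prod:
  assumes "\<And>x y. T (x * y) = T x * T (y :: ts)" "T 1 = (1 :: ts)"
  shows "T (prod f A) = (\<Prod>i\<in>A. T (f i))"
  by (induction A rule: infinite_finite_induct) (auto simp: assms)

text \<open>By the chain rule two substitutions with the same derivation factor \<open>w\<close> that agree on the first
  \<open>j\<close> logarithms differ at the next one by a constant, which the last hypothesis excludes.\<close>

lemma substitution_unique:
  assumes T: "slin T" "\<And>x y. T (x * y) = T x * T y" "T 1 = 1" "\<And>x. td (T x) = T (td x) * w"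
    and T': "slin T'" "\<And>x y. T' (x * y) = T' x * T' y" "T' 1 = 1" "\<And>x. td (T' x) = T' (td x) * w"
    and z: "\<And>q. T (mon (zm q)) = T' (mon (zm q))"
    and l0: "T (mon (- lunit 0)) = T' (mon (- lunit 0))"
    and l: "\<And>j. small (T (mon (- lunit (Suc j))) - T' (mon (- lunit (Suc j))))"
  shows "T x = T' x"
proof (rule slin_eqI[OF T(1) T'(1)])
  have inv: "mon (lunit j) = inverse (mon (- lunit j))" for j by (simp add: inverse_mon)
  have ml: "T (mon (- lunit j)) = T' (mon (- lunit j))" for j
  proof (induction j rule: less_induct)
    case (less j)
    show ?case
    proof (cases j)
      case 0 then show ?thesis using l0 by simp
    next
      case (Suc i)
      let ?x = "mon (- lunit (Suc i))"
      have pl: "T (mon (lunit n)) = T' (mon (lunit n))" if "n \<le> i" for n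
        using less.IH[of n] that Suc hom_inverse[OF T(2,3), of "mon (- lunit n)"] hom_inverse[OF T'(2,3), of "mon (- lunit n)"]
        by (simp add: inv)
      \<comment> \<open>Up to sign the derivative of \<open>?x\<close> is a product of 1 / z and the
        logarithms already treated.\<close>
      have "mon (dlm i) = mon (zm (-1)) * (\<Prod>n<Suc i. mon (lunit n) powi lexp (dlm i) n)"
        using mon_factor[of "Suc i" "dlm i"] by (simp add: dep_dlm)
      also have "(\<Prod>n<Suc i. mon (lunit n) powi lexp (dlm i) n) = (\<Prod>n<Suc i. mon (lunit n))"
        by (rule prod.cong) auto
      finally have d: "mon (dlm i) = mon (zm (-1)) * (\<Prod>n<Suc i. mon (lunit n))" .
      have "T (mon (dlm i)) = T' (mon (dlm i))"
        unfolding d T(2) T'(2) hom_prod[OF T(2,3)] hom_prod[OF T'(2,3)] z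
        by (intro arg_cong2[of _ _ _ _ "(*)"] refl prod.cong pl) auto
      then have "td (T ?x - T' ?x) = 0"
        by (simp add: td_diff T(4) T'(4) td_minus_lunit_Suc slin_uminus[OF T(1)] slin_uminus[OF T'(1)])
      then have "T ?x - T' ?x = 0" using l by (rule td_eq_0)
      then show ?thesis using Suc by simp
    qed
  qed
  fix m assume "fd m"
  then obtain k where k: "dep k m" by (auto simp: fd_def)
  have pl: "T (mon (lunit j)) = T' (mon (lunit j))" for j
    using ml[of j] hom_inverse[OF T(2,3), of "mon (- lunit j)"] hom_inverse[OF T'(2,3), of "mon (- lunit j)"]
    by (simp add: inv)
  show "T (mon m) = T' (mon m)"
    unfolding mon_factor[OF k] T(2) T'(2) hom_prod[OF T(2,3)] hom_prod[OF T'(2,3)] z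
    by (intro arg_cong2[of _ _ _ _ "(*)"] refl prod.cong)
      (simp add: hom_powi[OF T(2,3)] hom_powi[OF T'(2,3)] pl)
qed

lemma tBin_Exp_Ln: "small e \<Longrightarrow> tBin q e = tExp (q *\<^sub>R tLn e)"
  using tBin_tExp[OF small_tLn, of e q] tExp_tLn[of e] by simp

lemma tcomp_fev: assumes "0 < p" "small e" "small x" shows "tcomp p e (fev F x) = fev F (tcomp p e x)"
  by (rule slin_fev[OF slin_tcomp[OF assms(1,2)] tcomp_mult[OF assms(1,2)] tcomp_one[OF assms(1,2)] assms(3) small_tcomp[OF assms]])

text \<open>Passing to logarithms, log(1 + c) = p log(1 + b) + log(1 + a) o g for g = z^q (1 + b).
  This relation gives the agreement on powers of z and on log z; in the chain rule both sides have
  the derivative of the composite as factor.\<close>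

lemma tcomp_comp:
  assumes p: "0 < p" "small a" and q: "0 < q" "small b"
    and c: "tcomp q b (mon (zm p) * (1 + a)) = mon (zm (p * q)) * (1 + c)" "small c"
  shows "tcomp q b (tcomp p a x) = tcomp (p * q) c x"
proof -
  note sC = slin_tcomp[OF q] and mC = tcomp_mult[OF q] and oC = tcomp_one[OF q]
  have pq: "0 < p * q" using p q by simp
  have Ca: "small (tcomp q b a)" by (rule small_tcomp[OF q p(2)])
  have "mon (zm (p * q)) * (1 + c) = mon (zm (p * q)) * (tBin p b * (1 + tcomp q b a))"
    unfolding c(1)[symmetric] mC tcomp_zm[OF q] slin_add[OF sC] oC by (simp add: mult_ac)
  then have "1 + c = tBin p b * (1 + tcomp q b a)" by simp
  also have "\<dots> = tExp (p *\<^sub>R tLn b + tLn (tcomp q b a))"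
    using q p Ca by (simp add: tBin_Exp_Ln tExp_add small_scaleR small_tLn tExp_tLn)
  finally have c': "1 + c = tExp (p *\<^sub>R tLn b + tLn (tcomp q b a))" .
  have sL: "small (p *\<^sub>R tLn b + tLn (tcomp q b a))"
    by (intro small_add small_scaleR small_tLn q Ca)
  have lnc: "tLn c = p *\<^sub>R tLn b + tLn (tcomp q b a)"
    using tLn_tExp[OF sL] by (simp flip: c')
  show ?thesis
  proof (rule substitution_unique[where T = "\<lambda>x. tcomp q b (tcomp p a x)" and T' = "tcomp (p * q) c" and w = "td (mon (zm (p * q)) * (1 + c))"])
    show "slin (\<lambda>x. tcomp q b (tcomp p a x))" by (rule slin_comp[OF sC slin_tcomp[OF p]])
    show "slin (tcomp (p * q) c)" by (rule slin_tcomp[OF pq c(2)])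
    show "tcomp q b (tcomp p a (x * y)) = tcomp q b (tcomp p a x) * tcomp q b (tcomp p a y)" for x y by (simp add: tcomp_mult p q)
    show "tcomp (p * q) c (x * y) = tcomp (p * q) c x * tcomp (p * q) c y" for x y by (rule tcomp_mult[OF pq c(2)])
    show "tcomp q b (tcomp p a 1) = 1" "tcomp (p * q) c 1 = 1" by (simp_all add: tcomp_one p q pq c(2))
    show "td (tcomp (p * q) c x) = tcomp (p * q) c (td x) * td (mon (zm (p * q)) * (1 + c))" for x
      by (rule td_tcomp[OF pq c(2)])
    show "td (tcomp q b (tcomp p a x)) = tcomp q b (tcomp p a (td x)) * td (mon (zm (p * q)) * (1 + c))" for x
    proof -
      have "td (tcomp q b (tcomp p a x)) = tcomp q b (tcomp p a (td x)) * (tcomp q b (td (mon (zm p) * (1 + a))) * td (mon (zm q) * (1 + b)))"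
        unfolding td_tcomp[OF q] td_tcomp[OF p] mC by (simp only: mult.assoc)
      then show ?thesis unfolding td_tcomp[OF q, symmetric] c(1) .
    qed
    show "tcomp q b (tcomp p a (mon (zm r))) = tcomp (p * q) c (mon (zm r))" for r
    proof -
      have "tcomp q b (tcomp p a (mon (zm r))) = mon (zm (q * (p * r))) * tBin (p * r) b * tBin r (tcomp q b a)"
        unfolding tcomp_zm[OF p] mC tcomp_zm[OF q] tBin_def tcomp_fev[OF q p(2)] ..
      also have "tBin (p * r) b = tExp (r *\<^sub>R (p *\<^sub>R tLn b))" by (simp add: tBin_Exp_Ln q mult.commute)
      also have "tBin r (tcomp q b a) = tExp (r *\<^sub>R tLn (tcomp q b a))" by (simp add: tBin_Exp_Ln Ca)
      also have "mon (zm (q * (p * r))) * tExp (r *\<^sub>R (p *\<^sub>R tLn b)) * tExp (r *\<^sub>R tLn (tcomp q b a))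
          = mon (zm (q * (p * r))) * tExp (r *\<^sub>R tLn c)"
        unfolding mult.assoc lnc scaleR_add_right
        by (subst tExp_add) (auto intro!: small_scaleR small_tLn q Ca)
      also have "\<dots> = tcomp (p * q) c (mon (zm r))"
        unfolding tcomp_zm[OF pq c(2)] tBin_Exp_Ln[OF c(2)] by (simp add: mult_ac)
      finally show ?thesis .
    qed
    show "tcomp q b (tcomp p a (mon (- lunit 0))) = tcomp (p * q) c (mon (- lunit 0))"
    proof -
      have "tcomp q b (tLn a) = tLn (tcomp q b a)" unfolding tLn_def by (rule tcomp_fev[OF q p(2)])
      then show ?thesis
        unfolding tcomp_minus_lunit_0[OF p] tcomp_minus_lunit_0[OF pq c(2)] slin_diff[OF sC] slin_scaleR[OF sC] tcomp_minus_lunit_0[OF q] lnc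
        by (simp add: algebra_simps)
    qed
    show "small (tcomp q b (tcomp p a (mon (- lunit (Suc j)))) - tcomp (p * q) c (mon (- lunit (Suc j))))" for j
    proof -
      let ?x = "mon (- lunit (Suc j))"
      obtain d1 where d1: "small d1" "tcomp p a ?x = ?x - of_real (ln (rS p j)) + d1" using tcomp_minus_lunit_Suc[OF p] .
      obtain d2 where d2: "small d2" "tcomp q b ?x = ?x - of_real (ln (rS q j)) + d2" using tcomp_minus_lunit_Suc[OF q] .
      obtain d3 where d3: "small d3" "tcomp (p * q) c ?x = ?x - of_real (ln (rS (p * q) j)) + d3" using tcomp_minus_lunit_Suc[OF pq c(2)] .
      \<comment> \<open>The constants of the two substitutions add up to that of the composite, so
        only infinitesimals are left in the difference.\<close>
      have "ln (rS (p * q) j) = ln (rS p j) + ln (rS q j)"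
        using p q by (simp add: rS_def ln_div ln_mult)
      moreover have "tcomp q b (of_real r) = of_real r" for r
        by (simp add: of_real_def slin_scaleR[OF sC] oC)
      moreover from this have "tcomp q b (tcomp p a ?x) = ?x - of_real (ln (rS q j)) + d2 - of_real (ln (rS p j)) + tcomp q b d1"
        by (simp only: d1(2) slin_add[OF sC] slin_diff[OF sC] d2(2))
      ultimately have "tcomp q b (tcomp p a ?x) - tcomp (p * q) c ?x = d2 + tcomp q b d1 - d3"
        unfolding d3(2) by simp
      then show ?thesis using d1(1) d2(1) d3(1) small_tcomp[OF q d1(1)] by (simp only: small_add small_diff)
    qed
  qed
qed

section \<open>Triangular strongly linear equations\<close>

lemma cf_slin_sum:
  assumes T: "slin T" and N: "finite N" "\<And>a. a \<in> sp x \<Longrightarrow> a \<notin> N \<Longrightarrow> cf (T (mon a)) c = 0"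
  shows "cf (T x) c = (\<Sum>a\<in>N. cf x a * cf (T (mon a)) c)"
proof -
  have "cf (hsum (\<lambda>m. cf x m *\<^sub>R T (mon m)) UNIV) c = (\<Sum>a\<in>N. cf (cf x a *\<^sub>R T (mon a)) c)"
    by (rule cf_hsum_sum[OF slinD(2)[OF T] N(1)]) (use N(2) in \<open>auto simp: sp_def\<close>)
  then show ?thesis using slinD(3)[OF T, of x] by simp
qed

lemma wf_adm: assumes "adm W" shows "wf {(v,w). v \<in> W \<and> w \<in> W \<and> v < w}"
proof (rule wfI_min)
  fix x and Q :: "lmon set" assume x: "x \<in> Q"
  show "\<exists>z\<in>Q. \<forall>y. (y, z) \<in> {(v,w). v \<in> W \<and> w \<in> W \<and> v < w} \<longrightarrow> y \<notin> Q"
  proof (cases "Q \<inter> W = {}")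
    case True then show ?thesis using x by blast
  next
    case False
    then obtain m where m: "m \<in> Q \<inter> W" "\<forall>a\<in>Q \<inter> W. m \<le> a"
      using assms[unfolded adm_def well_ordered_def, THEN conjunct1, rule_format, of "Q \<inter> W"] by auto
    then have "y \<notin> Q" if "y \<in> W" "y < m" for y using that leD[of m y] by blast
    then show ?thesis using m(1) by (intro bexI[of _ m]) auto
  qed
qed

text \<open>The coefficient of the solution at \<open>w\<close> is found from the equation at
  \<open>sig p w\<close>: summability leaves finitely many contributing \<open>v\<close>, and
  triangularity forces \<open>v \<le> w\<close>. The scaling \<open>p\<close> places the diagonal:
  it is 1 where \<open>m\<close> itself leads the image of \<open>mon m\<close>, and \<alpha> where
  the substituted monomial does.\<close>

lemma triangular_solve:
  assumes T: "slin T" and W: "adm W" and p: "0 < p"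
    and sub: "\<And>m. m \<in> W \<Longrightarrow> sp (T (mon m)) \<subseteq> sig p ` W"
    and diag: "\<And>m. m \<in> W \<Longrightarrow> cf (T (mon m)) (sig p m) \<noteq> 0"
    and tri: "\<And>m c. m \<in> W \<Longrightarrow> c \<in> sp (T (mon m)) \<Longrightarrow> sig p m \<le> c"
    and g: "sp g \<subseteq> sig p ` W"
  obtains y where "sp y \<subseteq> W" "T y = g"
proof -
  define R where "R = {(v,w). v \<in> W \<and> w \<in> W \<and> v < w}"
  have wfR: "wf R" unfolding R_def by (rule wf_adm[OF W])
  define K where "K w = {v \<in> W. cf (T (mon v)) (sig p w) \<noteq> 0}" for w
  have K: "finite (K w)" for w
    using hsummableD(2)[OF slinD(1)[OF T W]] by (simp add: K_def)
  have K_le: "v \<le> w" if "v \<in> K w" for v w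
    using tri[of v "sig p w"] that sig_le[OF p] by (auto simp: K_def sp_def)
  \<comment> \<open>Solves the equation at \<open>sig p w\<close> for the unknown at
    \<open>w\<close>, given the values \<open>rec\<close> at smaller monomials.\<close>
  define F where "F rec w = (cf g (sig p w) - (\<Sum>v\<in>K w - {w}. rec v * cf (T (mon v)) (sig p w))) / cf (T (mon w)) (sig p w)" for rec :: "lmon \<Rightarrow> real" and w
  define r where "r = wfrec R F"
  have r: "r w = F r w" if w: "w \<in> W" for w
  proof -
    have "r w = F (cut r R w) w" unfolding r_def by (rule wfrec[OF wfR])
    also have "\<dots> = F r w"
    proof -
      have "cut r R w v = r v" if "v \<in> K w - {w}" for v
        using that K_le[of v w] w by (intro cut_apply) (auto simp: R_def K_def)
      then show ?thesis by (simp add: F_def)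
    qed
    finally show ?thesis .
  qed
  define y where "y = Abs_ts (\<lambda>w. if w \<in> W then r w else 0)"
  have cfy: "cf y w = (if w \<in> W then r w else 0)" for w
    unfolding y_def by (subst cf_Abs'[OF W]) auto
  have sy: "sp y \<subseteq> W" by (auto simp: sp_def cfy split: if_splits)
  have "T y = g"
  proof (rule ts_eqI)
    fix c
    show "cf (T y) c = cf g c"
    proof (cases "c \<in> sig p ` W")
      case False
      have "sp (T y) \<subseteq> sig p ` W" by (rule sp_slin[OF T]) (use sy sub in blast)
      then have "c \<notin> sp (T y)" "c \<notin> sp g" using False g by blast+
      then show ?thesis by (simp add: notin_sp)
    next
      case True
      then obtain w where w: "w \<in> W" "c = sig p w" by blast
      have wK: "w \<in> K w" using diag[OF w(1)] w by (simp add: K_def)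
      have "cf (T y) c = (\<Sum>a\<in>K w. cf y a * cf (T (mon a)) c)"
        by (rule cf_slin_sum[OF T K]) (use sy w in \<open>auto simp: K_def\<close>)
      also have "\<dots> = cf y w * cf (T (mon w)) c + (\<Sum>a\<in>K w - {w}. cf y a * cf (T (mon a)) c)"
        by (rule sum.remove[OF K wK])
      also have "(\<Sum>a\<in>K w - {w}. cf y a * cf (T (mon a)) c) = (\<Sum>a\<in>K w - {w}. r a * cf (T (mon a)) c)"
        by (rule sum.cong) (auto simp: cfy K_def)
      also have "cf y w * cf (T (mon w)) c = cf g c - (\<Sum>a\<in>K w - {w}. r a * cf (T (mon a)) c)"
        using r[OF w(1)] w diag[OF w(1)] by (simp add: cfy F_def)
      finally show ?thesis by simp
    qed
  qed
  with sy show thesis using that by blast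
qed

section \<open>Transseries with leading term a power of z\<close>

definition gen :: "real \<Rightarrow> ts \<Rightarrow> ts" where "gen p e = mon (zm p) * (1 + e)"

lemma gen_lead: assumes "small e" shows "gen p e \<noteq> 0" "ld (gen p e) = zm p" "lc (gen p e) = 1" "eps (gen p e) = e"
proof -
  have "gen p e = 1 *\<^sub>R (mon (zm p) * (1 + e))" by (simp add: gen_def)
  from ts_lead_unique[OF this _ zm_simps(4) assms]
  show "gen p e \<noteq> 0" "ld (gen p e) = zm p" "lc (gen p e) = 1" "eps (gen p e) = e" by simp_all
qed

lemma gen_0: "gen p 0 = mon (zm p)"
  by (simp add: gen_def)

lemma zpow_cf: "zpow p = cf (mon (zm p))"
  by (auto simp: zpow_def cf_mon_fd zm_def[symmetric])

lemma gen_diff: "gen p e - mon (zm p) = mon (zm p) * e"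
  by (simp add: gen_def distrib_left)

lemma one_plus_tExp: "small e \<Longrightarrow> gen p e = mon (zm p) * tExp (tLn e)"
  by (simp add: gen_def tExp_tLn)

lemma gen_tExp: assumes "small x" shows "mon (zm p) * tExp x = gen p (tExp x - 1)" "small (tExp x - 1)" "tLn (tExp x - 1) = x"
  using small_tExp[OF assms] tLn_tExp[OF assms] by (simp_all add: gen_def)

text \<open>In logarithmic form composition is affine: the logarithm of the inner factor enters with
  weight \<open>p\<close>, that of the outer one is composed. The telescoping of iterates rests on
  this.\<close>

lemma tcomp_gen_tExp:
  assumes "0 < q" "small b" "small x"
  shows "tcomp q b (mon (zm p) * tExp x) = mon (zm (p * q)) * tExp (p *\<^sub>R tLn b + tcomp q b x)"
proof -
  have "tcomp q b (mon (zm p) * tExp x) = mon (zm (q * p)) * tBin p b * tExp (tcomp q b x)"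
    by (simp add: tcomp_mult tcomp_zm assms tExp_def tcomp_fev)
  also have "\<dots> = mon (zm (p * q)) * tExp (p *\<^sub>R tLn b + tcomp q b x)"
    using assms by (simp add: tBin_Exp_Ln tExp_add small_scaleR small_tLn small_tcomp mult.commute mult.left_commute)
  finally show ?thesis .
qed

lemma tcomp_gen:
  assumes "0 < q" "small b" "small a"
  obtains c where "small c" "tcomp q b (gen p a) = gen (p * q) c" "tLn c = p *\<^sub>R tLn b + tcomp q b (tLn a)"
proof -
  let ?x = "p *\<^sub>R tLn b + tcomp q b (tLn a)"
  have x: "small ?x" using assms by (intro small_add small_scaleR small_tLn small_tcomp)
  have "tcomp q b (gen p a) = gen (p * q) (tExp ?x - 1)"
    using tcomp_gen_tExp[OF assms(1,2) small_tLn[OF assms(3)], of p] gen_tExp(1)[OF x] one_plus_tExp[OF assms(3), of p] by simp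
  then show thesis using that gen_tExp(2,3)[OF x] by blast
qed

lemma tcomp_comp_gen:
  assumes "0 < p" "small a" "0 < q" "small b" "tcomp q b (gen p a) = gen (p * q) c" "small c"
  shows "tcomp q b (tcomp p a x) = tcomp (p * q) c x"
  using tcomp_comp[OF assms(1-4) assms(5)[unfolded gen_def] assms(6)] .

lemma cf_comp: "0 < p \<Longrightarrow> small e \<Longrightarrow> cf x \<circ>\<^sub>t cf (gen p e) = cf (tcomp p e x)"
  unfolding gen_def by (rule cf_tcomp)

text \<open>Compositional inverses: solve \<open>y \<circ> \<phi> = z\<close>, which is linear in \<open>y\<close>.\<close>

lemma inverse_exists:
  assumes e: "small e"
  obtains e' where "small e'" "tcomp 1 e (gen 1 e') = gen 1 0" "tcomp 1 e' (gen 1 e) = gen 1 0"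
proof -
  have left: "\<exists>e'. small e' \<and> tcomp 1 e (gen 1 e') = gen 1 0" if e: "small e" for e
  proof -
    obtain k where k: "\<And>a. a \<in> sp e \<Longrightarrow> dep k a" using adm_dep[OF adm_sp] by blast
    define M where "M = Emon k + mgen (sp e)"
    have mM: "adm (mgen (sp e))" using e by (intro adm_mgen) (auto simp: small_def)
    have M: "adm M" unfolding M_def by (intro adm_plus mM) auto
    have M0: "0 \<in> M" unfolding M_def using set_plus_intro[of 0 "Emon k" 0 "mgen (sp e)"] by simp
    have MM: "a + b \<in> M" if "a \<in> M" "b \<in> M" for a b
    proof -
      from that obtain a1 a2 b1 b2 where "a1 \<in> Emon k" "b1 \<in> Emon k" "a2 \<in> mgen (sp e)" "b2 \<in> mgen (sp e)"
        "a = a1 + a2" "b = b1 + b2" unfolding M_def by (auto elim!: set_plus_elim)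
      moreover from this have "(a1 + b1) + (a2 + b2) \<in> M" unfolding M_def by (intro set_plus_intro Emon_add mgen_add)
      ultimately show ?thesis by (simp add: add_ac)
    qed
    \<comment> \<open>A translate of a monoid that absorbs all corrections of composition with
      \<phi>, so that the operator preserves support in \<open>W\<close> and the triangular solution
      stays inside it.\<close>
    define W where "W = {zm 1} + M"
    have W: "adm W" unfolding W_def by (intro adm_plus M) auto
    have dW: "dep k m" if "m \<in> W" for m
      using that k unfolding W_def M_def by (auto elim!: set_plus_elim intro!: dep_simps simp: Emon_def dep_mgen)
    have id: "sig 1 ` A = A" for A by force
    obtain y where y: "sp y \<subseteq> W" "tcomp 1 e y = mon (zm 1)"
    proof (rule triangular_solve[OF slin_tcomp[OF zero_less_one e] W zero_less_one])
      fix m assume m: "m \<in> W"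
      show "cf (tcomp 1 e (mon m)) (sig 1 m) \<noteq> 0"
        using cf_tcomp_lead_mon[OF zero_less_one e fdI[OF dW[OF m]]] by simp
      show "sig 1 m \<le> c" if "c \<in> sp (tcomp 1 e (mon m))" for c
        by (rule tcomp_mon_ge[OF zero_less_one e fdI[OF dW[OF m]] that])
      show "sp (tcomp 1 e (mon m)) \<subseteq> sig 1 ` W"
      proof
        fix c assume "c \<in> sp (tcomp 1 e (mon m))"
        then have "c \<in> {m} + M" using sp_tcomp_mon[OF zero_less_one e dW[OF m]] by (auto simp: M_def)
        then obtain d where d: "d \<in> M" "c = m + d" by (auto simp: set_plus_def)
        obtain d' where "d' \<in> M" "m = zm 1 + d'" using m by (auto simp: W_def set_plus_def)
        then have "c = zm 1 + (d' + d)" "d' + d \<in> M" using d MM by (auto simp: add_ac)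
        then show "c \<in> sig 1 ` W" unfolding id W_def by (auto simp: set_plus_def)
      qed
    next
      show "sp (mon (zm 1)) \<subseteq> sig 1 ` W" unfolding id W_def using M0 by (auto simp: sp_mon set_plus_def)
    qed
    have y0: "y \<noteq> 0" using y(2) by (auto simp: slin_0[OF slin_tcomp[OF zero_less_one e]])
    have l: "ld (tcomp 1 e y) = zm 1" "lc (tcomp 1 e y) = 1" using gen_lead[OF small_0, of 1] by (simp_all add: y(2) gen_0)
    have "ld y = zm 1" using tcomp_lead(3)[OF zero_less_one e y0] l by simp
    moreover have "lc y = 1" using tcomp_lead(1,3)[OF zero_less_one e y0] l by (simp add: lc_def)
    ultimately have "y = gen 1 (eps y)" using ts_decomp[OF y0] by (simp add: gen_def)
    then show ?thesis using small_eps[OF y0] y(2) by (intro exI[of _ "eps y"]) (simp add: gen_0)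
  qed
  obtain e' where e': "small e'" "tcomp 1 e (gen 1 e') = gen 1 0" using left[OF e] by blast
  obtain c where c: "small c" "tcomp 1 e' (gen 1 e) = gen (1 * 1) c" using tcomp_gen[OF zero_less_one e'(1) e] .
  have "tcomp 1 e (tcomp 1 e' x) = x" for x
    using tcomp_comp_gen[OF zero_less_one e'(1) zero_less_one e, of 0 x] e'(2) by (simp add: tcomp_id)
  \<comment> \<open>A one-sided inverse is two-sided: \<phi> o \<phi>' o \<phi> equals \<phi> = z o
    \<phi>, and right composition with \<phi> is injective.\<close>
  then have "tcomp 1 e (tcomp 1 e' (gen 1 e)) = gen 1 e" .
  also have "gen 1 e = tcomp 1 e (gen 1 0)"
    using tcomp_zm[OF zero_less_one e, of 1] by (simp add: gen_0 gen_def tBin_def fps_binomial_1 fev_add fev_1 fev_X e)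
  finally have "tcomp 1 e' (gen 1 e) = gen 1 0" by (rule tcomp_inj[OF zero_less_one e])
  with e' show thesis using that by blast
qed

section \<open>The linear normalization equation\<close>

text \<open>For \<open>\<phi> = z exp \<psi>\<close> and \<open>f = z\<^sup>\<alpha> exp \<eta>\<close>, the equation \<open>\<phi> \<circ> f = \<phi>\<^sup>\<alpha>\<close> becomes the linear
  equation \<open>\<alpha> \<psi> - \<psi> \<circ> f = \<eta>\<close>.\<close>

lemma normalization_linear:
  assumes "0 < \<alpha>" "small e" "small u"
  shows "tcomp \<alpha> e (gen 1 u) = tcomp 1 u (mon (zm \<alpha>)) \<longleftrightarrow> \<alpha> *\<^sub>R tLn u - tcomp \<alpha> e (tLn u) = tLn e"
proof -
  have "tcomp \<alpha> e (gen 1 u) = mon (zm \<alpha>) * tExp (tLn e + tcomp \<alpha> e (tLn u))"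
    using tcomp_gen_tExp[OF assms(1,2) small_tLn[OF assms(3)], of 1] by (simp add: one_plus_tExp assms)
  moreover have "tcomp 1 u (mon (zm \<alpha>)) = mon (zm \<alpha>) * tExp (\<alpha> *\<^sub>R tLn u)"
    using assms by (simp add: tcomp_zm tBin_Exp_Ln)
  ultimately have "tcomp \<alpha> e (gen 1 u) = tcomp 1 u (mon (zm \<alpha>)) \<longleftrightarrow> tExp (tLn e + tcomp \<alpha> e (tLn u)) = tExp (\<alpha> *\<^sub>R tLn u)"
    by simp
  also have "\<dots> \<longleftrightarrow> tLn e + tcomp \<alpha> e (tLn u) = \<alpha> *\<^sub>R tLn u"
    using tExp_inj[of "tLn e + tcomp \<alpha> e (tLn u)" "\<alpha> *\<^sub>R tLn u"] assms
    by (auto intro: small_add small_scaleR small_tLn small_tcomp)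
  also have "\<dots> \<longleftrightarrow> \<alpha> *\<^sub>R tLn u - tcomp \<alpha> e (tLn u) = tLn e" by (auto simp: algebra_simps)
  finally show ?thesis .
qed

text \<open>Positivity at z-exponent 0 is decided by the first nonzero logarithmic exponent. This
  excludes exponent -1 of l_1, at which the diagonal entry would vanish.\<close>

lemma lexp0_nonneg: assumes "0 < m" "zexp m = 0" shows "0 \<le> lexp m 0"
proof -
  obtain i where i: "0 < lexp m i" "\<And>j. j < i \<Longrightarrow> lexp m j = 0" using assms by (auto simp: less_lmon_def)
  then show ?thesis by (cases i) auto
qed

lemma diag_nonzero:
  assumes "0 < \<alpha>" "\<alpha> \<noteq> 1" "0 \<le> n" shows "\<alpha> - \<alpha> powi (- n) \<noteq> (0::real)"
proof
  assume "\<alpha> - \<alpha> powi (- n) = 0"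
  moreover have "\<alpha> powi (- n) = inverse (\<alpha> ^ nat n)"
    unfolding power_int_minus using assms(3) by (simp add: power_int_def)
  ultimately have "\<alpha> * \<alpha> ^ nat n = inverse (\<alpha> ^ nat n) * \<alpha> ^ nat n" by (metis eq_iff_diff_eq_0)
  then have "\<alpha> ^ Suc (nat n) = 1" using assms(1) by simp
  then show False using assms(1,2) power_eq_1_iff[of \<alpha> "Suc (nat n)"] by (metis power_eq_imp_eq_base less_imp_le power_one zero_le_one zero_less_Suc)
qed

text \<open>Comparing leading monomials forces z-exponent 0, where comparing leading coefficients
  would make the diagonal entry vanish.\<close>

lemma linear_unique:
  assumes "0 < \<alpha>" "\<alpha> \<noteq> 1" "small e" "small x" "\<alpha> *\<^sub>R x = tcomp \<alpha> e x" shows "x = 0"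
proof (rule ccontr)
  assume x: "x \<noteq> 0"
  have 1: "\<alpha> *\<^sub>R x \<noteq> 0" using x assms(1) by simp
  have "sp (\<alpha> *\<^sub>R x) = sp x" using assms(1) by (auto simp: sp_def)
  then have "ld (\<alpha> *\<^sub>R x) = ld x" by (simp add: ld_def lead_def)
  then have "ld x = sig \<alpha> (ld x)" using tcomp_lead(3)[OF assms(1,3) x] assms(5) by simp
  then have s: "sig \<alpha> (ld x) = ld x" by (rule sym)
  then have z: "zexp (ld x) = 0" using assms(2) by (metis mult_cancel_right1 sig_simps(1))
  have "\<alpha> * lc x = lc x * \<alpha> powi (- lexp (ld x) 0)"
    using tcomp_lead(1)[OF assms(1,3) x] s assms(5) by (metis cf_simps(5) lc_def)
  then have "\<alpha> - \<alpha> powi (- lexp (ld x) 0) = 0" using lc_nonzero[OF x] by (simp add: mult.commute)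
  moreover have "0 \<le> lexp (ld x) 0" using z smallD[OF assms(4) ld_in[OF x]] by (intro lexp0_nonneg)
  ultimately show False using diag_nonzero[OF assms(1,2)] by blast
qed

definition orb :: "real \<Rightarrow> lmon set \<Rightarrow> lmon set" where
  "orb q A = {sig (q ^ m) a | m a. a \<in> A}"

text \<open>With q > 1, scaling a positive monomial by a higher power of q does not decrease it. So
  a good pair for the powers, taken inside a subsequence with increasing base monomials, is a good
  pair of the orbit.\<close>

lemma adm_orb: assumes q: "1 < q" and A: "adm A" "\<And>a. a \<in> A \<Longrightarrow> 0 < a" shows "adm (orb q A)"
  unfolding adm_def
proof
  obtain k where k: "\<And>a. a \<in> A \<Longrightarrow> dep k a" using adm_dep[OF A(1)] by blast
  then show "\<exists>k. \<forall>a\<in>orb q A. dep k a" by (intro exI[of _ k]) (auto simp: orb_def)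
  have wo: "well_ordered A" using A(1) by (simp add: adm_def)
  show "well_ordered (orb q A)"
    unfolding wo_iff_good
  proof (intro allI impI)
    fix s :: "nat \<Rightarrow> lmon" assume s: "\<forall>i. s i \<in> orb q A"
    then have "\<forall>i. \<exists>p. snd p \<in> A \<and> s i = sig (q ^ fst p) (snd p)" by (fastforce simp: orb_def)
    then obtain p where p: "\<And>i. snd (p i) \<in> A" "\<And>i. s i = sig (q ^ fst (p i)) (snd (p i))" by metis
    obtain r :: "nat \<Rightarrow> nat" where r: "strict_mono r" "\<And>i j. i \<le> j \<Longrightarrow> snd (p (r i)) \<le> snd (p (r j))"
      using wo_incseq[OF wo, of "\<lambda>i. snd (p i)"] p by blast
    have "\<exists>i j. i < j \<and> fst (p (r i)) \<le> fst (p (r j))"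
    proof (rule ccontr)
      assume "\<not> ?thesis"
      then have "fst (p (r (Suc n))) < fst (p (r n))" for n by (metis lessI not_le)
      then have "\<exists>f. \<forall>n. (f (Suc n), f n) \<in> less_than" by (intro exI[of _ "\<lambda>n. fst (p (r n))"]) simp
      then show False using wf_less_than unfolding wf_iff_no_infinite_down_chain by blast
    qed
    then obtain i j where ij: "i < j" "fst (p (r i)) \<le> fst (p (r j))" by blast
    let ?a = "snd (p (r i))" and ?b = "snd (p (r j))"
    have ab: "?a \<le> ?b" using r(2) ij by simp
    have "0 \<le> ?b" using A(2)[OF p(1)] by (rule less_imp_le)
    then have zb: "0 \<le> zexp ?b" by (rule zexp_nonneg)
    have "s (r i) \<le> sig (q ^ fst (p (r i))) ?b" unfolding p(2) using ab q by (simp add: sig_le)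
    also have "\<dots> \<le> s (r j)"
    proof (cases "zexp ?b = 0")
      case True
      then have "sig (q ^ fst (p (r i))) ?b = s (r j)" unfolding p(2) by (intro lmon_eqI) auto
      then show ?thesis by simp
    next
      case False
      have "q ^ fst (p (r i)) \<le> q ^ fst (p (r j))" using q ij by (intro power_increasing) auto
      then have "q ^ fst (p (r i)) * zexp ?b \<le> q ^ fst (p (r j)) * zexp ?b" using zb by (rule mult_right_mono)
      then consider "q ^ fst (p (r i)) * zexp ?b < q ^ fst (p (r j)) * zexp ?b" | "q ^ fst (p (r i)) * zexp ?b = q ^ fst (p (r j)) * zexp ?b"
        by linarith
      then show ?thesis
      proof cases
        case 1 then show ?thesis unfolding p(2) by (auto simp: less_eq_lmon_def less_lmon_def)
      next
        case 2
        then have "sig (q ^ fst (p (r i))) ?b = s (r j)" unfolding p(2) by (intro lmon_eqI) auto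
        then show ?thesis by simp
      qed
    qed
    finally show "\<exists>i j. i < j \<and> s i \<le> s j" using ij r(1) strict_monoD by blast
  qed
qed

text \<open>Closed under addition and under scaling by \<open>q\<close>, and large enough to contain
  all corrections of composition; hence stable under the recursion for \<psi>. Its generators
  reappear in the support claim.\<close>

definition Gm :: "nat \<Rightarrow> real \<Rightarrow> lmon set \<Rightarrow> lmon set" where
  "Gm k q A = mgen ({lunit i | i. i < k} \<union> orb q A)"

lemma orb_pos: "1 < q \<Longrightarrow> (\<And>a. a \<in> A \<Longrightarrow> 0 < a) \<Longrightarrow> b \<in> orb q A \<Longrightarrow> 0 < b"
  by (auto simp: orb_def intro!: sig_pos)

lemma adm_Gm: assumes "1 < q" "adm A" "\<And>a. a \<in> A \<Longrightarrow> 0 < a" shows "adm (Gm k q A)"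
  unfolding Gm_def
proof (rule adm_mgen)
  have "finite {lunit i | i. i < k}" by simp
  then have "adm {lunit i | i. i < k}" unfolding adm_def using wo_finite dep_lunit by blast
  then show "adm ({lunit i | i. i < k} \<union> orb q A)" using adm_orb[OF assms] by (intro adm_un)
qed (use orb_pos[of q A] assms in auto)

lemma Gm_nonneg: "1 < q \<Longrightarrow> (\<And>a. a \<in> A \<Longrightarrow> 0 < a) \<Longrightarrow> c \<in> Gm k q A \<Longrightarrow> 0 \<le> c"
  unfolding Gm_def using orb_pos[of q A] by (intro mgen_nonneg) auto

lemma Gm_dep: "(\<And>a. a \<in> A \<Longrightarrow> dep k a) \<Longrightarrow> c \<in> Gm k q A \<Longrightarrow> dep k c"
  unfolding Gm_def by (erule dep_mgen) (auto simp: orb_def dep_lunit)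

lemma Gm_add: "a \<in> Gm k q A \<Longrightarrow> b \<in> Gm k q A \<Longrightarrow> a + b \<in> Gm k q A"
  unfolding Gm_def by (rule mgen_add)

lemma Gm_Emon: "Emon k \<subseteq> Gm k q A"
  unfolding Gm_def using Emon_subset mgen_mono[of "{lunit i | i. i < k}"] by blast

lemma Gm_mgen: "mgen A \<subseteq> Gm k q A"
proof -
  have "A \<subseteq> orb q A" by (auto simp: orb_def intro: exI[of _ 0])
  then show ?thesis unfolding Gm_def by (intro mgen_mono) auto
qed

lemma Gm_sig: "c \<in> Gm k q A \<Longrightarrow> sig q c \<in> Gm k q A"
  unfolding Gm_def
proof (induction rule: mgen_induct)
  case (add a b)
  have "sig q a \<in> {lunit i | i. i < k} \<union> orb q A"
  proof (cases "a \<in> orb q A")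
    case True
    then obtain m a' where "a' \<in> A" "a = sig (q ^ m) a'" by (auto simp: orb_def)
    then have "sig q a = sig (q ^ Suc m) a'" by (simp add: sig_sig)
    then show ?thesis using \<open>a' \<in> A\<close> unfolding orb_def by blast
  next
    case False
    then obtain i where "i < k" "a = lunit i" using add by blast
    then show ?thesis using sig_Emon[OF lunit_Emon[of i k], of q] by auto
  qed
  then show ?case using add by (simp add: sig_add mgen_add mgen_base)
qed simp

lemma mgen_zexp:
  assumes "c \<in> mgen A" "c \<noteq> 0" "\<And>a. a \<in> A \<Longrightarrow> 0 < a" "\<And>a. a \<in> A \<Longrightarrow> \<delta> \<le> zexp a"
  shows "\<delta> \<le> zexp c"
proof -
  have "c = 0 \<or> \<delta> \<le> zexp c" using assms(1)
  proof (induction rule: mgen_induct)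
    case (add a b)
    have "0 \<le> zexp b" using add assms(3) by (intro zexp_nonneg mgen_nonneg[of b A])
    then show ?case using assms(4)[of a] add by simp
  qed simp
  then show ?thesis using assms(2) by blast
qed

text \<open>The bound \<delta> on z-exponents is carried through the recursion, as it is stable
  under adding corrections and under scaling by q > 1; it yields the estimate of
  \<open>ord_z\<close>. The two cases differ in the monomial that leads the image of
  \<open>mon m\<close>.\<close>

lemma linear_solve:
  assumes \<alpha>: "0 < \<alpha>" "\<alpha> \<noteq> 1" and e: "small e" "\<And>a. a \<in> sp e \<Longrightarrow> dep k a"
    and \<delta>: "0 \<le> \<delta>" "\<And>a. a \<in> sp e \<Longrightarrow> \<delta> \<le> zexp a" and q: "q = (if 1 < \<alpha> then \<alpha> else 1 / \<alpha>)"
  obtains \<psi> where "small \<psi>" "\<alpha> *\<^sub>R \<psi> - tcomp \<alpha> e \<psi> = tLn e" "sp \<psi> \<subseteq> Gm k q (sp e)" "\<And>a. a \<in> sp \<psi> \<Longrightarrow> \<delta> \<le> zexp a"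
proof -
  have q1: "1 < q" using \<alpha> by (auto simp: q)
  have pe: "\<And>a. a \<in> sp e \<Longrightarrow> 0 < a" using e(1) by (simp add: small_def)
  define G where "G = Gm k q (sp e)"
  define W where "W = {w \<in> G. w \<noteq> 0 \<and> \<delta> \<le> zexp w}"
  have G: "adm G" unfolding G_def by (rule adm_Gm[OF q1 adm_sp pe])
  have W: "adm W" by (rule adm_subset[OF G]) (auto simp: W_def)
  have Gnn: "0 \<le> w" if "w \<in> G" for w using Gm_nonneg[OF q1 pe that[unfolded G_def]] .
  have Wpos: "0 < w" if "w \<in> W" for w using that Gnn[of w] by (auto simp: W_def)
  have dG: "dep k w" if "w \<in> G" for w using Gm_dep[OF e(2) that[unfolded G_def]] .
  have WG: "w + (a + b) \<in> W" if w: "w \<in> W" and a: "a \<in> Emon k" and b: "b \<in> mgen (sp e)" for w a b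
  proof -
    have ab: "a + b \<in> G" unfolding G_def using a b Gm_Emon Gm_mgen by (intro Gm_add) blast+
    then have nn: "0 \<le> a + b" by (rule Gnn)
    have "w + (a + b) \<in> G" using w ab Gm_add unfolding W_def G_def by blast
    moreover have "0 < w + (a + b)" using Wpos[OF w] nn by (rule add_pos_nonneg)
    moreover have "\<delta> \<le> zexp (w + (a + b))" using w zexp_nonneg[OF nn] by (simp add: W_def)
    ultimately show ?thesis by (auto simp: W_def)
  qed
  have Wsig: "sig q w \<in> W" if w: "w \<in> W" for w
  proof -
    have "0 \<le> zexp w" using Wpos[OF w] by (intro zexp_nonneg) simp
    then have "zexp w \<le> q * zexp w" using q1 mult_right_mono[of 1 q "zexp w"] by simp
    moreover have "0 < sig q w" using Wpos[OF w] q1 by (intro sig_pos) auto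
    ultimately show ?thesis using w Gm_sig[of w k q "sp e"] by (auto simp: W_def G_def)
  qed
  have eta: "sp (tLn e) \<subseteq> W"
  proof
    fix c assume c: "c \<in> sp (tLn e)"
    then have m: "c \<in> mgen (sp e)" using sp_tLn[OF e(1)] by blast
    have "0 < c" using small_tLn[OF e(1)] c by (simp add: small_def)
    moreover have "\<delta> \<le> zexp c" using mgen_zexp[OF m _ pe \<delta>(2)] \<open>0 < c\<close> by auto
    ultimately show "c \<in> W" using m Gm_mgen unfolding W_def G_def by auto
  qed
  define T where "T x = \<alpha> *\<^sub>R x - tcomp \<alpha> e x" for x
  have sC: "slin (tcomp \<alpha> e)" by (rule slin_tcomp[OF \<alpha>(1) e(1)])
  have T: "slin T" unfolding T_def[abs_def] by (rule slin_minus[OF slin_cmult[OF slin_id] sC])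
  have spT: "c = m \<or> c \<in> sp (tcomp \<alpha> e (mon m))" if "c \<in> sp (T (mon m))" for c m
    using that by (auto simp: T_def sp_def cf_mon split: if_splits)
  have cfT: "cf (T (mon m)) c = (if c = m then \<alpha> else 0) - cf (tcomp \<alpha> e (mon m)) c" if "fd m" for m c
    using that by (simp add: T_def cf_mon)
  have "\<exists>\<psi>. sp \<psi> \<subseteq> W \<and> T \<psi> = tLn e"
  proof (cases "1 < \<alpha>")
    case True
    \<comment> \<open>For \<alpha> > 1 the monomial \<open>m\<close> itself leads, as
      \<open>sig \<alpha> m\<close> is not smaller. The two coincide at z-exponent 0, where the
      diagonal entry combines both contributions.\<close>
    then have qa: "q = \<alpha>" by (simp add: q)
    have id: "sig 1 ` A = A" for A by force
    have le: "m \<le> sig \<alpha> m" if "m \<in> W" for m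
    proof -
      have nn: "0 \<le> zexp m" using Wpos[OF that] by (intro zexp_nonneg) simp
      show ?thesis
      proof (cases "zexp m = 0")
        case True
        then have "sig \<alpha> m = m" by (intro lmon_eqI) auto
        then show ?thesis by simp
      next
        case False
        then show ?thesis using nn \<open>1 < \<alpha>\<close> by (auto simp: less_eq_lmon_def less_lmon_def)
      qed
    qed
    show ?thesis
    proof (rule triangular_solve[OF T W zero_less_one])
      fix m assume m: "m \<in> W"
      then have k: "dep k m" using dG by (simp add: W_def)
      note fd = fdI[OF k]
      show "sp (T (mon m)) \<subseteq> sig 1 ` W"
      proof
        fix c assume "c \<in> sp (T (mon m))"
        then consider "c = m" | "c \<in> sp (tcomp \<alpha> e (mon m))" using spT by blast
        then show "c \<in> sig 1 ` W"
        proof cases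
          case 2
          then obtain a b where "a \<in> Emon k" "b \<in> mgen (sp e)" "c = sig \<alpha> m + (a + b)"
            using sp_tcomp_mon[OF \<alpha>(1) e(1) k] by (auto simp: set_plus_def)
          then show ?thesis using WG[OF Wsig[OF m]] qa id by simp
        qed (use m id in simp)
      qed
      show "sig 1 m \<le> c" if "c \<in> sp (T (mon m))" for c
        using spT[OF that] tcomp_mon_ge[OF \<alpha>(1) e(1) fd, of c] le[OF m] by auto
      show "cf (T (mon m)) (sig 1 m) \<noteq> 0"
      proof (cases "zexp m = 0")
        case z: True
        then have "sig \<alpha> m = m" by (intro lmon_eqI) auto
        then have "cf (T (mon m)) m = \<alpha> - \<alpha> powi (- lexp m 0)"
          using cf_tcomp_lead_mon[OF \<alpha>(1) e(1) fd] by (simp add: cfT[OF fd])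
        then show ?thesis using diag_nonzero[OF \<alpha> lexp0_nonneg[OF Wpos[OF m] z]] by simp
      next
        case z: False
        then have "sig \<alpha> m \<noteq> m" using \<alpha>(2) by (metis mult_cancel_right1 sig_simps(1))
        then have "m < sig \<alpha> m" using le[OF m] by simp
        then have "cf (tcomp \<alpha> e (mon m)) m = 0"
          using tcomp_mon_ge[OF \<alpha>(1) e(1) fd, of m] by (meson not_le notin_sp)
        then show ?thesis using \<alpha>(1) by (simp add: cfT[OF fd])
      qed
    next
      show "sp (tLn e) \<subseteq> sig 1 ` W" using eta id by simp
    qed blast
  next
    case False
    then have a1: "\<alpha> < 1" and qa: "q = 1 / \<alpha>" using \<alpha> by (auto simp: q)
    \<comment> \<open>For \<alpha> < 1 the image of \<open>mon m\<close> is led by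
      \<open>sig \<alpha> m\<close>: the unknowns live on \<open>V\<close> and the equations on its
      image under \<open>sig \<alpha>\<close>, which is \<open>W\<close>. Closure under scaling by 1
      / \<alpha> puts \<open>V\<close> inside \<open>W\<close>.\<close>
    define V where "V = sig q ` W"
    have VW: "V \<subseteq> W" using Wsig by (auto simp: V_def)
    have sV: "sig \<alpha> ` V = W" using \<alpha>(1) by (simp add: V_def image_image sig_sig qa)
    have "adm V" by (rule adm_subset[OF W VW])
    have "\<exists>\<psi>. sp \<psi> \<subseteq> V \<and> T \<psi> = tLn e"
    proof (rule triangular_solve[OF T \<open>adm V\<close> \<alpha>(1)])
      fix m assume mV: "m \<in> V"
      then have m: "m \<in> W" and smW: "sig \<alpha> m \<in> W" using VW sV by auto
      then have k: "dep k m" using dG by (simp add: W_def)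
      note fd = fdI[OF k]
      have nn: "0 \<le> zexp m" using Wpos[OF m] by (intro zexp_nonneg) simp
      have lt: "sig \<alpha> m < m" if "zexp m \<noteq> 0"
        using that nn a1 by (auto simp: less_lmon_def)
      have eq: "sig \<alpha> m = m" if "zexp m = 0" using that by (intro lmon_eqI) auto
      show "sp (T (mon m)) \<subseteq> sig \<alpha> ` V"
      proof
        fix c assume "c \<in> sp (T (mon m))"
        then consider "c = m" | "c \<in> sp (tcomp \<alpha> e (mon m))" using spT by blast
        then show "c \<in> sig \<alpha> ` V"
        proof cases
          case 2
          then obtain a b where "a \<in> Emon k" "b \<in> mgen (sp e)" "c = sig \<alpha> m + (a + b)"
            using sp_tcomp_mon[OF \<alpha>(1) e(1) k] by (auto simp: set_plus_def)
          then show ?thesis using WG[OF smW] sV by simp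
        qed (use m sV in simp)
      qed
      show "sig \<alpha> m \<le> c" if "c \<in> sp (T (mon m))" for c
        using spT[OF that] tcomp_mon_ge[OF \<alpha>(1) e(1) fd, of c] lt eq by (cases "zexp m = 0") auto
      show "cf (T (mon m)) (sig \<alpha> m) \<noteq> 0"
      proof (cases "zexp m = 0")
        case z: True
        have "cf (T (mon m)) (sig \<alpha> m) = \<alpha> - \<alpha> powi (- lexp m 0)"
          using cf_tcomp_lead_mon[OF \<alpha>(1) e(1) fd] by (simp add: cfT[OF fd] eq[OF z])
        then show ?thesis using diag_nonzero[OF \<alpha> lexp0_nonneg[OF Wpos[OF m] z]] by simp
      next
        case z: False
        have "cf (T (mon m)) (sig \<alpha> m) = - (\<alpha> powi (- lexp m 0))"
          using cf_tcomp_lead_mon[OF \<alpha>(1) e(1) fd] lt[OF z] by (simp add: cfT[OF fd])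
        then show ?thesis using \<alpha>(1) by simp
      qed
    next
      show "sp (tLn e) \<subseteq> sig \<alpha> ` V" using eta sV by simp
    qed blast
    then show ?thesis using VW by blast
  qed
  then obtain \<psi> where \<psi>: "sp \<psi> \<subseteq> W" "T \<psi> = tLn e" by blast
  show thesis
  proof (rule that[of \<psi>])
    show "small \<psi>" using \<psi>(1) Wpos by (auto simp: small_def)
    show "\<alpha> *\<^sub>R \<psi> - tcomp \<alpha> e \<psi> = tLn e" using \<psi>(2) by (simp add: T_def)
    show "sp \<psi> \<subseteq> Gm k q (sp e)" using \<psi>(1) by (auto simp: W_def G_def)
    show "\<And>a. a \<in> sp \<psi> \<Longrightarrow> \<delta> \<le> zexp a" using \<psi>(1) by (auto simp: W_def)
  qed
qed

section \<open>Parabolic and strongly hyperbolic transseries\<close>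

lemma lts_ord_cf: "lts_ord (cf x) = (if x = 0 then Pinf else Fin (ld x))"
  by (simp add: lts_ord_def ld_def)

lemma cf_diff: "cf (x - y) = cf x - cf y"
  by (rule ext) simp

lemma hot_gen: "hot (cf x) (zpow p) \<longleftrightarrow> (\<exists>e. small e \<and> x = gen p e)"
proof
  assume h: "hot (cf x) (zpow p)"
  define g where "g = x - mon (zm p)"
  have g: "g = 0 \<or> zm p < ld g"
    using h by (auto simp: hot_def zpow_cf cf_diff[symmetric] lts_ord_cf g_def sp_mon split: if_splits)
  define e where "e = mon (- zm p) * g"
  have "0 < a" if "a \<in> sp e" for a
  proof -
    have "cf e a = cf g (a + zm p)" unfolding e_def by (subst cf_mon_times) auto
    then have "a + zm p \<in> sp g" using that by (simp add: sp_def)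
    moreover from this have "g \<noteq> 0" by auto
    ultimately have "ld g \<le> a + zm p" "g \<noteq> 0" using ld_le[of g] by auto
    then have "zm p < a + zm p" using g less_le_trans[of "zm p" "ld g" "a + zm p"] by blast
    then show ?thesis by simp
  qed
  moreover have "x = gen p e"
  proof -
    have "mon (zm p) * e = g" using mon_add[of "zm p" "- zm p"] by (simp add: e_def flip: mult.assoc)
    then show ?thesis by (simp add: gen_def distrib_left g_def)
  qed
  ultimately show "\<exists>e. small e \<and> x = gen p e" by (auto simp: small_def)
next
  assume "\<exists>e. small e \<and> x = gen p e"
  then obtain e where e: "small e" "x = gen p e" by blast
  let ?g = "mon (zm p) * e"
  have "zm p < ld ?g" if "?g \<noteq> 0"
  proof -
    have "ld ?g - zm p \<in> sp e" using ld_in[OF that] by (simp add: sp_def cf_mon_times)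
    from smallD[OF e(1) this] show ?thesis by (simp only: diff_gt_0_iff_gt)
  qed
  then show "hot (cf x) (zpow p)"
    by (auto simp: hot_def zpow_cf cf_diff[symmetric] lts_ord_cf sp_mon e(2) gen_diff)
qed

lemma cf_gen: "cf (gen p e) c = (if c = zm p then 1 else 0) + cf e (c - zm p)"
  by (simp add: gen_def distrib_left cf_mon cf_mon_times)

lemma gen_Lts: assumes "0 < p" "small e" shows "cf (gen p e) \<in> Lts k \<longleftrightarrow> (\<forall>a\<in>sp e. dep k a)"
proof -
  have "0 < zm p" using assms(1) by (simp add: less_lmon_def)
  then have "0 < lts_ord (cf (gen p e))"
    using gen_lead[OF assms(2), of p] by (simp add: lts_ord_cf zero_extended_def)
  then have "cf (gen p e) \<in> Lts k \<longleftrightarrow> (\<forall>a\<in>sp (gen p e). dep k a)"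
    by (auto simp: Lts_def Linf_def dep_def)
  also have "\<dots> \<longleftrightarrow> (\<forall>a\<in>sp e. dep k a)"
  proof
    assume L: "\<forall>a\<in>sp (gen p e). dep k a"
    show "\<forall>a\<in>sp e. dep k a"
    proof
      fix a assume a: "a \<in> sp e"
      then have "a \<noteq> 0" using smallD[OF assms(2)] by blast
      then have "a + zm p \<in> sp (gen p e)" using a by (simp add: sp_def cf_gen)
      then have "dep k (a + zm p)" using L by blast
      then have "dep k (a + zm p - zm p)" by (rule dep_simps(3)) simp
      then show "dep k a" by simp
    qed
  next
    assume R: "\<forall>a\<in>sp e. dep k a"
    show "\<forall>a\<in>sp (gen p e). dep k a"
    proof
      fix c assume "c \<in> sp (gen p e)"
      then have "c = zm p \<or> c - zm p \<in> sp e" by (auto simp: sp_def cf_gen split: if_splits)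
      then show "dep k c"
      proof
        assume "c - zm p \<in> sp e"
        then have "dep k (c - zm p)" using R by blast
        then have "dep k (c - zm p + zm p)" by (rule dep_simps(2)) simp
        then show ?thesis by simp
      qed simp
    qed
  qed
  finally show ?thesis .
qed

lemma Lts_cf: assumes "f \<in> Lts k" obtains x where "f = cf x"
proof -
  have "f \<in> frakLinf" using assms by (auto simp: Lts_def frakLinf_def)
  then show thesis using that cf_cases by blast
qed

lemma L0_iff: "f \<in> L0 k \<longleftrightarrow> (\<exists>e. small e \<and> f = cf (gen 1 e) \<and> (\<forall>a\<in>sp e. dep k a))"
proof
  assume f: "f \<in> L0 k"
  then obtain x where x: "f = cf x" using Lts_cf by (auto simp: L0_def)
  then obtain e where "small e" "x = gen 1 e" using f hot_gen by (auto simp: L0_def)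
  then show "\<exists>e. small e \<and> f = cf (gen 1 e) \<and> (\<forall>a\<in>sp e. dep k a)"
    using f x gen_Lts[of 1 e k] by (auto simp: L0_def)
qed (auto simp: L0_def gen_Lts hot_gen)

lemma frakL0_iff: "f \<in> frakL0 \<longleftrightarrow> (\<exists>e. small e \<and> f = cf (gen 1 e))"
proof
  assume "\<exists>e. small e \<and> f = cf (gen 1 e)"
  then obtain e where e: "small e" "f = cf (gen 1 e)" by blast
  obtain k where "\<And>a. a \<in> sp e \<Longrightarrow> dep k a" using adm_dep[OF adm_sp] by blast
  then have "f \<in> L0 k" using e L0_iff by blast
  then show "f \<in> frakL0" by (auto simp: frakL0_def)
qed (auto simp: frakL0_def L0_iff)

lemma gen_frakLH: assumes "0 < p" "small e" shows "cf (gen p e) \<in> frakLH"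
proof -
  obtain k where "\<And>a. a \<in> sp e \<Longrightarrow> dep k a" using adm_dep[OF adm_sp] by blast
  then have "cf (gen p e) \<in> Lts k" using gen_Lts[OF assms] by blast
  moreover have "hot (cf (gen p e)) (scale_lts 1 (zpow p))"
    using assms hot_gen by (auto simp: scale_lts_def)
  ultimately have "cf (gen p e) \<in> LH k" using assms(1) zero_less_one unfolding LH_def by blast
  then show ?thesis by (auto simp: frakLH_def)
qed

lemma frakLH_cf: assumes "f \<in> frakLH" obtains x where "f = cf x"
  using assms Lts_cf by (auto simp: frakLH_def LH_def)

text \<open>\<open>inv\<close> is a definite description, so uniqueness is needed besides existence;
  injectivity of right composition supplies it without the group axioms.\<close>

lemma inv_gen:
  assumes e: "small e" "small e'" and i: "tcomp 1 e (gen 1 e') = gen 1 0" "tcomp 1 e' (gen 1 e) = gen 1 0"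
  shows "inv\<^bsub>LH_group\<^esub> (cf (gen 1 e)) = cf (gen 1 e')"
proof -
  have one: "zpow 1 = cf (gen 1 0)" by (simp add: zpow_cf gen_0)
  show ?thesis
    unfolding m_inv_def LH_group_def
  proof (rule the_equality)
    show "cf (gen 1 e') \<in> carrier \<lparr>carrier = frakLH, mult = comp_lts, one = zpow 1\<rparr> \<and>
      cf (gen 1 e) \<otimes>\<^bsub>\<lparr>carrier = frakLH, mult = comp_lts, one = zpow 1\<rparr>\<^esub> cf (gen 1 e') = \<one>\<^bsub>\<lparr>carrier = frakLH, mult = comp_lts, one = zpow 1\<rparr>\<^esub> \<and>
      cf (gen 1 e') \<otimes>\<^bsub>\<lparr>carrier = frakLH, mult = comp_lts, one = zpow 1\<rparr>\<^esub> cf (gen 1 e) = \<one>\<^bsub>\<lparr>carrier = frakLH, mult = comp_lts, one = zpow 1\<rparr>\<^esub>"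
      using e i by (simp add: cf_comp one gen_frakLH)
  next
    fix y assume y: "y \<in> carrier \<lparr>carrier = frakLH, mult = comp_lts, one = zpow 1\<rparr> \<and>
      cf (gen 1 e) \<otimes>\<^bsub>\<lparr>carrier = frakLH, mult = comp_lts, one = zpow 1\<rparr>\<^esub> y = \<one>\<^bsub>\<lparr>carrier = frakLH, mult = comp_lts, one = zpow 1\<rparr>\<^esub> \<and>
      y \<otimes>\<^bsub>\<lparr>carrier = frakLH, mult = comp_lts, one = zpow 1\<rparr>\<^esub> cf (gen 1 e) = \<one>\<^bsub>\<lparr>carrier = frakLH, mult = comp_lts, one = zpow 1\<rparr>\<^esub>"
    then obtain x where x: "y = cf x" using frakLH_cf by auto
    then have "tcomp 1 e x = tcomp 1 e (gen 1 e')" using y e i by (simp add: cf_comp one cf_inject)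
    then have "x = gen 1 e'" by (rule tcomp_inj[OF zero_less_one e(1)])
    then show "y = cf (gen 1 e')" using x by simp
  qed
qed

text \<open>Both sides are composed with \<phi> from the right, an injective operation that cancels
  the inverse.\<close>

lemma is_normalization_iff:
  assumes \<alpha>: "0 < \<alpha>" and e: "small e" and u: "small u"
  shows "is_normalization \<alpha> (cf (gen \<alpha> e)) (cf (gen 1 u)) \<longleftrightarrow> tcomp \<alpha> e (gen 1 u) = tcomp 1 u (mon (zm \<alpha>))"
proof -
  obtain v where v: "small v" "tcomp 1 u (gen 1 v) = gen 1 0" "tcomp 1 v (gen 1 u) = gen 1 0"
    using inverse_exists[OF u] .
  obtain c where c: "small c" "tcomp 1 v (gen \<alpha> e) = gen (\<alpha> * 1) c" using tcomp_gen[OF zero_less_one v(1) e] .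
  have id: "tcomp 1 u (tcomp 1 v x) = x" for x
    using tcomp_comp_gen[OF zero_less_one v(1) zero_less_one u, of 0 x] v(2) by (simp add: tcomp_id)
  have "tcomp 1 u (gen \<alpha> c) = gen \<alpha> e" using id[of "gen \<alpha> e"] c(2) by simp
  \<comment> \<open>Here \<open>gen \<alpha> c\<close> is f o \<phi>^(-1), and composing it with
    \<phi> gives back f.\<close>
  then have ucx: "tcomp 1 u (tcomp \<alpha> c x) = tcomp \<alpha> e x" for x
    using tcomp_comp_gen[OF \<alpha> c(1) zero_less_one u _ e, of x] by simp
  have f0: "cf (gen 1 u) \<in> frakL0" using u frakL0_iff by blast
  have "cf (gen 1 u) \<circ>\<^sub>t cf (gen \<alpha> e) \<circ>\<^sub>t inv\<^bsub>LH_group\<^esub> cf (gen 1 u) = cf (tcomp \<alpha> c (gen 1 u))"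
    using c \<alpha> v(1) by (simp add: inv_gen[OF u v] cf_comp)
  then have "is_normalization \<alpha> (cf (gen \<alpha> e)) (cf (gen 1 u)) \<longleftrightarrow> tcomp \<alpha> c (gen 1 u) = mon (zm \<alpha>)"
    using f0 by (simp add: is_normalization_def zpow_cf cf_inject)
  also have "\<dots> \<longleftrightarrow> tcomp 1 u (tcomp \<alpha> c (gen 1 u)) = tcomp 1 u (mon (zm \<alpha>))"
    by (rule iffI, erule arg_cong, erule tcomp_inj[OF zero_less_one u])
  finally show ?thesis by (simp add: ucx)
qed

section \<open>Convergence of coefficients\<close>

lemma recurrence_tendsto_0:
  fixes x y :: "nat \<Rightarrow> real"
  assumes d: "0 \<le> d" "d < 1" and x: "\<And>n. x (Suc n) = d * x n + y n" and y: "y \<longlonglongrightarrow> 0"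
  shows "x \<longlonglongrightarrow> 0"
proof (rule LIMSEQ_I)
  fix r :: real assume r: "0 < r"
  \<comment> \<open>Chosen so that d r / 2 + r (1 - d) / 2 = r / 2: the bound r / 2 reproduces
    itself under the recurrence.\<close>
  then have "0 < r * (1 - d) / 2" using d by simp
  from LIMSEQ_D[OF y this] obtain N where N: "\<And>n. n \<ge> N \<Longrightarrow> \<bar>y n\<bar> < r * (1 - d) / 2" by auto
  have b: "\<bar>x (N + k)\<bar> \<le> d ^ k * \<bar>x N\<bar> + r / 2" for k
  proof (induction k)
    case 0 then show ?case using r by simp
  next
    case (Suc k)
    have "\<bar>x (N + Suc k)\<bar> \<le> d * \<bar>x (N + k)\<bar> + \<bar>y (N + k)\<bar>"
      using abs_triangle_ineq[of "d * x (N + k)" "y (N + k)"] d by (simp add: x abs_mult)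
    also have "\<dots> \<le> d * (d ^ k * \<bar>x N\<bar> + r / 2) + r * (1 - d) / 2"
      using Suc d N[of "N + k"] by (intro add_mono mult_left_mono) auto
    also have "\<dots> = d ^ Suc k * \<bar>x N\<bar> + r / 2" by (simp add: field_simps)
    finally show ?case .
  qed
  have "(\<lambda>k. d ^ k * \<bar>x N\<bar>) \<longlonglongrightarrow> 0 * \<bar>x N\<bar>" using d by (intro tendsto_intros LIMSEQ_realpow_zero)
  then have "(\<lambda>k. d ^ k * \<bar>x N\<bar>) \<longlonglongrightarrow> 0" by simp
  from LIMSEQ_D[OF this, of "r / 2"] r obtain M where M': "\<And>k. k \<ge> M \<Longrightarrow> norm (d ^ k * \<bar>x N\<bar> - 0) < r / 2" by auto
  have M: "d ^ k * \<bar>x N\<bar> < r / 2" if "k \<ge> M" for k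
    using M'[OF that] abs_ge_self[of "d ^ k * \<bar>x N\<bar>"] unfolding real_norm_def diff_zero by (rule le_less_trans[rotated])
  show "\<exists>no. \<forall>n\<ge>no. norm (x n - 0) < r"
  proof (intro exI[of _ "N + M"] allI impI)
    fix n assume "N + M \<le> n"
    then obtain k where k: "n = N + k" "M \<le> k" by (metis le_add_diff_inverse nat_add_left_cancel_le add_leD1)
    show "norm (x n - 0) < r" using b[of k] M[OF k(2)] k(1) by simp
  qed
qed

lemma msum_mono: "A \<subseteq> B \<Longrightarrow> msum j A \<subseteq> msum j B"
  by (induction j) (simp_all add: set_plus_mono2)

text \<open>On a common well-ordered support a coefficient of a power is a polynomial, the same for
  all \<open>n\<close>, in finitely many coefficients, hence continuous.\<close>

lemma tendsto_power_cf:
  assumes V: "well_ordered V" and sub: "\<And>n. sp (y n) \<subseteq> V" "sp z \<subseteq> V"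
    and l: "\<And>c. (\<lambda>n. cf (y n) c) \<longlonglongrightarrow> cf z c"
  shows "(\<lambda>n. cf (y n ^ i) c) \<longlonglongrightarrow> cf (z ^ i) c"
proof (induction i arbitrary: c)
  case (Suc i)
  let ?D = "{a \<in> V. c - a \<in> msum i V}"
  have D: "finite ?D" by (rule wo_decomp_finite[OF V msum_wo[OF V]])
  have pw: "sp (x ^ i) \<subseteq> msum i V" if "sp x \<subseteq> V" for x
    using sp_power[of x i] msum_mono[OF that, of i] by blast
  have eq: "cf (x * x ^ i) c = (\<Sum>a\<in>?D. cf x a * cf (x ^ i) (c - a))" if "sp x \<subseteq> V" for x
    using that pw[OF that] by (intro cf_times_eq[OF D]) (auto simp: sp_def)
  show ?case unfolding power_Suc eq[OF sub(1)] eq[OF sub(2)]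
    by (intro tendsto_sum tendsto_mult l Suc)
qed simp

text \<open>Positivity of the common support leaves finitely many degrees at each coefficient, the
  same for all \<open>n\<close>.\<close>

lemma tendsto_fev_cf:
  assumes V: "well_ordered V" "\<And>a. a \<in> V \<Longrightarrow> 0 < a" and sub: "\<And>n. sp (y n) \<subseteq> V" "sp z \<subseteq> V"
    and l: "\<And>c. (\<lambda>n. cf (y n) c) \<longlonglongrightarrow> cf z c"
  shows "(\<lambda>n. cf (fev G (y n)) c) \<longlonglongrightarrow> cf (fev G z) c"
proof -
  let ?N = "{i. c \<in> msum i V}"
  have N: "finite ?N" by (rule mgen_finite_degree[OF V])
  have eq: "cf (fev G x) c = (\<Sum>i\<in>?N. G $ i * cf (x ^ i) c)" if x: "sp x \<subseteq> V" for x
  proof -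
    have "small x" using x V(2) by (auto simp: small_def)
    note m = msum_mono[OF x]
    have "cf (fev G x) c = (\<Sum>i\<in>?N. cf ((G $ i) *\<^sub>R x ^ i) c)"
      unfolding fev_def
    proof (rule cf_hsum_sum[OF small_hsummable[OF \<open>small x\<close>] N])
      show "cf ((G $ i) *\<^sub>R x ^ i) c = 0" if "i \<notin> ?N" for i
        using that sp_power[of x i] m[of i] by (auto simp: sp_def)
    qed simp
    then show ?thesis by simp
  qed
  show ?thesis unfolding eq[OF sub(1)] eq[OF sub(2)]
    by (intro tendsto_sum tendsto_mult tendsto_const tendsto_power_cf[OF V(1) sub l])
qed

text \<open>For \<open>\<alpha> > 1\<close> the operator \<open>x \<mapsto> \<alpha>\<^sup>-\<^sup>1 (x \<circ> f)\<close> is triangular with diagonal entries in \<open>[0, 1)\<close>,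
  so its iterates tend to \<open>0\<close> coefficientwise, by induction along the support.\<close>

lemma iterates_tendsto_0:
  assumes \<alpha>: "1 < \<alpha>" and e: "small e" and x: "small x"
  obtains V where "adm V" "\<And>a. a \<in> V \<Longrightarrow> 0 < a" "\<And>n. sp ((1 / \<alpha> ^ n) *\<^sub>R (tcomp \<alpha> e ^^ n) x) \<subseteq> V"
    "\<And>c. (\<lambda>n. cf ((1 / \<alpha> ^ n) *\<^sub>R (tcomp \<alpha> e ^^ n) x) c) \<longlonglongrightarrow> 0"
proof -
  have a0: "0 < \<alpha>" using \<alpha> by simp
  obtain k where k: "\<And>a. a \<in> sp e \<union> sp x \<Longrightarrow> dep k a" using adm_dep[OF adm_un[OF adm_sp adm_sp]] by blast
  let ?A = "sp e \<union> sp x"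
  have pA: "\<And>a. a \<in> ?A \<Longrightarrow> 0 < a" using e x by (auto simp: small_def)
  define G where "G = Gm k \<alpha> ?A"
  have G: "adm G" unfolding G_def by (rule adm_Gm[OF \<alpha> adm_un[OF adm_sp adm_sp] pA])
  define V where "V = {w \<in> G. w \<noteq> 0}"
  have V: "adm V" by (rule adm_subset[OF G]) (auto simp: V_def)
  have Gnn: "0 \<le> w" if "w \<in> G" for w using Gm_nonneg[OF \<alpha> pA that[unfolded G_def]] .
  have Vpos: "0 < w" if "w \<in> V" for w using that Gnn[of w] by (auto simp: V_def)
  have dV: "dep k w" if "w \<in> V" for w using Gm_dep[OF k, of ?A w \<alpha>] that by (auto simp: V_def G_def)
  have CV: "sp (tcomp \<alpha> e (mon m)) \<subseteq> V" if m: "m \<in> V" for m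
  proof
    fix c assume c: "c \<in> sp (tcomp \<alpha> e (mon m))"
    then have "sig \<alpha> m \<le> c" by (rule tcomp_mon_ge[OF a0 e fdI[OF dV[OF m]]])
    then have c0: "0 < c" using sig_pos[OF a0 Vpos[OF m]] by (rule less_le_trans[rotated])
    obtain a b where ab: "a \<in> Emon k" "b \<in> mgen (sp e)" "c = sig \<alpha> m + (a + b)"
      using sp_tcomp_mon[OF a0 e dV[OF m]] c by (auto simp: set_plus_def)
    have "sig \<alpha> m \<in> G" using m Gm_sig unfolding V_def G_def by blast
    moreover have "a \<in> G" using ab(1) Gm_Emon unfolding G_def by blast
    moreover have "b \<in> G" using ab(2) mgen_mono[of "sp e" ?A] Gm_mgen unfolding G_def by blast
    ultimately have "c \<in> G" unfolding ab(3) G_def by (intro Gm_add)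
    then show "c \<in> V" using c0 by (auto simp: V_def)
  qed
  define X where "X n = (1 / \<alpha> ^ n) *\<^sub>R (tcomp \<alpha> e ^^ n) x" for n
  have sC: "slin (tcomp \<alpha> e)" by (rule slin_tcomp[OF a0 e])
  have X_Suc: "X (Suc n) = (1 / \<alpha>) *\<^sub>R tcomp \<alpha> e (X n)" for n
    by (simp add: X_def slin_scaleR[OF sC])
  have spX: "sp (X n) \<subseteq> V" for n
  proof (induction n)
    case 0
    have "sp x \<subseteq> G" unfolding G_def using Gm_mgen[of ?A k \<alpha>] mgen_base[of _ ?A] by blast
    then show ?case using pA by (auto simp: X_def V_def)
  next
    case (Suc n)
    have "sp (tcomp \<alpha> e (X n)) \<subseteq> V" by (rule sp_slin[OF sC]) (use Suc CV in blast)
    then show ?case unfolding X_Suc using sp_scaleR by blast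
  qed
  have lim: "(\<lambda>n. cf (X n) c) \<longlonglongrightarrow> 0" if c: "c \<in> V" for c
    using wf_adm[OF V] c
  proof (induction c rule: wf_induct_rule)
    case (less c)
    let ?K = "{v \<in> V. cf (tcomp \<alpha> e (mon v)) c \<noteq> 0}"
    have K: "finite ?K" using hsummableD(2)[OF slinD(1)[OF sC V]] by simp
    have step: "cf (X (Suc n)) c = (1 / \<alpha>) * (\<Sum>v\<in>?K. cf (X n) v * cf (tcomp \<alpha> e (mon v)) c)" for n
      unfolding X_Suc cf_simps using spX[of n] by (subst cf_slin_sum[OF sC K]) auto
    have vle: "v \<le> sig \<alpha> v \<and> sig \<alpha> v \<le> c" if "v \<in> ?K" for v
    proof -
      have "v \<in> V" "c \<in> sp (tcomp \<alpha> e (mon v))" using that by (auto simp: sp_def)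
      moreover have "v \<le> sig \<alpha> v"
      proof -
        have "0 \<le> zexp v" using Vpos[OF \<open>v \<in> V\<close>] by (intro zexp_nonneg) simp
        then consider "zexp v = 0" | "zexp v < \<alpha> * zexp v" using \<alpha> by fastforce
        then show ?thesis
        proof cases
          case 1
          then have "sig \<alpha> v = v" by (intro lmon_eqI) auto
          then show ?thesis by simp
        qed (auto simp: less_eq_lmon_def less_lmon_def)
      qed
      ultimately show ?thesis using tcomp_mon_ge[OF a0 e fdI[OF dV]] by blast
    qed
    \<comment> \<open>The diagonal entry, nonzero only if \<open>sig \<alpha> c = c\<close>, that is
      at z-exponent 0; there it is \<alpha>^(-n-1), with n \<ge> 0 the exponent of l_1. All other
      contributions come from smaller monomials and tend to 0 by induction.\<close>
    define d where "d = (if c \<in> ?K then (1 / \<alpha>) * cf (tcomp \<alpha> e (mon c)) c else 0)"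
    define y where "y n = (1 / \<alpha>) * (\<Sum>v\<in>?K - {c}. cf (X n) v * cf (tcomp \<alpha> e (mon v)) c)" for n
    have d: "0 \<le> d \<and> d < 1"
    proof (cases "c \<in> ?K")
      case True
      then have "sig \<alpha> c = c" using vle[of c] by (intro antisym) auto
      then have cf: "cf (tcomp \<alpha> e (mon c)) c = \<alpha> powi (- lexp c 0)" and z: "zexp c = 0"
        using cf_tcomp_lead_mon[OF a0 e fdI[OF dV[OF less.prems]]] \<alpha> by (simp, metis mult_cancel_right1 sig_simps(1) less_irrefl)
      have "0 \<le> lexp c 0" by (rule lexp0_nonneg[OF Vpos[OF less.prems] z])
      then have "\<alpha> powi (- lexp c 0) = inverse (\<alpha> ^ nat (lexp c 0))"
        unfolding power_int_minus by (simp add: power_int_def)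
      moreover have "1 \<le> \<alpha> ^ nat (lexp c 0)" using \<alpha> by (intro one_le_power) simp
      ultimately have "0 < \<alpha> powi (- lexp c 0)" "\<alpha> powi (- lexp c 0) \<le> 1" using a0 by (auto simp: inverse_le_1_iff)
      then show ?thesis using \<alpha> True by (auto simp: d_def cf)
    qed (auto simp: d_def)
    have rec: "cf (X (Suc n)) c = d * cf (X n) c + y n" for n
    proof (cases "c \<in> ?K")
      case True
      then show ?thesis using sum.remove[OF K True, of "\<lambda>v. cf (X n) v * cf (tcomp \<alpha> e (mon v)) c"]
        unfolding step d_def y_def by (simp add: distrib_left)
    next
      case False
      then have "?K - {c} = ?K" by blast
      then show ?thesis using False unfolding step d_def y_def by simp
    qed
    have "y \<longlonglongrightarrow> 0"
      unfolding y_def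
    proof (rule tendsto_mult_right_zero, rule tendsto_null_sum)
      fix v assume v: "v \<in> ?K - {c}"
      then have "v \<in> V" "v < c" using vle[of v] by auto
      then have "(\<lambda>n. cf (X n) v) \<longlonglongrightarrow> 0" using less by auto
      then show "(\<lambda>n. cf (X n) v * cf (tcomp \<alpha> e (mon v)) c) \<longlonglongrightarrow> 0" by (rule tendsto_mult_left_zero)
    qed
    then show ?case using recurrence_tendsto_0[of d "\<lambda>n. cf (X n) c" y] d rec by blast
  qed
  have "(\<lambda>n. cf (X n) c) \<longlonglongrightarrow> 0" for c
  proof (cases "c \<in> V")
    case False
    then have "cf (X n) c = 0" for n using spX[of n] by (auto simp: sp_def)
    then show ?thesis by simp
  qed (rule lim)
  then show thesis using that[OF V Vpos] spX unfolding X_def by blast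
qed

section \<open>The power-metric topology\<close>

lemma ord_z_cf: "ord_z (cf x) = (if x = 0 then infinity else ereal (zexp (ld x)))"
proof (cases "x = 0")
  case False
  have "(LEAST \<beta>. \<exists>n. LMon \<beta> n \<in> sp x) = zexp (ld x)"
  proof (rule Least_equality)
    have "LMon (zexp (ld x)) (lexp (ld x)) \<in> sp x" using ld_in[OF False] by simp
    then show "\<exists>n. LMon (zexp (ld x)) n \<in> sp x" by blast
    fix \<beta> assume "\<exists>n. LMon \<beta> n \<in> sp x"
    then obtain n where "LMon \<beta> n \<in> sp x" by blast
    from zexp_mono[OF ld_le[OF False this]] show "zexp (ld x) \<le> \<beta>" by simp
  qed
  then show ?thesis using False by (simp add: ord_z_def)
qed (simp add: ord_z_def)

lemma d_z_cf: "d_z (cf x) (cf y) = (if x = y then 0 else 2 powr (- zexp (ld (x - y))))"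
  by (simp add: d_z_def cf_inject cf_diff[symmetric] ord_z_cf)

text \<open>The distance is an ultrametric: the leading monomial of \<open>x - z\<close> lies in the
  support of \<open>x - y\<close> or of \<open>y - z\<close>.\<close>

lemma Metric_space_d_z: "Metric_space frakLinf d_z"
proof
  fix f g :: lts
  show "0 \<le> d_z f g" by (simp add: d_z_def)
  have "supp (f - g) = supp (g - f)" by (auto simp: supp_def)
  then have "ord_z (f - g) = ord_z (g - f)" by (simp add: ord_z_def)
  then show "d_z f g = d_z g f" by (simp add: d_z_def)
next
  fix f g :: lts assume "f \<in> frakLinf" "g \<in> frakLinf"
  then show "d_z f g = 0 \<longleftrightarrow> f = g" by (simp add: d_z_def)
next
  fix f g h :: lts assume "f \<in> frakLinf" "g \<in> frakLinf" "h \<in> frakLinf"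
  then obtain x y z where c: "f = cf x" "g = cf y" "h = cf z" by (metis cf_cases)
  have nn: "0 \<le> d_z (cf x) (cf y)" for x y by (simp add: d_z_def)
  show "d_z f h \<le> d_z f g + d_z g h"
  proof (cases "x = y \<or> y = z \<or> x = z")
    case True
    then show ?thesis using nn[of x y] nn[of y z] unfolding c by (auto simp: d_z_cf)
  next
    case False
    have "ld (x - z) \<in> sp (x - y) \<union> sp (y - z)"
      using ld_in[of "x - z"] sp_add[of "x - y" "y - z"] False by auto
    then have "zexp (ld (x - y)) \<le> zexp (ld (x - z)) \<or> zexp (ld (y - z)) \<le> zexp (ld (x - z))"
      using ld_le[of "x - y"] ld_le[of "y - z"] False zexp_mono by auto
    then have "d_z f h \<le> d_z f g \<or> d_z f h \<le> d_z g h" unfolding c using False by (auto simp: d_z_cf)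
    then show ?thesis using nn[of x y] nn[of y z] unfolding c by linarith
  qed
qed

lemma limitin_power_metric:
  "limitin (power_metric_topology_on frakL0) B \<psi> sequentially \<longleftrightarrow>
    \<psi> \<in> frakL0 \<and> (\<forall>\<^sub>F n in sequentially. B n \<in> frakL0) \<and>
    (\<forall>\<epsilon>>0. \<forall>\<^sub>F n in sequentially. B n \<in> frakLinf \<and> d_z (B n) \<psi> < \<epsilon>)"
proof -
  have "\<psi> \<in> frakLinf" if "\<psi> \<in> frakL0" using that cf by (auto simp: frakL0_iff)
  then show ?thesis
    unfolding power_metric_topology_on_def limitin_subtopology Metric_space.limitin_metric[OF Metric_space_d_z] by blast
qed

lemma ld_mult: assumes "x \<noteq> 0" "y \<noteq> 0" shows "ld (x * y) = ld x + ld y"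
proof -
  let ?e = "eps x + eps y + eps x * eps y"
  have "x * y = (lc x *\<^sub>R (mon (ld x) * (1 + eps x))) * (lc y *\<^sub>R (mon (ld y) * (1 + eps y)))"
    using ts_decomp[OF assms(1)] ts_decomp[OF assms(2)] by simp
  also have "\<dots> = (lc x * lc y) *\<^sub>R (mon (ld x + ld y) * (1 + ?e))"
    using assms by (simp add: mon_add fd_ld algebra_simps)
  finally have eq: "x * y = (lc x * lc y) *\<^sub>R (mon (ld x + ld y) * (1 + ?e))" .
  show ?thesis
    by (rule ts_lead_unique(2)[OF eq]) (use assms in \<open>auto intro!: small_add small_times small_eps fd_add fd_ld\<close>)
qed

lemma ld_one_plus: "small e \<Longrightarrow> ld (1 + e) = 0 \<and> 1 + e \<noteq> 0"
  using gen_lead[of e 0] by (simp add: gen_def zm_0)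

lemma ld_tExp: assumes "small x" shows "ld (tExp x) = 0" "tExp x \<noteq> 0"
  using ld_one_plus[OF small_tExp[OF assms]] by simp_all

text \<open>By exp x - 1 = x G(x) with G(0) = 1, where the factor G(x) has trivial leading
  monomial.\<close>

lemma ld_tExp_minus_1: assumes "small x" "x \<noteq> 0" shows "tExp x - 1 \<noteq> 0" "ld (tExp x - 1) = ld x"
proof -
  define G where "G = Abs_fps (\<lambda>n. 1 / fact (Suc n) :: real)"
  have "fps_exp 1 - 1 = fps_X * G"
  proof (rule fps_ext)
    fix n show "(fps_exp 1 - 1) $ n = (fps_X * G) $ n" by (cases n) (auto simp: G_def distrib_right)
  qed
  moreover have "tExp x - 1 = fev (fps_exp 1 - 1) x" using assms(1) by (simp add: tExp_def fev_diff fev_1)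
  ultimately have eq: "tExp x - 1 = x * fev G x" using assms(1) by (simp add: fev_mult fev_X)
  have "fev G x - 1 = fev (G - 1) x" using assms(1) by (simp add: fev_diff fev_1)
  moreover have "small (fev (G - 1) x)" by (rule small_fev[OF assms(1)]) (simp add: G_def)
  ultimately have sG: "small (fev G x - 1)" by simp
  have "1 + (fev G x - 1) = fev G x" by simp
  with ld_one_plus[OF sG] have "ld (fev G x) = 0 \<and> fev G x \<noteq> 0" by metis
  then show "tExp x - 1 \<noteq> 0" "ld (tExp x - 1) = ld x" using assms(2) by (simp_all add: eq ld_mult)
qed

text \<open>The difference factors as z exp \<psi> (exp x - 1).\<close>

lemma gen_tExp_diff:
  assumes "small \<psi>" "small x" "x \<noteq> 0"
  shows "mon (zm 1) * tExp (\<psi> + x) - mon (zm 1) * tExp \<psi> \<noteq> 0"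
    "ld (mon (zm 1) * tExp (\<psi> + x) - mon (zm 1) * tExp \<psi>) = zm 1 + ld x"
proof -
  have eq: "mon (zm 1) * tExp (\<psi> + x) - mon (zm 1) * tExp \<psi> = mon (zm 1) * (tExp \<psi> * (tExp x - 1))"
    using assms by (simp add: tExp_add algebra_simps)
  have ldm: "ld (mon (zm 1)) = zm 1" using gen_lead(2)[OF small_0, of 1] by (simp add: gen_0)
  show "mon (zm 1) * tExp (\<psi> + x) - mon (zm 1) * tExp \<psi> \<noteq> 0"
    "ld (mon (zm 1) * tExp (\<psi> + x) - mon (zm 1) * tExp \<psi>) = zm 1 + ld x"
    unfolding eq using ld_tExp[OF assms(1)] ld_tExp_minus_1[OF assms(2,3)] by (simp_all add: ld_mult ldm)
qed

text \<open>Both series have \<open>ord_z\<close> equal to 1, so the leading blocks agree iff the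
  difference has no term with z-exponent 1; for nonzero \<open>x\<close> its leading monomial is
  \<open>zm 1 + ld x\<close>.\<close>

lemma Lb_z_eq_iff:
  assumes "small \<psi>" "small x"
  shows "Lb_z (cf (mon (zm 1) * tExp (\<psi> + x))) = Lb_z (cf (mon (zm 1) * tExp \<psi>)) \<longleftrightarrow> x = 0 \<or> 0 < zexp (ld x)"
proof -
  have o: "ord_z (cf (mon (zm 1) * tExp y)) = ereal 1" if "small y" for y
    using gen_lead[OF gen_tExp(2)[OF that], of 1] gen_tExp(1)[OF that, of 1] by (simp add: ord_z_cf)
  let ?h = "mon (zm 1) * tExp (\<psi> + x)" and ?p = "mon (zm 1) * tExp \<psi>"
  have L: "Lb_z (cf ?h) = Lb_z (cf ?p) \<longleftrightarrow> (\<forall>a. zexp a = 1 \<longrightarrow> cf (?h - ?p) a = 0)"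
    unfolding Lb_z_def o[OF assms(1)] o[OF small_add[OF assms]] by (auto simp: fun_eq_iff)
  show ?thesis
  proof (cases "x = 0")
    case False
    note d = gen_tExp_diff[OF assms False]
    have nn: "0 \<le> zexp (ld x)" using smallD[OF assms(2) ld_in[OF False]] by (intro zexp_nonneg) simp
    show ?thesis
    proof
      assume "Lb_z (cf ?h) = Lb_z (cf ?p)"
      then have "zexp (ld (?h - ?p)) \<noteq> 1" using L ld_in[OF d(1)] by (auto simp: sp_def)
      then show "x = 0 \<or> 0 < zexp (ld x)" using nn d(2) by simp
    next
      assume "x = 0 \<or> 0 < zexp (ld x)"
      then have "1 < zexp (ld (?h - ?p))" using False d(2) by simp
      then have "cf (?h - ?p) a = 0" if "zexp a = 1" for a
        using ld_le[OF d(1), of a] zexp_mono[of "ld (?h - ?p)" a] that by (auto simp: sp_def)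
      then show "Lb_z (cf ?h) = Lb_z (cf ?p)" using L by blast
    qed
  qed simp
qed

section \<open>The Boettcher sequence\<close>

text \<open>The last clause is the linear equation for the iterate, obtained by telescoping. It
  expresses the logarithmic part of f^n through \<psi>.\<close>

lemma iterate_gen:
  assumes \<alpha>: "0 < \<alpha>" and e: "small e"
  shows "\<exists>c. small c \<and> cf (gen \<alpha> e) [^]\<^bsub>LH_group\<^esub> n = cf (gen (\<alpha> ^ n) c) \<and>
    (\<forall>x. tcomp (\<alpha> ^ n) c x = (tcomp \<alpha> e ^^ n) x) \<and>
    (\<forall>\<psi>. \<alpha> *\<^sub>R \<psi> - tcomp \<alpha> e \<psi> = tLn e \<longrightarrow> \<alpha> ^ n *\<^sub>R \<psi> - (tcomp \<alpha> e ^^ n) \<psi> = tLn c)"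
proof (induction n)
  case 0
  have "tLn 0 = 0" using tLn_tExp[of 0] by simp
  then show ?case
    by (intro exI[of _ 0]) (simp add: tcomp_id gen_0 zpow_cf LH_group_def nat_pow_def)
next
  case (Suc n)
  note sC = slin_tcomp[OF \<alpha> e]
  obtain c where c: "small c" "cf (gen \<alpha> e) [^]\<^bsub>LH_group\<^esub> n = cf (gen (\<alpha> ^ n) c)"
    "\<And>x. tcomp (\<alpha> ^ n) c x = (tcomp \<alpha> e ^^ n) x"
    "\<And>\<psi>. \<alpha> *\<^sub>R \<psi> - tcomp \<alpha> e \<psi> = tLn e \<Longrightarrow> \<alpha> ^ n *\<^sub>R \<psi> - (tcomp \<alpha> e ^^ n) \<psi> = tLn c"
    using Suc by blast
  obtain b where b: "small b" "tcomp \<alpha> e (gen (\<alpha> ^ n) c) = gen (\<alpha> ^ n * \<alpha>) b" "tLn b = \<alpha> ^ n *\<^sub>R tLn e + tcomp \<alpha> e (tLn c)"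
    using tcomp_gen[OF \<alpha> e c(1)] .
  have pow: "cf (gen \<alpha> e) [^]\<^bsub>LH_group\<^esub> Suc n = cf (gen (\<alpha> ^ Suc n) b)"
  proof -
    have "cf (gen \<alpha> e) [^]\<^bsub>LH_group\<^esub> Suc n = (cf (gen \<alpha> e) [^]\<^bsub>LH_group\<^esub> n) \<circ>\<^sub>t cf (gen \<alpha> e)"
      by (simp add: nat_pow_def LH_group_def)
    then show ?thesis using b(2) by (simp add: c(2) cf_comp[OF \<alpha> e] mult.commute)
  qed
  have op: "tcomp (\<alpha> ^ Suc n) b x = (tcomp \<alpha> e ^^ Suc n) x" for x
    using tcomp_comp_gen[OF _ c(1) \<alpha> e b(2) b(1), of x] \<alpha> c(3) by (simp add: mult.commute)
  have rel: "\<alpha> ^ Suc n *\<^sub>R \<psi> - (tcomp \<alpha> e ^^ Suc n) \<psi> = tLn b" if "\<alpha> *\<^sub>R \<psi> - tcomp \<alpha> e \<psi> = tLn e" for \<psi>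
    unfolding b(3) c(4)[OF that, symmetric] that[symmetric]
    by (simp add: slin_diff[OF sC] slin_scaleR[OF sC] scaleR_diff_right mult.commute)
  show ?case using b(1) pow op rel by blast
qed

text \<open>For f^n = z^(\<alpha>^n) (1 + c) and \<theta> = log(1 + w), the series h o f^n has
  logarithmic part log(1 + c) + \<theta> o f^n. Inserting log(1 + c) = \<alpha>^n \<psi> - \<psi> o
  f^n and dividing by \<alpha>^n leaves \<psi> and the correction.\<close>

lemma boettcher_eq:
  assumes \<alpha>: "0 < \<alpha>" and e: "small e" and w: "small w" and \<psi>: "\<alpha> *\<^sub>R \<psi> - tcomp \<alpha> e \<psi> = tLn e"
  shows "boettcher \<alpha> (cf (gen \<alpha> e)) (cf (gen 1 w)) n =
    cf (mon (zm 1) * tExp (\<psi> + (1 / \<alpha> ^ n) *\<^sub>R (tcomp \<alpha> e ^^ n) (tLn w - \<psi>)))"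
proof -
  have an: "0 < \<alpha> ^ n" using \<alpha> by simp
  obtain c where c: "small c" "cf (gen \<alpha> e) [^]\<^bsub>LH_group\<^esub> n = cf (gen (\<alpha> ^ n) c)"
    "\<And>x. tcomp (\<alpha> ^ n) c x = (tcomp \<alpha> e ^^ n) x" "\<alpha> ^ n *\<^sub>R \<psi> - (tcomp \<alpha> e ^^ n) \<psi> = tLn c"
    using iterate_gen[OF \<alpha> e, of n] \<psi> by blast
  obtain v where v: "small v" "tcomp (\<alpha> ^ n) c (gen 1 w) = gen (1 * \<alpha> ^ n) v" "tLn v = 1 *\<^sub>R tLn c + tcomp (\<alpha> ^ n) c (tLn w)"
    using tcomp_gen[OF an c(1) w] .
  have "boettcher \<alpha> (cf (gen \<alpha> e)) (cf (gen 1 w)) n = cf (tcomp (\<alpha> ^ n) v (mon (zm (1 / \<alpha> ^ n))))"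
    using v(2) by (simp add: boettcher_def c(2) zpow_cf cf_comp an c(1) v(1))
  also have "tcomp (\<alpha> ^ n) v (mon (zm (1 / \<alpha> ^ n))) = mon (zm 1) * tExp ((1 / \<alpha> ^ n) *\<^sub>R tLn v)"
    using \<alpha> by (simp add: tcomp_zm[OF an v(1)] tBin_Exp_Ln[OF v(1)])
  also have "(1 / \<alpha> ^ n) *\<^sub>R tLn v = \<psi> + (1 / \<alpha> ^ n) *\<^sub>R (tcomp \<alpha> e ^^ n) (tLn w - \<psi>)"
  proof -
    have "(tcomp \<alpha> e ^^ n) (tLn w - \<psi>) = (tcomp \<alpha> e ^^ n) (tLn w) - (tcomp \<alpha> e ^^ n) \<psi>"
      using slin_diff[OF slin_tcomp[OF an c(1)], of "tLn w" \<psi>] by (simp add: c(3))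
    then have "tLn v = \<alpha> ^ n *\<^sub>R \<psi> + (tcomp \<alpha> e ^^ n) (tLn w - \<psi>)"
      by (simp add: v(3) c(3) c(4)[symmetric])
    then show ?thesis using \<alpha> by (simp add: scaleR_add_right)
  qed
  finally show ?thesis .
qed

lemma iterate_lead:
  assumes "0 < \<alpha>" "small e" "x \<noteq> 0" shows "(tcomp \<alpha> e ^^ n) x \<noteq> 0 \<and> ld ((tcomp \<alpha> e ^^ n) x) = sig (\<alpha> ^ n) (ld x)"
proof (induction n)
  case 0 then show ?case using assms by simp
next
  case (Suc n)
  then show ?case using tcomp_lead(2,3)[OF assms(1,2), of "(tcomp \<alpha> e ^^ n) x"] by (simp add: sig_sig)
qed

lemma ld_scaleR: "r \<noteq> 0 \<Longrightarrow> ld (r *\<^sub>R x) = ld x"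
proof -
  assume "r \<noteq> 0"
  then have "sp (r *\<^sub>R x) = sp x" by (auto simp: sp_def)
  then show ?thesis by (simp add: ld_def lead_def)
qed

section \<open>The normalization theorem\<close>

text \<open>Depth and order bounds are quantified inside the conclusion because they are needed for
  every \<open>k\<close> and \<delta> separately; uniqueness identifies the solutions constructed
  for each of them with one \<psi>.\<close>

lemma normalization_exists:
  assumes \<alpha>: "0 < \<alpha>" "\<alpha> \<noteq> 1" and e: "small e" and q: "q = (if 1 < \<alpha> then \<alpha> else 1 / \<alpha>)"
  obtains u where "small u" "\<And>\<phi>. is_normalization \<alpha> (cf (gen \<alpha> e)) \<phi> \<longleftrightarrow> \<phi> = cf (gen 1 u)"
    "\<alpha> *\<^sub>R tLn u - tcomp \<alpha> e (tLn u) = tLn e"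
    "\<And>k \<delta>. (\<And>a. a \<in> sp e \<Longrightarrow> dep k a) \<Longrightarrow> 0 \<le> \<delta> \<Longrightarrow> (\<And>a. a \<in> sp e \<Longrightarrow> \<delta> \<le> zexp a) \<Longrightarrow>
      sp (tLn u) \<subseteq> Gm k q (sp e) \<and> (\<forall>a\<in>sp (tLn u). \<delta> \<le> zexp a)"
proof -
  have unique: "x = y" if "small x" "small y" "\<alpha> *\<^sub>R x - tcomp \<alpha> e x = tLn e" "\<alpha> *\<^sub>R y - tcomp \<alpha> e y = tLn e" for x y
  proof -
    have "\<alpha> *\<^sub>R (x - y) = tcomp \<alpha> e (x - y)"
      using that(3,4) unfolding slin_diff[OF slin_tcomp[OF \<alpha>(1) e]] scaleR_diff_right by (simp add: algebra_simps)
    then have "x - y = 0" by (rule linear_unique[OF \<alpha> e small_diff[OF that(1,2)]])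
    then show ?thesis by simp
  qed
  have nn: "0 \<le> zexp a" if "a \<in> sp e" for a using smallD[OF e that] by (intro zexp_nonneg) simp
  obtain k where "\<And>a. a \<in> sp e \<Longrightarrow> dep k a" using adm_dep[OF adm_sp] by blast
  then obtain \<psi> where \<psi>: "small \<psi>" "\<alpha> *\<^sub>R \<psi> - tcomp \<alpha> e \<psi> = tLn e"
    using linear_solve[OF \<alpha> e _ order_refl nn q] by metis
  define u where "u = tExp \<psi> - 1"
  have u: "small u" "tLn u = \<psi>" using small_tExp[OF \<psi>(1)] tLn_tExp[OF \<psi>(1)] by (simp_all add: u_def)
  show thesis
  proof (rule that[OF u(1)])
    show "\<alpha> *\<^sub>R tLn u - tcomp \<alpha> e (tLn u) = tLn e" using \<psi> u by simp
    fix \<phi>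
    show "is_normalization \<alpha> (cf (gen \<alpha> e)) \<phi> \<longleftrightarrow> \<phi> = cf (gen 1 u)"
    proof
      assume n: "is_normalization \<alpha> (cf (gen \<alpha> e)) \<phi>"
      then obtain v where v: "small v" "\<phi> = cf (gen 1 v)" by (auto simp: is_normalization_def frakL0_iff)
      then have "\<alpha> *\<^sub>R tLn v - tcomp \<alpha> e (tLn v) = tLn e"
        using n is_normalization_iff[OF \<alpha>(1) e v(1)] normalization_linear[OF \<alpha>(1) e v(1)] by simp
      then have "tLn v = \<psi>" by (rule unique[OF small_tLn[OF v(1)] \<psi>(1) _ \<psi>(2)])
      then have "1 + v = 1 + u" using tExp_tLn[OF v(1)] by (simp add: u_def)
      then show "\<phi> = cf (gen 1 u)" using v(2) by simp
    next
      assume "\<phi> = cf (gen 1 u)"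
      then show "is_normalization \<alpha> (cf (gen \<alpha> e)) \<phi>"
        using \<psi>(2) is_normalization_iff[OF \<alpha>(1) e u(1)] normalization_linear[OF \<alpha>(1) e u(1)] u(2) by simp
    qed
  next
    fix k \<delta>
    assume k: "\<And>a. a \<in> sp e \<Longrightarrow> dep k a" and \<delta>: "0 \<le> \<delta>" "\<And>a. a \<in> sp e \<Longrightarrow> \<delta> \<le> zexp a"
    obtain \<psi>' where \<psi>': "small \<psi>'" "\<alpha> *\<^sub>R \<psi>' - tcomp \<alpha> e \<psi>' = tLn e" "sp \<psi>' \<subseteq> Gm k q (sp e)" "\<And>a. a \<in> sp \<psi>' \<Longrightarrow> \<delta> \<le> zexp a"
      using linear_solve[OF \<alpha> e k \<delta> q] by metis
    have "\<psi>' = \<psi>" by (rule unique[OF \<psi>'(1) \<psi>(1) \<psi>'(2) \<psi>(2)])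
    then show "sp (tLn u) \<subseteq> Gm k q (sp e) \<and> (\<forall>a\<in>sp (tLn u). \<delta> \<le> zexp a)" using \<psi>' u(2) by simp
  qed
qed

lemma sp_gen_diff: "sp (gen p e - mon (zm p)) = {a + zm p | a. a \<in> sp e}"
proof -
  have "c \<in> sp (gen p e - mon (zm p)) \<longleftrightarrow> c - zm p \<in> sp e" for c
    by (simp add: gen_diff sp_def cf_mon_times)
  then have "c \<in> sp (gen p e - mon (zm p)) \<longleftrightarrow> (\<exists>a. c = a + zm p \<and> a \<in> sp e)" for c
    by (metis add_diff_cancel_right' diff_add_cancel)
  then show ?thesis by blast
qed

lemma ld_gen_diff: assumes "e \<noteq> 0" shows "gen p e - mon (zm p) \<noteq> 0" "ld (gen p e - mon (zm p)) = zm p + ld e"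
proof -
  have "ld (mon (zm p)) = zm p" using gen_lead(2)[OF small_0, of p] by (simp add: gen_0)
  then show "gen p e - mon (zm p) \<noteq> 0" "ld (gen p e - mon (zm p)) = zm p + ld e"
    using assms by (simp_all add: gen_diff ld_mult)
qed

text \<open>For nonzero \<open>e\<close> and \<open>u\<close> the orders are \<alpha> +
  \<open>zexp (ld e)\<close> and 1 + \<open>zexp (ld u)\<close>, and \<open>u\<close> has the
  leading monomial of its logarithm; so the bound for \<delta> = \<open>zexp (ld e)\<close> is the
  claim.\<close>

lemma ord_z_normalization:
  assumes \<alpha>: "0 < \<alpha>" "\<alpha> \<noteq> 1" and e: "small e" and u: "small u"
    and lin: "\<alpha> *\<^sub>R tLn u - tcomp \<alpha> e (tLn u) = tLn e"
    and \<delta>: "\<And>\<delta>. 0 \<le> \<delta> \<Longrightarrow> (\<And>a. a \<in> sp e \<Longrightarrow> \<delta> \<le> zexp a) \<Longrightarrow> \<forall>a\<in>sp (tLn u). \<delta> \<le> zexp a"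
  shows "ord_z (cf (gen \<alpha> e) - zpow \<alpha>) - ereal \<alpha> + 1 \<le> ord_z (cf (gen 1 u) - zpow 1)"
proof (cases "u = 0")
  case True
  then show ?thesis by (simp add: zpow_cf cf_diff[symmetric] ord_z_cf gen_0)
next
  case False
  have Lu: "tLn u \<noteq> 0" using tExp_tLn[OF u] False by force
  have e0: "e \<noteq> 0"
  proof
    assume "e = 0"
    then have "\<alpha> *\<^sub>R tLn u = tcomp \<alpha> e (tLn u)" using lin tLn_tExp[of 0] by simp
    then show False using linear_unique[OF \<alpha> e small_tLn[OF u]] Lu by blast
  qed
  have "0 \<le> zexp (ld e)" using smallD[OF e ld_in[OF e0]] by (intro zexp_nonneg) simp
  then have "\<forall>a\<in>sp (tLn u). zexp (ld e) \<le> zexp a" using ld_le[OF e0] by (intro \<delta> zexp_mono)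
  then have "zexp (ld e) \<le> zexp (ld (tLn u))" using ld_in[OF Lu] by blast
  moreover have "ld u = ld (tLn u)"
    using ld_tExp_minus_1[OF small_tLn[OF u] Lu] tExp_tLn[OF u] by simp
  ultimately have "zexp (ld e) \<le> zexp (ld u)" by simp
  then show ?thesis
    using ld_gen_diff[OF e0, of \<alpha>] ld_gen_diff[OF False, of 1]
    by (simp add: zpow_cf cf_diff[symmetric] ord_z_cf one_ereal_def)
qed

lemma sp_parabolic:
  assumes u: "small u" and c: "c \<in> sp (gen 1 u)" obtains a where "a \<in> mgen (sp (tLn u))" "c = zm 1 + a"
proof -
  have "c \<in> sp (mon (zm 1) * tExp (tLn u))" using c one_plus_tExp[OF u] by simp
  then have "c \<in> {zm 1} + sp (tExp (tLn u))" using sp_times[of "mon (zm 1)" "tExp (tLn u)"] by (auto simp: sp_mon)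
  then obtain a where "a \<in> sp (tExp (tLn u))" "c = zm 1 + a" by (auto simp: set_plus_def)
  then show thesis using that sp_tExp[OF small_tLn[OF u]] by blast
qed

lemma dep_parabolic:
  assumes u: "small u" and d: "\<And>a. a \<in> sp (tLn u) \<Longrightarrow> dep k a" shows "\<forall>a\<in>sp u. dep k a"
proof
  fix a assume a: "a \<in> sp u"
  then have "a \<in> sp (tExp (tLn u))"
    using smallD[OF u a] tExp_tLn[OF u] by (auto simp: sp_def cf_one)
  then have "a \<in> mgen (sp (tLn u))" using sp_tExp[OF small_tLn[OF u]] by blast
  then show "dep k a" by (rule dep_mgen) (rule d)
qed

lemma support_normalization:
  assumes u: "small u" and sub: "sp (tLn u) \<subseteq> Gm k q (sp e)"
    and J: "0 \<in> J" "\<And>m::nat. \<exists>j\<in>J. q ^ m = \<alpha> powi j"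
  shows "supp (cf (gen 1 u)) \<subseteq> semigroup_generated (support_generators J k \<alpha> (cf (gen \<alpha> e)))"
proof
  let ?H = "support_generators J k \<alpha> (cf (gen \<alpha> e))"
  have gens: "a \<in> ?H" if a: "a \<in> {lunit i | i. i < k} \<union> orb q (sp e)" for a
  proof (cases "a \<in> orb q (sp e)")
    case True
    then obtain m b where b: "b \<in> sp e" "a = sig (q ^ m) b" by (auto simp: orb_def)
    obtain j where j: "j \<in> J" "q ^ m = \<alpha> powi j" using J(2) by blast
    have "b + zm \<alpha> \<in> supp (cf (gen \<alpha> e) - zpow \<alpha>)"
      using b(1) sp_gen_diff[of \<alpha> e] by (auto simp: zpow_cf cf_diff[symmetric])
    moreover have "a = LMon (\<alpha> powi j * (zexp (b + zm \<alpha>) - \<alpha>)) (lexp (b + zm \<alpha>))"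
      using b j by (intro lmon_eqI) auto
    ultimately show ?thesis using j(1) unfolding support_generators_def by blast
  next
    case False
    then show ?thesis using a unfolding support_generators_def by blast
  qed
  have z: "zm 1 \<in> semigroup_generated ?H"
  proof (rule semigroup_generated.gen)
    have "zm 1 = LMon (\<alpha> powi 0) (\<lambda>_. 0)" by (simp add: zm_def)
    then show "zm 1 \<in> ?H" using J(1) unfolding support_generators_def by blast
  qed
  have G: "x + a \<in> semigroup_generated ?H" if "a \<in> Gm k q (sp e)" "x \<in> semigroup_generated ?H" for a x
    using that(1)[unfolded Gm_def] that(2)
  proof (induction arbitrary: x rule: mgen_induct)
    case (add a b)
    have "x + a \<in> semigroup_generated ?H"
      by (rule semigroup_generated.add[OF add.prems semigroup_generated.gen[OF gens[OF add.hyps(1)]]])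
    from add.IH[OF this] show ?case by (simp add: add.assoc)
  qed simp
  fix c assume "c \<in> supp (cf (gen 1 u))"
  then have "c \<in> sp (gen 1 u)" by simp
  then obtain a where a: "a \<in> mgen (sp (tLn u))" "c = zm 1 + a" using sp_parabolic[OF u] by blast
  have "mgen (sp (tLn u)) \<subseteq> Gm k q (sp e)"
  proof
    fix b assume "b \<in> mgen (sp (tLn u))"
    then show "b \<in> Gm k q (sp e)"
    proof (induction rule: mgen_induct)
      case (add a b)
      then show ?case using sub by (intro Gm_add) auto
    qed (simp add: Gm_def)
  qed
  then show "c \<in> semigroup_generated ?H" using a G[OF _ z] by auto
qed

text \<open>With \<psi> = log(\<phi> / z) and x = log(h / \<phi>) the iterate is z exp(\<psi> +
  \<open>X n\<close>); both limits are governed by \<open>X n\<close> and the leading blocks by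
  \<open>x\<close>.\<close>

lemma boettcher_limits:
  assumes \<alpha>: "1 < \<alpha>" and e: "small e" and u: "small u" and w: "small w"
    and lin: "\<alpha> *\<^sub>R tLn u - tcomp \<alpha> e (tLn u) = tLn e"
  defines "B \<equiv> boettcher \<alpha> (cf (gen \<alpha> e)) (cf (gen 1 w))"
  shows "\<forall>n. B n \<in> frakL0"
    "limitin (weak_topology_on frakL0) B (cf (gen 1 u)) sequentially"
    "(\<exists>\<psi>. limitin (power_metric_topology_on frakL0) B \<psi> sequentially) \<longleftrightarrow> Lb_z (cf (gen 1 w)) = Lb_z (cf (gen 1 u))"
proof -
  have a0: "0 < \<alpha>" using \<alpha> by simp
  define \<psi> where "\<psi> = tLn u"
  define x where "x = tLn w - \<psi>"
  define X where "X n = (1 / \<alpha> ^ n) *\<^sub>R (tcomp \<alpha> e ^^ n) x" for n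
  have \<psi>: "small \<psi>" and x: "small x" using u w by (auto simp: \<psi>_def x_def intro: small_tLn small_diff)
  have u_eq: "gen 1 u = mon (zm 1) * tExp \<psi>" using one_plus_tExp[OF u] by (simp add: \<psi>_def)
  have w_eq: "gen 1 w = mon (zm 1) * tExp (\<psi> + x)" using one_plus_tExp[OF w] by (simp add: \<psi>_def x_def)
  have B_eq: "B n = cf (mon (zm 1) * tExp (\<psi> + X n))" for n
    unfolding B_def boettcher_eq[OF a0 e w lin] by (simp add: X_def x_def \<psi>_def)
  obtain V where V: "adm V" "\<And>a. a \<in> V \<Longrightarrow> 0 < a" "\<And>n. sp (X n) \<subseteq> V" "\<And>c. (\<lambda>n. cf (X n) c) \<longlonglongrightarrow> 0"
    using iterates_tendsto_0[OF \<alpha> e x] unfolding X_def by metis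
  have smX: "small (X n)" for n using V(2,3) by (auto simp: small_def)
  have BL0: "B n \<in> frakL0" for n
    unfolding B_eq frakL0_iff gen_tExp(1)[OF small_add[OF \<psi> smX]] using gen_tExp(2)[OF small_add[OF \<psi> smX]] by blast
  then show "\<forall>n. B n \<in> frakL0" by blast
  have uL0: "cf (gen 1 u) \<in> frakL0" using u frakL0_iff by blast
  have conv: "(\<lambda>n. B n c) \<longlonglongrightarrow> cf (gen 1 u) c" for c
  proof -
    have Vwo: "well_ordered (sp \<psi> \<union> V)" using adm_un[OF adm_sp V(1)] by (simp add: adm_def)
    have Vpos: "\<And>a. a \<in> sp \<psi> \<union> V \<Longrightarrow> 0 < a" using V(2) \<psi> by (auto simp: small_def)
    have sub: "sp (\<psi> + X n) \<subseteq> sp \<psi> \<union> V" for n using sp_add[of \<psi> "X n"] V(3)[of n] by blast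
    have "(\<lambda>n. cf (\<psi> + X n) c) \<longlonglongrightarrow> cf \<psi> c" for c
      using tendsto_add[OF tendsto_const[of "cf \<psi> c"] V(4)[of c]] by simp
    from tendsto_fev_cf[OF Vwo Vpos sub _ this]
    have "(\<lambda>n. cf (tExp (\<psi> + X n)) d) \<longlonglongrightarrow> cf (tExp \<psi>) d" for d unfolding tExp_def by blast
    then show ?thesis unfolding B_eq u_eq by (simp add: cf_mon_times)
  qed
  show "limitin (weak_topology_on frakL0) B (cf (gen 1 u)) sequentially"
    unfolding weak_topology_on_def limitin_subtopology limitin_componentwise
    using BL0 uL0 conv by simp
  \<comment> \<open>For nonzero \<open>x\<close> the leading monomial of \<open>X n\<close> is
    \<open>sig (\<alpha> ^ n) (ld x)\<close>, so the distance is known exactly: it tends to 0 if the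
    z-exponent of \<open>ld x\<close> is positive and is constantly 1 / 2 if it is 0.\<close>
  have d_eq: "d_z (B n) (cf (gen 1 u)) = (if x = 0 then 0 else 2 powr (- (1 + \<alpha> ^ n * zexp (ld x))))" for n
  proof (cases "x = 0")
    case True
    have "(tcomp \<alpha> e ^^ n) 0 = 0" by (induction n) (simp_all add: slin_0[OF slin_tcomp[OF a0 e]])
    then have "X n = 0" using True by (simp add: X_def)
    then show ?thesis using True by (simp add: B_eq u_eq d_z_cf)
  next
    case False
    have "ld (X n) = sig (\<alpha> ^ n) (ld x)" "X n \<noteq> 0"
      using iterate_lead[OF a0 e False, of n] a0 by (simp_all add: X_def ld_scaleR)
    then show ?thesis using gen_tExp_diff[OF \<psi> smX] False by (simp add: B_eq u_eq d_z_cf)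
  qed
  have Lb: "Lb_z (cf (gen 1 w)) = Lb_z (cf (gen 1 u)) \<longleftrightarrow> x = 0 \<or> 0 < zexp (ld x)"
    unfolding w_eq u_eq by (rule Lb_z_eq_iff[OF \<psi> x])
  show "(\<exists>\<psi>. limitin (power_metric_topology_on frakL0) B \<psi> sequentially) \<longleftrightarrow> Lb_z (cf (gen 1 w)) = Lb_z (cf (gen 1 u))"
    unfolding Lb
  proof
    assume "x = 0 \<or> 0 < zexp (ld x)"
    then have "(\<lambda>n. d_z (B n) (cf (gen 1 u))) \<longlonglongrightarrow> 0"
    proof
      assume z: "0 < zexp (ld x)"
      have "filterlim (\<lambda>n. \<alpha> ^ n) at_top sequentially"
        using filterlim_at_infinity_imp_filterlim_at_top[OF filterlim_realpow_sequentially_gt1[of \<alpha>]] \<alpha> by simp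
      then have "filterlim (\<lambda>n. \<alpha> ^ n * zexp (ld x)) at_top sequentially"
        by (rule filterlim_at_top_mult_tendsto_pos[OF tendsto_const z])
      then have "filterlim (\<lambda>n. 1 + \<alpha> ^ n * zexp (ld x)) at_top sequentially"
        by (rule filterlim_tendsto_add_at_top[OF tendsto_const])
      then have "filterlim (\<lambda>n. (1 + \<alpha> ^ n * zexp (ld x)) * ln 2) at_top sequentially"
        by (rule filterlim_at_top_mult_tendsto_pos[OF tendsto_const, rotated]) simp
      then have "filterlim (\<lambda>n. - ((1 + \<alpha> ^ n * zexp (ld x)) * ln 2)) at_bot sequentially"
        by (simp only: filterlim_uminus_at_bot minus_minus)
      from filterlim_compose[OF exp_at_bot this]
      have "(\<lambda>n. 2 powr (- (1 + \<alpha> ^ n * zexp (ld x)))) \<longlonglongrightarrow> 0"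
        by (simp only: powr_def mult_minus_left) simp
      then show ?thesis unfolding d_eq by (cases "x = 0") auto
    qed (simp add: d_eq)
    then have "\<forall>\<^sub>F n in sequentially. d_z (B n) (cf (gen 1 u)) < \<epsilon>" if "0 < \<epsilon>" for \<epsilon>
      using that by (rule order_tendstoD(2))
    moreover have "B n \<in> frakLinf" for n unfolding B_eq by (rule cf)
    ultimately show "\<exists>\<psi>. limitin (power_metric_topology_on frakL0) B \<psi> sequentially"
      unfolding limitin_power_metric using uL0 BL0 by auto
  next
    assume "\<exists>\<psi>. limitin (power_metric_topology_on frakL0) B \<psi> sequentially"
    then obtain \<chi> where lim: "limitin (power_metric_topology_on frakL0) B \<chi> sequentially" by blast
    have \<chi>: "\<chi> \<in> frakL0" using lim unfolding limitin_power_metric by blast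
    have dist: "\<forall>\<^sub>F n in sequentially. d_z (B n) \<chi> < \<epsilon>" if "0 < \<epsilon>" for \<epsilon>
    proof -
      have "\<forall>\<^sub>F n in sequentially. B n \<in> frakLinf \<and> d_z (B n) \<chi> < \<epsilon>"
        using lim that unfolding limitin_power_metric by blast
      then show ?thesis by (rule eventually_mono) simp
    qed
    obtain y where y: "\<chi> = cf y" using \<chi> by (auto simp: frakL0_iff)
    \<comment> \<open>A power-metric limit is also the coefficientwise limit: at distance below
      \<open>2 powr (- zexp c)\<close> the coefficients at \<open>c\<close> coincide.\<close>
    have "\<chi> c = cf (gen 1 u) c" for c
    proof (rule LIMSEQ_unique[OF _ conv])
      have "\<forall>\<^sub>F n in sequentially. d_z (B n) \<chi> < 2 powr (- zexp c)" by (rule dist) simp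
      then have "\<forall>\<^sub>F n in sequentially. B n c = \<chi> c"
      proof (rule eventually_mono)
        fix n assume d: "d_z (B n) \<chi> < 2 powr (- zexp c)"
        let ?b = "mon (zm 1) * tExp (\<psi> + X n)"
        show "B n c = \<chi> c"
        proof (rule ccontr)
          assume ne: "B n c \<noteq> \<chi> c"
          then have "c \<in> sp (?b - y)" by (simp add: B_eq y sp_def)
          moreover from this have "?b - y \<noteq> 0" by auto
          ultimately have "zexp (ld (?b - y)) \<le> zexp c" by (intro zexp_mono ld_le)
          then show False using d \<open>?b - y \<noteq> 0\<close> by (simp add: B_eq y d_z_cf)
        qed
      qed
      then show "(\<lambda>n. B n c) \<longlonglongrightarrow> \<chi> c" by (rule tendsto_eventually)
    qed
    then have "\<chi> = cf (gen 1 u)" by (rule ext)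
    then have "\<forall>\<^sub>F n in sequentially. d_z (B n) (cf (gen 1 u)) < 2 powr (- 1)" using dist[of "2 powr (- 1)"] by simp
    \<comment> \<open>A distance below 1 / 2 rules out the constant distance that belongs to
      z-exponent 0.\<close>
    then obtain n where "d_z (B n) (cf (gen 1 u)) < 2 powr (- 1)" by (auto simp: eventually_sequentially)
    then have "x = 0 \<or> 0 < \<alpha> ^ n * zexp (ld x)" unfolding d_eq by (cases "x = 0") (simp_all only: if_False powr_less_cancel_iff, simp_all)
    then show "x = 0 \<or> 0 < zexp (ld x)" using a0 by (auto simp: zero_less_mult_iff)
  qed
qed

theorem theoremA:
  fixes f :: lts and \<alpha> :: real
  assumes "f \<in> frakLH" and "0 < \<alpha>" and "\<alpha> \<noteq> 1" and "hot f (zpow \<alpha>)"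
  shows "(\<exists>!\<phi>. is_normalization \<alpha> f \<phi>) \<and>
    (\<forall>\<phi>. is_normalization \<alpha> f \<phi> \<longrightarrow>
       ord_z (f - zpow \<alpha>) - ereal \<alpha> + 1 \<le> ord_z (\<phi> - zpow 1)
     \<and> (\<forall>k. f \<in> LH k \<longrightarrow> \<phi> \<in> L0 k)
     \<and> (1 < \<alpha> \<longrightarrow> (\<forall>h\<in>frakL0.
            (\<forall>n. boettcher \<alpha> f h n \<in> frakL0)
          \<and> limitin (weak_topology_on frakL0) (boettcher \<alpha> f h) \<phi> sequentially
          \<and> ((\<exists>\<psi>. limitin (power_metric_topology_on frakL0) (boettcher \<alpha> f h) \<psi> sequentially)
               \<longleftrightarrow> Lb_z h = Lb_z \<phi>)))
     \<and> (\<forall>k. f \<in> Lts k \<longrightarrow>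
            (1 < \<alpha> \<longrightarrow> supp \<phi> \<subseteq> semigroup_generated (support_generators {0..} k \<alpha> f))
          \<and> (\<alpha> < 1 \<longrightarrow> supp \<phi> \<subseteq> semigroup_generated (support_generators UNIV k \<alpha> f))))"
proof -
  obtain y where "f = cf y" using frakLH_cf[OF assms(1)] .
  then obtain e where e: "small e" and f: "f = cf (gen \<alpha> e)" using assms(4) hot_gen by auto
  define q where "q = (if 1 < \<alpha> then \<alpha> else 1 / \<alpha>)"
  obtain u where u: "small u" and norm: "\<And>\<phi>. is_normalization \<alpha> f \<phi> \<longleftrightarrow> \<phi> = cf (gen 1 u)"
    and lin: "\<alpha> *\<^sub>R tLn u - tcomp \<alpha> e (tLn u) = tLn e"
    and sup: "\<And>k \<delta>. (\<And>a. a \<in> sp e \<Longrightarrow> dep k a) \<Longrightarrow> 0 \<le> \<delta> \<Longrightarrow> (\<And>a. a \<in> sp e \<Longrightarrow> \<delta> \<le> zexp a) \<Longrightarrow>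
      sp (tLn u) \<subseteq> Gm k q (sp e) \<and> (\<forall>a\<in>sp (tLn u). \<delta> \<le> zexp a)"
    by (rule normalization_exists[OF assms(2,3) e q_def, folded f]) blast
  have nn: "0 \<le> zexp a" if "a \<in> sp e" for a using smallD[OF e that] by (intro zexp_nonneg) simp
  have dep: "f \<in> Lts k \<longleftrightarrow> (\<forall>a\<in>sp e. dep k a)" for k unfolding f by (rule gen_Lts[OF assms(2) e])
  have supG: "sp (tLn u) \<subseteq> Gm k q (sp e)" if "f \<in> Lts k" for k using sup[of k 0] nn that dep by simp
  obtain k0 where k0: "\<And>a. a \<in> sp e \<Longrightarrow> dep k0 a" using adm_dep[OF adm_sp] by blast
  have P1: "ord_z (f - zpow \<alpha>) - ereal \<alpha> + 1 \<le> ord_z (cf (gen 1 u) - zpow 1)"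
    unfolding f using sup[OF k0] by (intro ord_z_normalization[OF assms(2,3) e u lin]) blast
  have P2: "\<forall>k. f \<in> LH k \<longrightarrow> cf (gen 1 u) \<in> L0 k"
  proof (intro allI impI)
    fix k assume "f \<in> LH k"
    then have L: "f \<in> Lts k" by (simp add: LH_def)
    have "dep k a" if "a \<in> sp (tLn u)" for a
      using supG[OF L] Gm_dep[of "sp e" k a q] dep[of k] L that by blast
    then have "\<forall>a\<in>sp u. dep k a" by (rule dep_parabolic[OF u])
    then show "cf (gen 1 u) \<in> L0 k" using u L0_iff by blast
  qed
  have P3: "1 < \<alpha> \<longrightarrow> (\<forall>h\<in>frakL0.
            (\<forall>n. boettcher \<alpha> f h n \<in> frakL0)
          \<and> limitin (weak_topology_on frakL0) (boettcher \<alpha> f h) (cf (gen 1 u)) sequentially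
          \<and> ((\<exists>\<psi>. limitin (power_metric_topology_on frakL0) (boettcher \<alpha> f h) \<psi> sequentially)
               \<longleftrightarrow> Lb_z h = Lb_z (cf (gen 1 u))))"
  proof (intro impI ballI)
    fix h assume "1 < \<alpha>" "h \<in> frakL0"
    then obtain w where w: "small w" "h = cf (gen 1 w)" by (auto simp: frakL0_iff)
    show "(\<forall>n. boettcher \<alpha> f h n \<in> frakL0)
          \<and> limitin (weak_topology_on frakL0) (boettcher \<alpha> f h) (cf (gen 1 u)) sequentially
          \<and> ((\<exists>\<psi>. limitin (power_metric_topology_on frakL0) (boettcher \<alpha> f h) \<psi> sequentially)
               \<longleftrightarrow> Lb_z h = Lb_z (cf (gen 1 u)))"
      unfolding w(2) f by (intro conjI boettcher_limits[OF \<open>1 < \<alpha>\<close> e u w(1) lin])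
  qed
  have P4: "\<forall>k. f \<in> Lts k \<longrightarrow>
            (1 < \<alpha> \<longrightarrow> supp (cf (gen 1 u)) \<subseteq> semigroup_generated (support_generators {0..} k \<alpha> f))
          \<and> (\<alpha> < 1 \<longrightarrow> supp (cf (gen 1 u)) \<subseteq> semigroup_generated (support_generators UNIV k \<alpha> f))"
  proof (intro allI impI conjI)
    fix k assume L: "f \<in> Lts k" and a: "1 < \<alpha>"
    have "q ^ m = \<alpha> powi int m" for m using a by (simp add: q_def power_int_def)
    then show "supp (cf (gen 1 u)) \<subseteq> semigroup_generated (support_generators {0..} k \<alpha> f)"
      unfolding f by (intro support_normalization[OF u supG[OF L]]) (auto intro: bexI[of _ "int m" for m])
  next
    fix k assume L: "f \<in> Lts k" and a: "\<alpha> < 1"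
    have "q ^ m = \<alpha> powi (- int m)" for m
      using a by (simp add: q_def power_int_minus power_one_over inverse_eq_divide)
    then show "supp (cf (gen 1 u)) \<subseteq> semigroup_generated (support_generators UNIV k \<alpha> f)"
      unfolding f by (intro support_normalization[OF u supG[OF L]]) auto
  qed
  show ?thesis unfolding norm using P1 P2 P3 P4 by (simp only: ex1_eq simp_thms)
qed

end
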